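(* Let $F(X,Y)$ be a relational specification with inputs $X=\{X_1,\dots,X_n\}$ and outputs $Y=\{Y_1,\dots,Y_m\}$. If there exists an ordered set of Skolem functions $\Psi^*$ for $F$ with $|\mathrm{Im}(\Psi^* )|=k$, then there is a randomized algorithm with access to an NP oracle that synthesizes Skolem functions for $F$ in time $\mathrm{poly}(n,m,|F|,k)$.
   Context: $F(X,Y)$ is a Boolean formula/relation over Boolean input variables $X$ and Boolean output variables $Y$, and $|F|$ is its size. Skolem functions for $F$ are an $m$-tuple $\Psi=\langle\psi_1,\dots,\psi_m\rangle$ of Boolean functions (output as circuits) such that $\exists Y\,F(X,Y)\equiv F(X,\Psi(X))$, where $F(X,\Psi(X))$ is the substitution of $\psi_i(X)$ for each $Y_i$. It is not required that $\forall X\,\exists Y\,F(X,Y)$ holds. The image of $\Psi$ is $$\mathrm{Im}(\Psi)=\{\Psi(\vec x):\vec x\in\{0,1\}^n\text{ and }F(\vec x,\Psi(\vec x))=1\}.$$ *)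

theory Defs
  imports "HOL-Probability.Probability_Mass_Function"
begin

section \<open>Relational specifications and Skolem functions\<close>

text \<open>\<open>X i\<close> and \<open>Y j\<close> are 0-based: a specification with \<open>n\<close> inputs and \<open>m\<close> outputs uses
  \<open>X 0, \<dots>, X (n - 1)\<close> and \<open>Y 0, \<dots>, Y (m - 1)\<close>.\<close>

datatype var = X nat | Y nat

datatype formula =
    Const bool
  | Atom var
  | Neg formula
  | Conj formula formula
  | Disj formula formula

primrec vars :: "formula \<Rightarrow> var set" where
  "vars (Const b) = {}"
| "vars (Atom v) = {v}"
| "vars (Neg F) = vars F"
| "vars (Conj F G) = vars F \<union> vars G"
| "vars (Disj F G) = vars F \<union> vars G"

primrec fsize :: "formula \<Rightarrow> nat" where
  "fsize (Const b) = 1"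
| "fsize (Atom v) = 1"
| "fsize (Neg F) = 1 + fsize F"
| "fsize (Conj F G) = 1 + fsize F + fsize G"
| "fsize (Disj F G) = 1 + fsize F + fsize G"

primrec holds :: "formula \<Rightarrow> bool list \<Rightarrow> bool list \<Rightarrow> bool" where
  "holds (Const b) x y = b"
| "holds (Atom v) x y = (case v of X i \<Rightarrow> x ! i | Y j \<Rightarrow> y ! j)"
| "holds (Neg F) x y = (\<not> holds F x y)"
| "holds (Conj F G) x y = (holds F x y \<and> holds G x y)"
| "holds (Disj F G) x y = (holds F x y \<or> holds G x y)"

definition is_spec :: "nat \<Rightarrow> nat \<Rightarrow> formula \<Rightarrow> bool" where
  "is_spec n m F \<longleftrightarrow> vars F \<subseteq> X ` {..<n} \<union> Y ` {..<m}"

definition bits :: "nat \<Rightarrow> bool list set" where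
  "bits n = {x. length x = n}"

text \<open>Boolean functions of \<open>n\<close> arguments are functions on \<^typ>\<open>bool list\<close>; only their values on
  \<^term>\<open>bits n\<close> matter.\<close>

definition app_tuple :: "(bool list \<Rightarrow> bool) list \<Rightarrow> bool list \<Rightarrow> bool list" where
  "app_tuple \<Psi> x = map (\<lambda>\<psi>. \<psi> x) \<Psi>"

definition skolem :: "nat \<Rightarrow> nat \<Rightarrow> formula \<Rightarrow> (bool list \<Rightarrow> bool) list \<Rightarrow> bool" where
  "skolem n m F \<Psi> \<longleftrightarrow> length \<Psi> = m \<and>
     (\<forall>x \<in> bits n. (\<exists>y \<in> bits m. holds F x y) \<longleftrightarrow> holds F x (app_tuple \<Psi> x))"

definition skolem_image :: "nat \<Rightarrow> formula \<Rightarrow> (bool list \<Rightarrow> bool) list \<Rightarrow> bool list set" where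
  "skolem_image n F \<Psi> = {app_tuple \<Psi> x |x. x \<in> bits n \<and> holds F x (app_tuple \<Psi> x)}"


section \<open>Boolean circuits\<close>

text \<open>A circuit is a straight-line program. The arguments of \<open>GNot\<close>, \<open>GAnd\<close>, \<open>GOr\<close> are
  positions of earlier gates, and the last gate is the output gate.\<close>

datatype gate = GConst bool | GIn nat | GNot nat | GAnd nat nat | GOr nat nat

type_synonym circuit = "gate list"

primrec gate_ok :: "nat \<Rightarrow> nat \<Rightarrow> gate \<Rightarrow> bool" where
  "gate_ok n p (GConst b) = True"
| "gate_ok n p (GIn i) = (i < n)"
| "gate_ok n p (GNot a) = (a < p)"
| "gate_ok n p (GAnd a b) = (a < p \<and> b < p)"
| "gate_ok n p (GOr a b) = (a < p \<and> b < p)"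

definition circuit_ok :: "nat \<Rightarrow> circuit \<Rightarrow> bool" where
  "circuit_ok n C \<longleftrightarrow> C \<noteq> [] \<and> (\<forall>p < length C. gate_ok n p (C ! p))"

primrec gate_val :: "bool list \<Rightarrow> bool list \<Rightarrow> gate \<Rightarrow> bool" where
  "gate_val x vs (GConst b) = b"
| "gate_val x vs (GIn i) = x ! i"
| "gate_val x vs (GNot a) = (\<not> vs ! a)"
| "gate_val x vs (GAnd a b) = (vs ! a \<and> vs ! b)"
| "gate_val x vs (GOr a b) = (vs ! a \<or> vs ! b)"

definition circuit_fun :: "circuit \<Rightarrow> bool list \<Rightarrow> bool" where
  "circuit_fun C x = last (foldl (\<lambda>vs g. vs @ [gate_val x vs g]) [] C)"


section \<open>Randomized oracle programs\<close>

text \<open>The machine model is Jones's language WHILE over binary trees, extended by coin tosses and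
  oracle queries. Evaluating an expression is charged with the sizes, as unshared trees, of the
  values of all its subexpressions. Hence a run of time \<open>t\<close> only builds and queries trees of size at
  most \<open>t\<close>, and running times agree with those of Turing machines up to a polynomial.\<close>

datatype tree = Leaf | Node tree tree

primrec tsize :: "tree \<Rightarrow> nat" where
  "tsize Leaf = 1"
| "tsize (Node l r) = 1 + tsize l + tsize r"

primrec left :: "tree \<Rightarrow> tree" where
  "left Leaf = Leaf"
| "left (Node l r) = l"

primrec right :: "tree \<Rightarrow> tree" where
  "right Leaf = Leaf"
| "right (Node l r) = r"

definition tree_of_bool :: "bool \<Rightarrow> tree" where
  "tree_of_bool b = (if b then Node Leaf Leaf else Leaf)"

type_synonym store = "nat \<Rightarrow> tree"

datatype expr =
    Null
  | Var nat
  | Join expr expr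
  | Fst expr
  | Snd expr
  | Equal expr expr

primrec val :: "expr \<Rightarrow> store \<Rightarrow> tree" where
  "val Null s = Leaf"
| "val (Var x) s = s x"
| "val (Join e f) s = Node (val e s) (val f s)"
| "val (Fst e) s = left (val e s)"
| "val (Snd e) s = right (val e s)"
| "val (Equal e f) s = tree_of_bool (val e s = val f s)"

primrec cost :: "expr \<Rightarrow> store \<Rightarrow> nat" where
  "cost Null s = 1"
| "cost (Var x) s = tsize (s x)"
| "cost (Join e f) s = cost e s + cost f s + tsize (val (Join e f) s)"
| "cost (Fst e) s = cost e s + tsize (val (Fst e) s)"
| "cost (Snd e) s = cost e s + tsize (val (Snd e) s)"
| "cost (Equal e f) s = cost e s + cost f s + tsize (val (Equal e f) s)"

datatype com =
    Skip
  | Assign nat expr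
  | Seq com com
  | Cond expr com com
  | While expr com
  | Toss nat
  | Query nat expr

text \<open>\<open>exec L c s r t s' r'\<close>: with oracle \<open>L\<close>, program \<open>c\<close> started in store \<open>s\<close> with random
  tape \<open>r\<close> halts after time \<open>t\<close> in store \<open>s'\<close>, leaving the unread part \<open>r'\<close> of the tape. A toss
  on an exhausted tape gets stuck.\<close>

inductive exec ::
  "tree set \<Rightarrow> com \<Rightarrow> store \<Rightarrow> bool list \<Rightarrow> nat \<Rightarrow> store \<Rightarrow> bool list \<Rightarrow> bool"
  for L :: "tree set" where
  Skip: "exec L Skip s r 1 s r"
| Assign: "exec L (Assign x e) s r (1 + cost e s) (s(x := val e s)) r"
| Seq: "exec L c s r t s' r' \<Longrightarrow> exec L d s' r' t' s'' r'' \<Longrightarrow>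
    exec L (Seq c d) s r (t + t') s'' r''"
| CondTrue: "val e s \<noteq> Leaf \<Longrightarrow> exec L c s r t s' r' \<Longrightarrow>
    exec L (Cond e c d) s r (1 + cost e s + t) s' r'"
| CondFalse: "val e s = Leaf \<Longrightarrow> exec L d s r t s' r' \<Longrightarrow>
    exec L (Cond e c d) s r (1 + cost e s + t) s' r'"
| WhileFalse: "val e s = Leaf \<Longrightarrow>
    exec L (While e c) s r (1 + cost e s) s r"
| WhileTrue: "val e s \<noteq> Leaf \<Longrightarrow> exec L c s r t s' r' \<Longrightarrow>
    exec L (While e c) s' r' t' s'' r'' \<Longrightarrow>
    exec L (While e c) s r (1 + cost e s + t + t') s'' r''"
| Toss: "exec L (Toss x) s (b # r) 1 (s(x := tree_of_bool b)) r"
| Query: "exec L (Query x e) s r (1 + cost e s) (s(x := tree_of_bool (val e s \<in> L))) r"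

inductive_cases exec_cases:
  "exec L Skip s r t s' r'"
  "exec L (Assign x e) s r t s' r'"
  "exec L (Seq c d) s r t s' r'"
  "exec L (Cond e c d) s r t s' r'"
  "exec L (While e c) s r t s' r'"
  "exec L (Toss x) s r t s' r'"
  "exec L (Query x e) s r t s' r'"

lemma exec_deterministic:
  assumes "exec L c s r t s' r'" and "exec L c s r u s'' r''"
  shows "u = t \<and> s'' = s' \<and> r'' = r'"
  using assms
proof (induction arbitrary: u s'' r'' rule: exec.induct)
  case (Skip s r)
  from Skip.prems show ?case by (rule exec_cases(1)) auto
next
  case (Assign x e s r)
  from Assign.prems show ?case by (rule exec_cases(2)) auto
next
  case (Seq c s r t s' r' d t' s2 r2)
  from Seq.prems obtain t1 s1 r1 t2
    where *: "exec L c s r t1 s1 r1" "exec L d s1 r1 t2 s'' r''" "u = t1 + t2"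
    by (rule exec_cases(3)) auto
  from Seq.IH(1)[OF *(1)] have "t1 = t" "s1 = s'" "r1 = r'" by auto
  with Seq.IH(2) * show ?case by auto
next
  case (CondTrue e s c r t s' r' d)
  from CondTrue.prems obtain t1
    where *: "exec L c s r t1 s'' r''" "u = 1 + cost e s + t1"
    by (rule exec_cases(4)) (use CondTrue.hyps in auto)
  from CondTrue.IH[OF *(1)] * show ?case by auto
next
  case (CondFalse e s d r t s' r' c)
  from CondFalse.prems obtain t1
    where *: "exec L d s r t1 s'' r''" "u = 1 + cost e s + t1"
    by (rule exec_cases(4)) (use CondFalse.hyps in auto)
  from CondFalse.IH[OF *(1)] * show ?case by auto
next
  case (WhileFalse e s c r)
  from WhileFalse.prems show ?case
    by (rule exec_cases(5)) (use WhileFalse.hyps in auto)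
next
  case (WhileTrue e s c r t s' r' t' s2 r2)
  from WhileTrue.prems obtain t1 s1 r1 t2
    where *: "exec L c s r t1 s1 r1" "exec L (While e c) s1 r1 t2 s'' r''"
      "u = 1 + cost e s + t1 + t2"
    by (rule exec_cases(5)) (use WhileTrue.hyps in auto)
  from WhileTrue.IH(1)[OF *(1)] have "t1 = t" "s1 = s'" "r1 = r'" by auto
  with WhileTrue.IH(2) * show ?case by auto
next
  case (Toss x s b r)
  from Toss.prems show ?case by (rule exec_cases(6)) auto
next
  case (Query x e s r)
  from Query.prems show ?case by (rule exec_cases(7)) auto
qed

text \<open>Variable 0 holds the input on start and the output on halting.\<close>

definition init :: "tree \<Rightarrow> store" where
  "init v = (\<lambda>_. Leaf)(0 := v)"


section \<open>The class NP\<close>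

text \<open>Verifiers are run with the empty oracle and an empty random tape, so a query always
  answers no and a toss prevents halting: they are ordinary deterministic programs.\<close>

definition polytime :: "com \<Rightarrow> bool" where
  "polytime V \<longleftrightarrow> (\<exists>a d. \<forall>v. \<exists>t s. exec {} V (init v) [] t s [] \<and> t \<le> a * tsize v ^ d)"

definition accepts :: "com \<Rightarrow> tree \<Rightarrow> bool" where
  "accepts V v \<longleftrightarrow> (\<exists>t s. exec {} V (init v) [] t s [] \<and> s 0 \<noteq> Leaf)"

definition NP :: "tree set set" where
  "NP = {L. \<exists>V a d. polytime V \<and>
     (\<forall>v. v \<in> L \<longleftrightarrow> (\<exists>w. tsize w \<le> a * tsize v ^ d \<and> accepts V (Node v w)))}"


section \<open>Synthesis\<close>

text \<open>Numbers are encoded in unary: the encoding of a specification has size polynomial in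
  \<open>n\<close>, \<open>m\<close> and \<open>|F|\<close>, and that of a circuit has size polynomial in the numbers of gates and
  inputs.\<close>

primrec enc_nat :: "nat \<Rightarrow> tree" where
  "enc_nat 0 = Leaf"
| "enc_nat (Suc n) = Node Leaf (enc_nat n)"

primrec enc_list :: "tree list \<Rightarrow> tree" where
  "enc_list [] = Leaf"
| "enc_list (v # vs) = Node v (enc_list vs)"

primrec enc_var :: "var \<Rightarrow> tree" where
  "enc_var (X i) = Node (enc_nat 0) (enc_nat i)"
| "enc_var (Y j) = Node (enc_nat 1) (enc_nat j)"

primrec enc_formula :: "formula \<Rightarrow> tree" where
  "enc_formula (Const b) = Node (enc_nat 0) (tree_of_bool b)"
| "enc_formula (Atom v) = Node (enc_nat 1) (enc_var v)"
| "enc_formula (Neg F) = Node (enc_nat 2) (enc_formula F)"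
| "enc_formula (Conj F G) = Node (enc_nat 3) (Node (enc_formula F) (enc_formula G))"
| "enc_formula (Disj F G) = Node (enc_nat 4) (Node (enc_formula F) (enc_formula G))"

definition enc_spec :: "nat \<Rightarrow> nat \<Rightarrow> formula \<Rightarrow> tree" where
  "enc_spec n m F = Node (enc_nat n) (Node (enc_nat m) (enc_formula F))"

primrec enc_gate :: "gate \<Rightarrow> tree" where
  "enc_gate (GConst b) = Node (enc_nat 0) (tree_of_bool b)"
| "enc_gate (GIn i) = Node (enc_nat 1) (enc_nat i)"
| "enc_gate (GNot a) = Node (enc_nat 2) (enc_nat a)"
| "enc_gate (GAnd a b) = Node (enc_nat 3) (Node (enc_nat a) (enc_nat b))"
| "enc_gate (GOr a b) = Node (enc_nat 4) (Node (enc_nat a) (enc_nat b))"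

definition enc_circuits :: "circuit list \<Rightarrow> tree" where
  "enc_circuits Cs = enc_list (map (\<lambda>C. enc_list (map enc_gate C)) Cs)"

lemma enc_nat_inject: "enc_nat a = enc_nat b \<longleftrightarrow> a = b"
proof (induction a arbitrary: b)
  case 0 show ?case by (cases b) auto
next
  case (Suc a) then show ?case by (cases b) auto
qed

lemma enc_list_inject: "enc_list us = enc_list vs \<longleftrightarrow> us = vs"
proof (induction us arbitrary: vs)
  case Nil show ?case by (cases vs) auto
next
  case (Cons u us) then show ?case by (cases vs) auto
qed

lemma enc_gate_inject: "enc_gate g = enc_gate h \<longleftrightarrow> g = h"
  by (cases g; cases h) (auto simp: enc_nat_inject tree_of_bool_def numeral_eq_Suc)

lemma enc_circuits_inject: "enc_circuits Cs = enc_circuits Ds \<longleftrightarrow> Cs = Ds"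
proof -
  have "inj (\<lambda>C. enc_list (map enc_gate C))"
    by (rule injI) (simp add: enc_list_inject inj_map_eq_map inj_def enc_gate_inject)
  then show ?thesis by (simp add: enc_circuits_def enc_list_inject inj_map_eq_map)
qed

text \<open>A run on a random tape of length \<open>T\<close> succeeds if it halts within time \<open>T\<close> and outputs
  circuits for Skolem functions. The length is no restriction, as each toss takes time 1.\<close>

definition run_succeeds :: "tree set \<Rightarrow> com \<Rightarrow> nat \<Rightarrow> nat \<Rightarrow> formula \<Rightarrow> nat \<Rightarrow> bool list \<Rightarrow> bool" where
  "run_succeeds L A n m F T r \<longleftrightarrow>
     (\<exists>t s r' Cs. exec L A (init (enc_spec n m F)) r t s r' \<and> t \<le> T \<and>
        s 0 = enc_circuits Cs \<and> (\<forall>C \<in> set Cs. circuit_ok n C) \<and>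
        skolem n m F (map circuit_fun Cs))"

definition synthesizes_within :: "tree set \<Rightarrow> com \<Rightarrow> nat \<Rightarrow> nat \<Rightarrow> formula \<Rightarrow> nat \<Rightarrow> bool" where
  "synthesizes_within L A n m F T \<longleftrightarrow>
     measure_pmf.prob (pmf_of_set (bits T)) {r. run_succeeds L A n m F T r} \<ge> 2 / 3"

end

theory Submission
  imports Defs
begin

text \<open>Greedy covering: keep a list \<open>ys\<close> of outputs and repeatedly add an output \<open>y\<close> whose set
  \<open>A y\<close> of newly covered inputs has, up to a factor 2, maximal size. As the \<open>k\<close> elements of the image
  of \<open>\<Psi>\<close> cover all inputs that have an output, each round shrinks the number of uncovered inputs
  by a factor \<open>1 - 1/(2k)\<close>, and \<open>2k(n + 1)\<close> rounds suffice; \<open>k\<close> need not be known, since an NP query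
  tells when nothing is left to cover. The circuits then select an element of \<open>ys\<close> that works for
  the given input.

  In each round, to find \<open>y\<close>, hash the \<open>t\<close>-tuples over \<open>A y\<close>, simultaneously for all \<open>y\<close>, with one fresh random linear map over
  GF(2) where \<open>t\<close> is linear in \<open>n + m\<close>. An NP query asks for some \<open>y\<close> and a tuple over \<open>A y\<close> on which
  the first \<open>j\<close> output bits of the hash vanish. Take the largest \<open>j\<close> for which this
  succeeds and find a corresponding \<open>y\<close> bit by bit: a second moment bound for a maximal set and a union
  bound over the sets of less than half its size show that this \<open>y\<close> is good enough except with
  probability exponentially small in \<open>n + m\<close>.\<close>

section \<open>Polynomial bounds\<close>

text \<open>Comparing the sizes of the sets \<open>A y\<close> is a counting problem, whereas an NP
  query only decides existence; hashing turns a size into the deepest level at which something still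
  exists. One map shared by all \<open>y\<close> lets the same query range over \<open>y\<close>
  too. The map is only pairwise independent, so Chebyshev's inequality has to do: at the critical
  level a maximal set keeps about \<open>2 ^ c\<close> tuples on average, and a round fails with
  probability at most \<open>2 / 2 ^ c\<close>. With \<open>c = n + m + 4\<close> this adds up to at
  most 1/4 over \<open>2 * k * (n + 1)\<close> rounds for every \<open>k \<le> 2 ^ m\<close>, so the
  same parameters serve for each unknown \<open>k\<close>. The rounds are adaptive, hence each
  consumes its own block of coins.

  To keep machine programs out of the mathematics, the deterministic parts are written as functions
  on trees and shown to be polynomial-time by closure rules. These functions are total, so time
  bounds have to hold on malformed trees as well. Only coin tossing and the main loop are written
  out as programs.\<close>

lemma tsize_pos [simp]: "0 < tsize v"
  by (induction v) auto

lemma tsize_ge_1 [simp]: "Suc 0 \<le> tsize v"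
  using tsize_pos[of v] by linarith

lemma tsize_left: "tsize (left v) \<le> tsize v"
  by (cases v) auto

lemma tsize_right: "tsize (right v) \<le> tsize v"
  by (cases v) auto

lemma tsize_tree_of_bool: "tsize (tree_of_bool b) \<le> 3"
  by (auto simp: tree_of_bool_def)

lemma tree_of_bool_eq_Leaf [simp]: "tree_of_bool b = Leaf \<longleftrightarrow> \<not> b"
  by (auto simp: tree_of_bool_def)

definition pbd :: "(tree \<Rightarrow> nat) \<Rightarrow> bool" where
  "pbd f \<longleftrightarrow> (\<exists>a d. \<forall>v. f v \<le> a * tsize v ^ d)"

lemma pbd_mono: "pbd g \<Longrightarrow> (\<And>v. f v \<le> g v) \<Longrightarrow> pbd f"
  unfolding pbd_def by (meson order_trans)

lemma pbd_const: "pbd (\<lambda>v. c)"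
  unfolding pbd_def by (rule exI[of _ c], rule exI[of _ 0]) simp

lemma pbd_tsize: "pbd tsize"
  unfolding pbd_def by (rule exI[of _ 1], rule exI[of _ 1]) simp

text \<open>A single monomial absorbs a sum because \<open>tsize v\<close> is at least 1, so both
  exponents may be raised to \<open>d + e\<close>.\<close>

lemma pbd_add:
  assumes "pbd f" "pbd g" shows "pbd (\<lambda>v. f v + g v)"
proof -
  from assms obtain a d b e where f: "\<And>v. f v \<le> a * tsize v ^ d"
    and g: "\<And>v. g v \<le> b * tsize v ^ e" unfolding pbd_def by auto
  have "f v + g v \<le> (a + b) * tsize v ^ (d + e)" for v
  proof -
    have "a * tsize v ^ d \<le> a * tsize v ^ (d + e)" "b * tsize v ^ e \<le> b * tsize v ^ (d + e)"
      by (auto intro!: mult_le_mono2 power_increasing)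
    with f[of v] g[of v] show ?thesis unfolding add_mult_distrib by linarith
  qed
  then show ?thesis unfolding pbd_def by blast
qed

lemma pbd_mult:
  assumes "pbd f" "pbd g" shows "pbd (\<lambda>v. f v * g v)"
proof -
  from assms obtain a d b e where f: "\<And>v. f v \<le> a * tsize v ^ d"
    and g: "\<And>v. g v \<le> b * tsize v ^ e" unfolding pbd_def by auto
  have "f v * g v \<le> (a * b) * tsize v ^ (d + e)" for v
    using mult_le_mono[OF f[of v] g[of v]] by (simp add: power_add ac_simps)
  then show ?thesis unfolding pbd_def by blast
qed

lemma pbd_power: "pbd f \<Longrightarrow> pbd (\<lambda>v. f v ^ k)"
  by (induction k) (auto intro: pbd_const pbd_mult)

lemma pbd_comp:
  assumes "pbd f" "pbd (\<lambda>v. tsize (g v))" shows "pbd (\<lambda>v. f (g v))"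
proof -
  from assms(1) obtain a d where f: "\<And>v. f v \<le> a * tsize v ^ d" unfolding pbd_def by auto
  have "pbd (\<lambda>v. a * tsize (g v) ^ d)"
    by (intro pbd_mult pbd_const pbd_power assms)
  then show ?thesis by (rule pbd_mono) (rule f)
qed

lemma pbd_Suc: "pbd f \<Longrightarrow> pbd (\<lambda>v. Suc (f v))"
  using pbd_add[OF _ pbd_const[of 1]] by simp

lemmas pbd_intros = pbd_const pbd_tsize pbd_add pbd_mult pbd_power pbd_Suc


section \<open>Functions computable in polynomial time\<close>

text \<open>A written value is paid for by the run, up to the factor 3 for \<open>Toss\<close> and
  \<open>Query\<close>, which write truth values of size up to 3. A variable that is never written
  may be arbitrarily large, hence the disjunction.\<close>

lemma exec_size: "exec L c s r t s' r' \<Longrightarrow> s' i = s i \<or> tsize (s' i) \<le> 3 * t"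
proof (induction rule: exec.induct)
  case (Assign x e s r)
  have "tsize (val e s) \<le> cost e s" by (induction e) auto
  then show ?case by (cases "i = x") auto
next
  case (Toss x s b r)
  then show ?case using tsize_tree_of_bool[of b] by auto
next
  case (Query x e s r)
  then show ?case using tsize_tree_of_bool[of "val e s \<in> L"] by auto
qed auto

text \<open>Programs compute in place at an arbitrary variable \<open>b\<close>, treat the variables above \<open>b\<close> as
  uninitialised scratch space and leave those below alone; this makes them compose without any
  bookkeeping of variable names.\<close>

definition implements :: "tree set \<Rightarrow> nat \<Rightarrow> com \<Rightarrow> (tree \<Rightarrow> tree) \<Rightarrow> (tree \<Rightarrow> nat) \<Rightarrow> bool" where
  "implements L b c f p \<longleftrightarrow> (\<forall>s r. \<exists>t s'. exec L c s r t s' r \<and> s' b = f (s b) \<and>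
     (\<forall>i<b. s' i = s i) \<and> t \<le> p (s b))"

text \<open>Variable names are fixed inside a program, so each base variable \<open>b\<close> gets
  its own program and bound.\<close>

definition ptime :: "tree set \<Rightarrow> (tree \<Rightarrow> tree) \<Rightarrow> bool" where
  "ptime L f \<longleftrightarrow> (\<forall>b. \<exists>c p. pbd p \<and> implements L b c f p)"

lemma implementsE:
  assumes "implements L b c f p"
  obtains t s' where "exec L c s r t s' r" "s' b = f (s b)" "\<And>i. i < b \<Longrightarrow> s' i = s i" "t \<le> p (s b)"
  using assms unfolding implements_def by metis

lemma ptimeE:
  assumes "ptime L f"
  obtains c p where "pbd p" "implements L b c f p"
  using assms unfolding ptime_def by metis

lemma ptime_size:
  assumes "ptime L f" shows "pbd (\<lambda>v. tsize (f v))"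
proof -
  from assms obtain c p where p: "pbd p" and c: "implements L 0 c f p" by (rule ptimeE)
  have le: "tsize (f v) \<le> tsize v + 3 * p v" for v
  proof -
    from c obtain t s' where "exec L c (init v) [] t s' []" "s' 0 = f (init v 0)" "t \<le> p (init v 0)"
      by (rule implementsE)
    with exec_size[of L c "init v" "[]" t s' "[]" 0] show ?thesis by (auto simp: init_def)
  qed
  show ?thesis by (rule pbd_mono[OF _ le]) (intro pbd_intros p)
qed

lemma ptimeI:
  "(\<And>b. implements L b (c b) f p) \<Longrightarrow> pbd p \<Longrightarrow> ptime L f"
  unfolding ptime_def by blast

lemma implementsI:
  assumes "\<And>s r. \<exists>t s'. exec L c s r t s' r \<and> s' b = f (s b) \<and> (\<forall>i<b. s' i = s i) \<and> t \<le> p (s b)"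
  shows "implements L b c f p"
  using assms unfolding implements_def by blast

section \<open>Closure properties of polynomial-time functions on trees\<close>

lemma pt_id: "ptime L (\<lambda>v. v)"
proof (rule ptimeI)
  show "implements L b Skip (\<lambda>v. v) (\<lambda>_. 1)" for b
    by (rule implementsI) (use exec.Skip in force)
qed (rule pbd_const)

lemma pt_assign:
  assumes "\<And>b s. val (e b) s = f (s b)" "\<And>b s. cost (e b) s = p (s b)" "pbd p"
  shows "ptime L f"
proof (rule ptimeI)
  show "implements L b (Assign b (e b)) f (\<lambda>v. 1 + p v)" for b
  proof (rule implementsI, intro exI conjI impI)
    show "exec L (Assign b (e b)) s r (1 + cost (e b) s) (s(b := val (e b) s)) r" for s r
      by (rule exec.Assign)
  qed (auto simp: assms(1,2))
  show "pbd (\<lambda>v. 1 + p v)" by (intro pbd_add pbd_const assms(3))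
qed

primrec quote :: "tree \<Rightarrow> expr" where
  "quote Leaf = Null"
| "quote (Node l r) = Join (quote l) (quote r)"

lemma val_quote [simp]: "val (quote u) s = u"
  by (induction u) auto

lemma cost_quote: "cost (quote u) s = cost (quote u) s'"
  by (induction u) auto

lemma pt_const: "ptime L (\<lambda>v. u)"
proof (rule pt_assign)
  show "val (quote u) s = u" for b :: nat and s by simp
  show "cost (quote u) s = (\<lambda>v. cost (quote u) (\<lambda>_. Leaf)) (s b)" for b :: nat and s
    by (rule cost_quote)
qed (rule pbd_const)

lemma pbd_left: "pbd (\<lambda>v. tsize (left v))"
  by (rule pbd_mono[OF pbd_tsize tsize_left])

lemma pbd_right: "pbd (\<lambda>v. tsize (right v))"
  by (rule pbd_mono[OF pbd_tsize tsize_right])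

lemma pt_left1: "ptime L left"
proof (rule pt_assign)
  show "val (Fst (Var b)) s = left (s b)" for b s by simp
  show "cost (Fst (Var b)) s = (\<lambda>v. tsize v + tsize (left v)) (s b)" for b s by simp
  show "pbd (\<lambda>v. tsize v + tsize (left v))" by (rule pbd_add[OF pbd_tsize pbd_left])
qed

lemma pt_right1: "ptime L right"
proof (rule pt_assign)
  show "val (Snd (Var b)) s = right (s b)" for b s by simp
  show "cost (Snd (Var b)) s = (\<lambda>v. tsize v + tsize (right v)) (s b)" for b s by simp
  show "pbd (\<lambda>v. tsize v + tsize (right v))" by (rule pbd_add[OF pbd_tsize pbd_right])
qed

lemma pt_eq1: "ptime L (\<lambda>v. tree_of_bool (left v = right v))"
proof (rule pt_assign)
  let ?e = "\<lambda>b. Equal (Fst (Var b)) (Snd (Var b))"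
  let ?p = "\<lambda>v. (tsize v + tsize (left v)) + (tsize v + tsize (right v)) +
       tsize (tree_of_bool (left v = right v))"
  show "val (?e b) s = tree_of_bool (left (s b) = right (s b))" for b s by simp
  show "cost (?e b) s = ?p (s b)" for b s by simp
  show "pbd ?p"
    by (intro pbd_add pbd_tsize pbd_left pbd_right pbd_mono[OF pbd_const tsize_tree_of_bool])
qed

lemma pt_query1: "ptime L (\<lambda>v. tree_of_bool (v \<in> L))"
proof (rule ptimeI)
  show "implements L b (Query b (Var b)) (\<lambda>v. tree_of_bool (v \<in> L)) (\<lambda>v. 1 + tsize v)" for b
  proof (rule implementsI, intro exI conjI impI)
    show "exec L (Query b (Var b)) s r (1 + cost (Var b) s)
        (s(b := tree_of_bool (val (Var b) s \<in> L))) r" for s r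
      by (rule exec.Query)
  qed auto
  show "pbd (\<lambda>v. 1 + tsize v)" by (intro pbd_add pbd_const pbd_tsize)
qed

text \<open>The time of \<open>f\<close> is polynomial in the size of \<open>g v\<close>, which
  \<open>ptime_size\<close> makes polynomial in the size of \<open>v\<close>.\<close>

lemma pt_comp:
  assumes f: "ptime L f" and g: "ptime L g"
  shows "ptime L (\<lambda>v. f (g v))"
  unfolding ptime_def
proof
  fix b
  obtain c p where p: "pbd p" and c: "implements L b c f p" using f by (rule ptimeE)
  obtain d q where q: "pbd q" and d: "implements L b d g q" using g by (rule ptimeE)
  have "implements L b (Seq d c) (\<lambda>v. f (g v)) (\<lambda>v. q v + p (g v))"
    unfolding implements_def
  proof (intro allI)
    fix s :: store and r
    obtain t1 s1 where 1: "exec L d s r t1 s1 r" "s1 b = g (s b)" "\<And>i. i < b \<Longrightarrow> s1 i = s i" "t1 \<le> q (s b)"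
      by (rule implementsE[OF d, where s = s and r = r]) blast
    obtain t2 s2 where 2: "exec L c s1 r t2 s2 r" "s2 b = f (s1 b)" "\<And>i. i < b \<Longrightarrow> s2 i = s1 i" "t2 \<le> p (s1 b)"
      by (rule implementsE[OF c, where s = s1 and r = r]) blast
    show "\<exists>t s'. exec L (Seq d c) s r t s' r \<and> s' b = f (g (s b)) \<and> (\<forall>i<b. s' i = s i) \<and> t \<le> q (s b) + p (g (s b))"
      by (intro exI conjI, rule exec.Seq[OF 1(1) 2(1)]) (use 1 2 in auto)
  qed
  moreover have "pbd (\<lambda>v. q v + p (g v))"
    by (intro pbd_add q pbd_comp[OF p] ptime_size[OF g])
  ultimately show "\<exists>c p. pbd p \<and> implements L b c (\<lambda>v. f (g v)) p"
    by - (intro exI conjI; assumption)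
qed

lemma pt_left: "ptime L f \<Longrightarrow> ptime L (\<lambda>v. left (f v))"
  by (rule pt_comp[OF pt_left1])

lemma pt_right: "ptime L f \<Longrightarrow> ptime L (\<lambda>v. right (f v))"
  by (rule pt_comp[OF pt_right1])

lemma pt_query: "ptime L f \<Longrightarrow> ptime L (\<lambda>v. tree_of_bool (f v \<in> L))"
  by (rule pt_comp[OF pt_query1])

lemma pt_Node:
  assumes f: "ptime L f" and g: "ptime L g"
  shows "ptime L (\<lambda>v. Node (f v) (g v))"
  unfolding ptime_def
proof
  fix b
  obtain c p where p: "pbd p" and c: "implements L (b + 1) c f p" using f by (rule ptimeE)
  obtain d q where q: "pbd q" and d: "implements L (b + 2) d g q" using g by (rule ptimeE)
  \<comment> \<open>Each subprogram overwrites its argument, so both work on copies. The copy in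
    \<open>b + 2\<close> is made only after \<open>c\<close> has run, because \<open>c\<close> may
    use everything above \<open>b + 1\<close> as scratch space.\<close>
  let ?C = "Seq (Assign (b + 1) (Var b)) (Seq c (Seq (Assign (b + 2) (Var b))
      (Seq d (Assign b (Join (Var (b + 1)) (Var (b + 2)))))))"
  let ?p = "\<lambda>v. (1 + tsize v) + (p v + ((1 + tsize v) + (q v +
      (1 + (tsize (f v) + tsize (g v) + (1 + tsize (f v) + tsize (g v)))))))"
  have "implements L b ?C (\<lambda>v. Node (f v) (g v)) ?p"
    unfolding implements_def
  proof (intro allI)
    fix s :: store and r
    let ?s1 = "s(b + 1 := s b)"
    have 1: "exec L (Assign (b + 1) (Var b)) s r (1 + tsize (s b)) ?s1 r"
      using exec.Assign[of L "b + 1" "Var b"] by simp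
    obtain t2 s2 where 2: "exec L c ?s1 r t2 s2 r" "s2 (b + 1) = f (?s1 (b + 1))"
      "\<And>i. i < b + 1 \<Longrightarrow> s2 i = ?s1 i" "t2 \<le> p (?s1 (b + 1))"
      by (rule implementsE[OF c, where s = "?s1" and r = r]) blast
    let ?s3 = "s2(b + 2 := s2 b)"
    have 3: "exec L (Assign (b + 2) (Var b)) s2 r (1 + tsize (s2 b)) ?s3 r"
      using exec.Assign[of L "b + 2" "Var b"] by simp
    obtain t4 s4 where 4: "exec L d ?s3 r t4 s4 r" "s4 (b + 2) = g (?s3 (b + 2))"
      "\<And>i. i < b + 2 \<Longrightarrow> s4 i = ?s3 i" "t4 \<le> q (?s3 (b + 2))"
      by (rule implementsE[OF d, where s = "?s3" and r = r]) blast
    note 5 = exec.Assign[of L b "Join (Var (b + 1)) (Var (b + 2))" s4 r]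
    note E = exec.Seq[OF 1 exec.Seq[OF 2(1) exec.Seq[OF 3 exec.Seq[OF 4(1) 5]]]]
    show "\<exists>t s'. exec L ?C s r t s' r \<and> s' b = Node (f (s b)) (g (s b)) \<and> (\<forall>i<b. s' i = s i) \<and> t \<le> ?p (s b)"
      by (intro exI conjI, rule E) (use 2 4 in auto)
  qed
  moreover have "pbd ?p"
    by (intro pbd_intros p q ptime_size[OF f] ptime_size[OF g])
  ultimately show "\<exists>c p. pbd p \<and> implements L b c (\<lambda>v. Node (f v) (g v)) p"
    by - (intro exI conjI; assumption)
qed

lemma pt_eq:
  assumes "ptime L f" "ptime L g"
  shows "ptime L (\<lambda>v. tree_of_bool (f v = g v))"
  using pt_comp[OF pt_eq1 pt_Node[OF assms]] by simp

lemma pt_if: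
  assumes h: "ptime L (\<lambda>v. tree_of_bool (P v))" and f: "ptime L f" and g: "ptime L g"
  shows "ptime L (\<lambda>v. if P v then f v else g v)"
  unfolding ptime_def
proof
  fix b
  obtain e o' where o: "pbd o'" and e: "implements L (b + 1) e (\<lambda>v. tree_of_bool (P v)) o'"
    using h by (rule ptimeE)
  obtain c p where p: "pbd p" and c: "implements L b c f p" using f by (rule ptimeE)
  obtain d q where q: "pbd q" and d: "implements L b d g q" using g by (rule ptimeE)
  let ?C = "Seq (Assign (b + 1) (Var b)) (Seq e (Cond (Var (b + 1)) c d))"
  let ?p = "\<lambda>v. (1 + tsize v) + (o' v + (1 + 3 + (p v + q v)))"
  have "implements L b ?C (\<lambda>v. if P v then f v else g v) ?p"
    unfolding implements_def
  proof (intro allI)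
    fix s :: store and r
    let ?s1 = "s(b + 1 := s b)"
    have 1: "exec L (Assign (b + 1) (Var b)) s r (1 + tsize (s b)) ?s1 r"
      using exec.Assign[of L "b + 1" "Var b"] by simp
    obtain t2 s2 where 2: "exec L e ?s1 r t2 s2 r" "s2 (b + 1) = tree_of_bool (P (?s1 (b + 1)))"
      "\<And>i. i < b + 1 \<Longrightarrow> s2 i = ?s1 i" "t2 \<le> o' (?s1 (b + 1))"
      by (rule implementsE[OF e, where s = "?s1" and r = r]) blast
    have s2: "s2 b = s b" "\<And>i. i < b \<Longrightarrow> s2 i = s i" using 2(3) by auto
    have le: "cost (Var (b + 1)) s2 \<le> 3" using 2(2) tsize_tree_of_bool by simp
    show "\<exists>t s'. exec L ?C s r t s' r \<and> s' b = (if P (s b) then f (s b) else g (s b)) \<and>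
        (\<forall>i<b. s' i = s i) \<and> t \<le> ?p (s b)"
    proof (cases "P (s b)")
      case True
      obtain t3 s3 where 3: "exec L c s2 r t3 s3 r" "s3 b = f (s2 b)"
        "\<And>i. i < b \<Longrightarrow> s3 i = s2 i" "t3 \<le> p (s2 b)"
        by (rule implementsE[OF c, where s = s2 and r = r]) blast
      have "val (Var (b + 1)) s2 \<noteq> Leaf" using True 2(2) by simp
      note E = exec.Seq[OF 1 exec.Seq[OF 2(1) exec.CondTrue[OF this 3(1)]]]
      show ?thesis
        by (intro exI conjI, rule E) (use True 2 3 s2 le in auto)
    next
      case False
      obtain t3 s3 where 3: "exec L d s2 r t3 s3 r" "s3 b = g (s2 b)"
        "\<And>i. i < b \<Longrightarrow> s3 i = s2 i" "t3 \<le> q (s2 b)"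
        by (rule implementsE[OF d, where s = s2 and r = r]) blast
      have "val (Var (b + 1)) s2 = Leaf" using False 2(2) by simp
      note E = exec.Seq[OF 1 exec.Seq[OF 2(1) exec.CondFalse[OF this 3(1)]]]
      show ?thesis
        by (intro exI conjI, rule E) (use False 2 3 s2 le in auto)
    qed
  qed
  moreover have "pbd ?p" by (intro pbd_intros p q o)
  ultimately show "\<exists>c p. pbd p \<and> implements L b c (\<lambda>v. if P v then f v else g v) p"
    by - (intro exI conjI; assumption)
qed

lemma pt_not:
  assumes "ptime L (\<lambda>v. tree_of_bool (P v))"
  shows "ptime L (\<lambda>v. tree_of_bool (\<not> P v))"
proof -
  have "(\<lambda>v. tree_of_bool (\<not> P v)) = (\<lambda>v. if P v then tree_of_bool False else tree_of_bool True)"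
    by auto
  then show ?thesis using pt_if[OF assms pt_const pt_const] by simp
qed

lemma pt_conj:
  assumes "ptime L (\<lambda>v. tree_of_bool (P v))" "ptime L (\<lambda>v. tree_of_bool (Q v))"
  shows "ptime L (\<lambda>v. tree_of_bool (P v \<and> Q v))"
proof -
  have "(\<lambda>v. tree_of_bool (P v \<and> Q v)) = (\<lambda>v. if P v then tree_of_bool (Q v) else tree_of_bool False)"
    by auto
  then show ?thesis using pt_if[OF assms pt_const] by simp
qed

lemma pt_disj:
  assumes "ptime L (\<lambda>v. tree_of_bool (P v))" "ptime L (\<lambda>v. tree_of_bool (Q v))"
  shows "ptime L (\<lambda>v. tree_of_bool (P v \<or> Q v))"
proof -
  have "(\<lambda>v. tree_of_bool (P v \<or> Q v)) = (\<lambda>v. if P v then tree_of_bool True else tree_of_bool (Q v))"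
    by auto
  then show ?thesis using pt_if[OF assms(1) pt_const assms(2)] by simp
qed

lemmas pt_intros = pt_id pt_const pt_left pt_right pt_Node pt_if pt_not pt_conj pt_disj
  pt_eq pt_query

subsection \<open>Loops\<close>

text \<open>There are \<open>k + 1\<close> tests, each of cost at most \<open>2 * B\<close>: a value
  of size at most \<open>B\<close> and its left part. Charging \<open>Q\<close> with every test
  counts one body too many.\<close>

lemma exec_while:
  assumes c: "implements L b c g p"
    and go: "\<And>i. i < k \<Longrightarrow> left ((g ^^ i) (s b)) \<noteq> Leaf"
    and stop: "left ((g ^^ k) (s b)) = Leaf"
    and size: "\<And>i. i \<le> k \<Longrightarrow> tsize ((g ^^ i) (s b)) \<le> B"
    and p: "\<And>i. i \<le> k \<Longrightarrow> p ((g ^^ i) (s b)) \<le> Q"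
  shows "\<exists>t s'. exec L (While (Fst (Var b)) c) s r t s' r \<and> s' b = (g ^^ k) (s b) \<and>
    (\<forall>i<b. s' i = s i) \<and> t \<le> Suc k * (1 + 2 * B + Q)"
  using go stop size p
proof (induction k arbitrary: s)
  case 0
  have st: "val (Fst (Var b)) s = Leaf" using "0.prems"(2) by simp
  have "tsize (s b) \<le> B" using "0.prems"(3)[of 0] by simp
  then have co: "cost (Fst (Var b)) s \<le> 2 * B" using tsize_left[of "s b"] by simp
  show ?case
    by (intro exI conjI, rule exec.WhileFalse[OF st]) (use co in auto)
next
  case (Suc k)
  have st: "val (Fst (Var b)) s \<noteq> Leaf" using "Suc.prems"(1)[of 0] by simp
  obtain t1 s1 where 1: "exec L c s r t1 s1 r" "s1 b = g (s b)"
    "\<And>i. i < b \<Longrightarrow> s1 i = s i" "t1 \<le> p (s b)"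
    by (rule implementsE[OF c, where s = s and r = r]) blast
  have shift: "(g ^^ i) (s1 b) = (g ^^ Suc i) (s b)" for i
    by (simp add: 1(2) funpow_swap1)
  have "\<exists>t s'. exec L (While (Fst (Var b)) c) s1 r t s' r \<and> s' b = (g ^^ k) (s1 b) \<and>
    (\<forall>i<b. s' i = s1 i) \<and> t \<le> Suc k * (1 + 2 * B + Q)"
  proof (rule Suc.IH)
    show "\<And>i. i < k \<Longrightarrow> left ((g ^^ i) (s1 b)) \<noteq> Leaf"
      unfolding shift using Suc.prems(1) by blast
    show "left ((g ^^ k) (s1 b)) = Leaf" unfolding shift using Suc.prems(2) .
    show "\<And>i. i \<le> k \<Longrightarrow> tsize ((g ^^ i) (s1 b)) \<le> B"
      unfolding shift using Suc.prems(3) by (meson Suc_le_mono)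
    show "\<And>i. i \<le> k \<Longrightarrow> p ((g ^^ i) (s1 b)) \<le> Q"
      unfolding shift using Suc.prems(4) by (meson Suc_le_mono)
  qed
  then obtain t2 s2 where 2: "exec L (While (Fst (Var b)) c) s1 r t2 s2 r" "s2 b = (g ^^ k) (s1 b)"
    "\<forall>i<b. s2 i = s1 i" "t2 \<le> Suc k * (1 + 2 * B + Q)" by blast
  have "tsize (s b) \<le> B" using "Suc.prems"(3)[of 0] by simp
  then have co: "cost (Fst (Var b)) s \<le> 2 * B" using tsize_left[of "s b"] by simp
  have "p (s b) \<le> Q" using "Suc.prems"(4)[of 0] by simp
  with 1(4) co 2(4) have le: "1 + cost (Fst (Var b)) s + t1 + t2 \<le> Suc (Suc k) * (1 + 2 * B + Q)"
    by simp
  show ?case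
  proof (intro exI conjI)
    show "exec L (While (Fst (Var b)) c) s r (1 + cost (Fst (Var b)) s + t1 + t2) s2 r"
      by (rule exec.WhileTrue[OF st 1(1) 2(1)])
    show "s2 b = (g ^^ Suc k) (s b)" using 2(2) shift by simp
    show "\<forall>i<b. s2 i = s i" using 1(3) 2(3) by simp
  qed (rule le)
qed

text \<open>Iterating a polynomial-time function may square sizes in every pass, so bounding the
  number of passes is not enough: a polynomial bound \<open>B\<close> on all intermediate values has
  to be supplied.\<close>

lemma pt_loop:
  assumes I: "ptime L I" and g: "ptime L g" and N: "pbd N" and B: "pbd B"
    and k: "\<And>v. k v \<le> N v"
    and go: "\<And>v i. i < k v \<Longrightarrow> left ((g ^^ i) (I v)) \<noteq> Leaf"
    and stop: "\<And>v. left ((g ^^ k v) (I v)) = Leaf"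
    and size: "\<And>v i. i \<le> k v \<Longrightarrow> tsize ((g ^^ i) (I v)) \<le> B v"
  shows "ptime L (\<lambda>v. (g ^^ k v) (I v))"
  unfolding ptime_def
proof
  fix b
  obtain c p where p: "pbd p" and c: "implements L b c g p" using g by (rule ptimeE)
  obtain d q where q: "pbd q" and d: "implements L b d I q" using I by (rule ptimeE)
  from p obtain a e where ae: "\<And>v. p v \<le> a * tsize v ^ e" unfolding pbd_def by auto
  let ?P = "\<lambda>v. q v + Suc (N v) * (1 + 2 * B v + a * B v ^ e)"
  have "implements L b (Seq d (While (Fst (Var b)) c)) (\<lambda>v. (g ^^ k v) (I v)) ?P"
    unfolding implements_def
  proof (intro allI)
    fix s :: store and r
    obtain t1 s1 where 1: "exec L d s r t1 s1 r" "s1 b = I (s b)" "\<And>i. i < b \<Longrightarrow> s1 i = s i" "t1 \<le> q (s b)"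
      by (rule implementsE[OF d, where s = s and r = r]) blast
    let ?v = "s b"
    have "\<exists>t s'. exec L (While (Fst (Var b)) c) s1 r t s' r \<and> s' b = (g ^^ k ?v) (s1 b) \<and>
      (\<forall>i<b. s' i = s1 i) \<and> t \<le> Suc (k ?v) * (1 + 2 * B ?v + a * B ?v ^ e)"
    proof (rule exec_while[OF c])
      fix i assume "i \<le> k ?v"
      then have "tsize ((g ^^ i) (I ?v)) \<le> B ?v" by (rule size)
      then show "p ((g ^^ i) (s1 b)) \<le> a * B ?v ^ e"
        unfolding 1(2) by (intro order_trans[OF ae] mult_le_mono2 power_mono) auto
    qed (use go stop size 1(2) in auto)
    then obtain t2 s2 where 2: "exec L (While (Fst (Var b)) c) s1 r t2 s2 r" "s2 b = (g ^^ k ?v) (s1 b)"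
      "\<forall>i<b. s2 i = s1 i" "t2 \<le> Suc (k ?v) * (1 + 2 * B ?v + a * B ?v ^ e)" by blast
    have "Suc (k ?v) * (1 + 2 * B ?v + a * B ?v ^ e) \<le> Suc (N ?v) * (1 + 2 * B ?v + a * B ?v ^ e)"
      using k[of ?v] by (intro mult_le_mono1) simp
    with 2(4) 1(4) have le: "t1 + t2 \<le> ?P ?v" by linarith
    show "\<exists>t s'. exec L (Seq d (While (Fst (Var b)) c)) s r t s' r \<and> s' b = (g ^^ k (s b)) (I (s b)) \<and>
        (\<forall>i<b. s' i = s i) \<and> t \<le> ?P (s b)"
      by (intro exI conjI, rule exec.Seq[OF 1(1) 2(1)]) (use 1(2,3) 2(2,3) le in simp_all)
  qed
  moreover have "pbd ?P" by (intro pbd_intros p q N B)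
  ultimately show "\<exists>c p. pbd p \<and> implements L b c (\<lambda>v. (g ^^ k v) (I v)) p"
    by - (intro exI conjI; assumption)
qed

text \<open>Every tree is the encoding of the list of left subtrees along its right spine.\<close>

primrec elems :: "tree \<Rightarrow> tree list" where
  "elems Leaf = []"
| "elems (Node l r) = l # elems r"

lemma elems_enc_list [simp]: "elems (enc_list us) = us"
  by (induction us) auto

lemma enc_list_elems [simp]: "enc_list (elems v) = v"
  by (induction v) auto

lemma length_elems: "length (elems v) \<le> tsize v"
  by (induction v) auto

lemma tsize_elems: "e \<in> set (elems v) \<Longrightarrow> tsize e \<le> tsize v"
  by (induction v) auto

lemma tsize_enc_list_drop: "tsize (enc_list (drop i (elems v))) \<le> tsize v"
proof (induction v arbitrary: i)
  case (Node l r)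
  show ?case using Node.IH(2)[of "i - 1"] by (cases i) auto
qed simp

lemma pt_foldl_bounded:
  assumes I: "ptime L I" and l: "ptime L l"
    and G: "ptime L (\<lambda>p. G (left p) (left (right p)) (right (right p)))"
    and B: "pbd B"
    and size: "\<And>v i. i \<le> length (elems (l v)) \<Longrightarrow>
      tsize (foldl (G v) (I v) (take i (elems (l v)))) \<le> B v"
  shows "ptime L (\<lambda>v. foldl (G v) (I v) (elems (l v)))"
proof -
  \<comment> \<open>The loop state holds the unread list (whose emptiness ends the loop), the
    parameter \<open>v\<close> that \<open>G\<close> needs in every pass, and the
    accumulator.\<close>
  define step where "step = (\<lambda>z. Node (right (left z)) (Node (left (right z))
      (G (left (right z)) (right (right z)) (left (left z)))))"
  define J where "J = (\<lambda>v. Node (l v) (Node v (I v)))"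
  have step: "step (Node (enc_list (e # es)) (Node v x)) = Node (enc_list es) (Node v (G v x e))" for e es v x
    by (simp add: step_def)
  have it: "(step ^^ i) (J v) = Node (enc_list (drop i (elems (l v))))
      (Node v (foldl (G v) (I v) (take i (elems (l v)))))"
    if "i \<le> length (elems (l v))" for i v
    using that
  proof (induction i)
    case 0
    show ?case by (simp add: J_def)
  next
    case (Suc i)
    then have i: "i < length (elems (l v))" by simp
    have "(step ^^ Suc i) (J v) = step (Node (enc_list (drop i (elems (l v))))
        (Node v (foldl (G v) (I v) (take i (elems (l v))))))"
      using Suc.IH i by simp
    also have "\<dots> = Node (enc_list (drop (Suc i) (elems (l v))))
        (Node v (foldl (G v) (I v) (take (Suc i) (elems (l v)))))"
      unfolding Cons_nth_drop_Suc[OF i, symmetric] step take_Suc_conv_app_nth[OF i] by simp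
    finally show ?case .
  qed
  have "ptime L (\<lambda>v. (step ^^ length (elems (l v))) (J v))"
  proof (rule pt_loop)
    show "ptime L J" unfolding J_def by (rule pt_Node[OF l pt_Node[OF pt_id I]])
    have "ptime L (\<lambda>z. G (left (right z)) (right (right z)) (left (left z)))"
      using pt_comp[OF G pt_Node[OF pt_left[OF pt_right1] pt_Node[OF pt_right[OF pt_right1] pt_left[OF pt_left1]]]]
      by simp
    then show "ptime L step"
      unfolding step_def by (intro pt_Node pt_left pt_right pt_id)
    show "pbd (\<lambda>v. tsize (l v))" by (rule ptime_size[OF l])
    show "length (elems (l v)) \<le> tsize (l v)" for v by (rule length_elems)
    show "pbd (\<lambda>v. 1 + tsize (l v) + (1 + tsize v + B v))"
      by (intro pbd_intros B ptime_size[OF l])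
    show "left ((step ^^ i) (J v)) \<noteq> Leaf" if i: "i < length (elems (l v))" for v i
      using it[of i v] i by (simp flip: Cons_nth_drop_Suc)
    show "left ((step ^^ length (elems (l v))) (J v)) = Leaf" for v by (simp add: it)
    show "tsize ((step ^^ i) (J v)) \<le> 1 + tsize (l v) + (1 + tsize v + B v)"
      if "i \<le> length (elems (l v))" for v i
      using that tsize_enc_list_drop[of i "l v"] size[OF that] by (simp add: it)
  qed
  from pt_right[OF pt_right[OF this]] show ?thesis by (simp add: it)
qed

lemma tsize_foldl:
  assumes "\<And>x e. e \<in> set es \<Longrightarrow> tsize (G x e) \<le> tsize x + Q"
  shows "tsize (foldl G x es) \<le> tsize x + length es * Q"
  using assms
proof (induction es arbitrary: x)
  case (Cons e es)
  have "tsize (foldl G (G x e) es) \<le> tsize (G x e) + length es * Q"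
    by (rule Cons.IH) (use Cons.prems in simp)
  moreover have "tsize (G x e) \<le> tsize x + Q" by (rule Cons.prems) simp
  ultimately show ?case by simp
qed simp

text \<open>The growth per pass is additive, by an amount independent of the accumulator
  \<open>x\<close>; this keeps all intermediate values polynomial.\<close>

lemma pt_foldl:
  fixes G :: "tree \<Rightarrow> tree \<Rightarrow> tree \<Rightarrow> tree"
  assumes I: "ptime L I" and l: "ptime L l"
    and G: "ptime L (\<lambda>p. G (left p) (left (right p)) (right (right p)))"
    and q: "pbd q"
    and size: "\<And>v x e. tsize (G v x e) \<le> tsize x + q (Node v e)"
  shows "ptime L (\<lambda>v. foldl (G v) (I v) (elems (l v)))"
proof -
  from q obtain a d where ad: "\<And>v. q v \<le> a * tsize v ^ d" unfolding pbd_def by auto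
  let ?Q = "\<lambda>v. a * (1 + tsize v + tsize (l v)) ^ d"
  have B: "pbd (\<lambda>v. tsize (I v) + tsize (l v) * ?Q v)"
    by (intro pbd_intros ptime_size[OF I] ptime_size[OF l])
  show ?thesis
  proof (rule pt_foldl_bounded[OF I l G B])
  fix v i assume i: "i \<le> length (elems (l v))"
  let ?es = "take i (elems (l v))"
  have "tsize (foldl (G v) (I v) ?es) \<le> tsize (I v) + length ?es * ?Q v"
  proof (rule tsize_foldl)
    fix x e assume "e \<in> set ?es"
    then have "tsize e \<le> tsize (l v)" by (intro tsize_elems) (rule in_set_takeD)
    then have "a * tsize (Node v e) ^ d \<le> ?Q v" by (intro mult_le_mono2 power_mono) auto
    with size[of v x e] ad[of "Node v e"] show "tsize (G v x e) \<le> tsize x + ?Q v" by linarith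
  qed
  also have "length ?es * ?Q v \<le> tsize (l v) * ?Q v"
    using length_elems[of "l v"] by (intro mult_le_mono1) simp
  finally show "tsize (foldl (G v) (I v) ?es) \<le> tsize (I v) + tsize (l v) * ?Q v" by simp
  qed
qed

lemma pt_ball:
  assumes l: "ptime L l" and P: "ptime L (\<lambda>p. tree_of_bool (P (left p) (right p)))"
  shows "ptime L (\<lambda>v. tree_of_bool (\<forall>e \<in> set (elems (l v)). P v e))"
proof -
  let ?G = "\<lambda>v x e. tree_of_bool (x \<noteq> Leaf \<and> P v e)"
  have eq: "foldl (?G v) (tree_of_bool b) es = tree_of_bool (b \<and> (\<forall>e \<in> set es. P v e))" for v b es
    by (induction es arbitrary: b) auto
  have "ptime L (\<lambda>v. foldl (?G v) (tree_of_bool True) (elems (l v)))"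
  proof (rule pt_foldl[where q = "\<lambda>_. 3"])
    show "ptime L (\<lambda>p. ?G (left p) (left (right p)) (right (right p)))"
    proof (intro pt_conj pt_not pt_eq pt_const pt_left pt_right pt_id)
      show "ptime L (\<lambda>p. tree_of_bool (P (left p) (right (right p))))"
        using pt_comp[OF P, of "\<lambda>p. Node (left p) (right (right p))",
          OF pt_Node[OF pt_left1 pt_right[OF pt_right1]]] by simp
    qed
    show "tsize (?G v x e) \<le> tsize x + 3" for v x e
      using tsize_tree_of_bool[of "x \<noteq> Leaf \<and> P v e"] by linarith
  qed (rule pt_const l pbd_const)+
  then show ?thesis unfolding eq by simp
qed


section \<open>Languages in NP\<close>

lemma NP_I:
  assumes P: "ptime {} (\<lambda>z. tree_of_bool (P (left z) (right z)))"
  shows "{v. \<exists>w. tsize w \<le> a * tsize v ^ d \<and> P v w} \<in> NP"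
proof -
  from P obtain V q where q: "pbd q" and V: "implements {} 0 V (\<lambda>z. tree_of_bool (P (left z) (right z))) q"
    by (rule ptimeE)
  have run: "\<exists>t s. exec {} V (init z) [] t s [] \<and> s 0 = tree_of_bool (P (left z) (right z)) \<and> t \<le> q z" for z
  proof -
    from V obtain t s' where "exec {} V (init z) [] t s' []"
      "s' 0 = tree_of_bool (P (left (init z 0)) (right (init z 0)))" "t \<le> q (init z 0)"
      by (rule implementsE)
    then show ?thesis by (auto simp: init_def)
  qed
  have pol: "polytime V"
    unfolding polytime_def using run q unfolding pbd_def by (meson order_trans)
  \<comment> \<open>\<open>accepts\<close> asks for some halting run; determinism identifies it with
    the run supplied by \<open>run\<close>.\<close>
  have acc: "accepts V (Node v w) \<longleftrightarrow> P v w" for v w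
  proof -
    from run[of "Node v w"] obtain t s where 1: "exec {} V (init (Node v w)) [] t s []"
      "s 0 = tree_of_bool (P v w)" by auto
    then show ?thesis unfolding accepts_def using exec_deterministic[OF 1(1)]
      by (metis tree_of_bool_eq_Leaf)
  qed
  from pol show ?thesis unfolding NP_def acc[symmetric] by blast
qed

section \<open>Random linear hashing over GF(2)\<close>

lemma finite_bits [simp]: "finite (bits n)"
proof -
  have "bits n = {x. set x \<subseteq> UNIV \<and> length x = n}" by (auto simp: bits_def)
  then show ?thesis using finite_lists_length_eq[of "UNIV :: bool set" n] by simp
qed

lemma card_bits [simp]: "card (bits n) = 2 ^ n"
proof -
  have "bits n = {x. set x \<subseteq> UNIV \<and> length x = n}" by (auto simp: bits_def)
  then show ?thesis using card_lists_length_eq[of "UNIV :: bool set" n] by (simp add: card_UNIV_bool)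
qed

text \<open>Independence of two consecutive segments of a uniform bit string, in counting
  form.\<close>

lemma card_bits_append:
  "card {r \<in> bits (a + b). P (take a r) \<and> Q (drop a r)} =
   card {r \<in> bits a. P r} * card {r \<in> bits b. Q r}"
proof -
  have "bij_betw (\<lambda>(x, y). x @ y) ({r \<in> bits a. P r} \<times> {r \<in> bits b. Q r})
      {r \<in> bits (a + b). P (take a r) \<and> Q (drop a r)}"
  proof (rule bij_betw_byWitness[where f' = "\<lambda>r. (take a r, drop a r)"])
  qed (auto simp: bits_def)
  from bij_betw_same_card[OF this] show ?thesis by (simp add: card_cartesian_product)
qed

lemma card_bits_rev: "card {r \<in> bits n. P (rev r)} = card {r \<in> bits n. P r}"
  by (rule bij_betw_same_card[of rev], rule bij_betw_byWitness[where f' = rev]) (auto simp: bits_def)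

lemma card_bits_take:
  assumes "a \<le> b"
  shows "card {r \<in> bits b. P (take a r)} = card {r \<in> bits a. P r} * 2 ^ (b - a)"
proof -
  have "card {r \<in> bits (a + (b - a)). P (take a r) \<and> True} =
      card {r \<in> bits a. P r} * card {r \<in> bits (b - a). True}"
    by (rule card_bits_append)
  then show ?thesis using assms by simp
qed

section \<open>Inner products over GF(2) with a uniform vector, where \<open>\<noteq>\<close> on
  Booleans is addition\<close>

fun dot :: "bool list \<Rightarrow> bool list \<Rightarrow> bool" where
  "dot (a # r) (b # u) \<longleftrightarrow> (a \<and> b) \<noteq> dot r u"
| "dot _ _ \<longleftrightarrow> False"

lemma dot_flip:
  "length r = length u \<Longrightarrow> i < length u \<Longrightarrow> dot (r[i := \<not> r ! i]) u \<longleftrightarrow> dot r u \<noteq> u ! i"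
proof (induction r u arbitrary: i rule: list_induct2)
  case (Cons a r b u)
  then show ?case by (cases i) auto
qed simp

text \<open>Flipping bit \<open>i\<close> of \<open>r\<close> is an involution of
  \<open>bits N\<close> that adds \<open>u ! i\<close> and \<open>v ! i\<close> to the two inner
  products.\<close>

lemma card_dot_shift:
  assumes "u \<in> bits N" "v \<in> bits N" "i < N"
  shows "card {r \<in> bits N. dot r u = b \<and> dot r v = c} =
    card {r \<in> bits N. dot r u = (b \<noteq> u ! i) \<and> dot r v = (c \<noteq> v ! i)}"
proof (rule bij_betw_same_card[of "\<lambda>r. r[i := \<not> r ! i]"],
    rule bij_betw_byWitness[where f' = "\<lambda>r. r[i := \<not> r ! i]"])
qed (use assms in \<open>auto simp: bits_def dot_flip\<close>)

lemma True_in_setE: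
  assumes "True \<in> set u" obtains i where "i < length u" "u ! i"
  using assms by (metis in_set_conv_nth)

lemma card_dot1:
  assumes u: "u \<in> bits N" and nz: "True \<in> set u"
  shows "card {r \<in> bits N. \<not> dot r u} * 2 = 2 ^ N"
proof -
  from nz obtain i where i: "i < N" "u ! i" using u by (auto simp: bits_def elim: True_in_setE)
  have "card {r \<in> bits N. \<not> dot r u} = card {r \<in> bits N. dot r u}"
    using card_dot_shift[OF u u i(1), of False False] i(2) by simp
  moreover have "card (bits N) = card ({r \<in> bits N. \<not> dot r u} \<union> {r \<in> bits N. dot r u})"
    by (rule arg_cong[where f = card]) auto
  then have "card (bits N) = card {r \<in> bits N. \<not> dot r u} + card {r \<in> bits N. dot r u}"
    by (subst (asm) card_Un_disjoint) auto
  ultimately show ?thesis by simp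
qed

text \<open>Distinct nonzero vectors over GF(2) are linearly independent, so the two inner products
  are independent uniform bits.\<close>

lemma card_dot2:
  assumes u: "u \<in> bits N" and nzu: "True \<in> set u" and v: "v \<in> bits N" and nzv: "True \<in> set v"
    and ne: "u \<noteq> v"
  shows "card {r \<in> bits N. \<not> dot r u \<and> \<not> dot r v} * 4 = 2 ^ N"
proof -
  define Z where "Z b c = card {r \<in> bits N. dot r u = b \<and> dot r v = c}" for b c
  have shift: "Z b c = Z (b \<noteq> u ! i) (c \<noteq> v ! i)" if "i < N" for i b c
    unfolding Z_def using card_dot_shift[OF u v that] by blast
  \<comment> \<open>\<open>Z\<close> is invariant under translation by each pair
    \<open>(u ! i, v ! i)\<close>. A position where \<open>u\<close> is set, one where
    \<open>v\<close> is set and one where they differ yield pairs that generate the whole plane over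
    GF(2), so \<open>Z\<close> is constant.\<close>
  obtain i where i: "i < N" "u ! i" using u nzu by (auto simp: bits_def elim: True_in_setE)
  obtain j where j: "j < N" "v ! j" using v nzv by (auto simp: bits_def elim: True_in_setE)
  obtain l where l: "l < N" "u ! l \<noteq> v ! l"
    using u v ne by (auto simp: bits_def list_eq_iff_nth_eq)
  have si: "Z b c = Z (\<not> b) (c \<noteq> v ! i)" for b c using shift[OF i(1), of b c] i(2) by simp
  have sj: "Z b c = Z (b \<noteq> u ! j) (\<not> c)" for b c using shift[OF j(1), of b c] j(2) by simp
  have flip: "Z b c = Z (\<not> b) c \<and> Z b c = Z b (\<not> c)" for b c
  proof (cases "v ! i")
    case False
    then have f: "Z b c = Z (\<not> b) c" for b c using si[of b c] by simp
    show ?thesis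
    proof (cases "u ! j")
      case True
      then show ?thesis using f[of b c] sj[of b c] f[of b "\<not> c"] by simp
    qed (use f[of b c] sj[of b c] in simp)
  next
    case True
    then have f: "Z b c = Z (\<not> b) (\<not> c)" for b c using si[of b c] by simp
    show ?thesis
    proof (cases "u ! l")
      case True
      then show ?thesis using l(2) shift[OF l(1), of b c] shift[OF l(1), of b "\<not> c"] f[of b c]
        by simp
    next
      case False
      then show ?thesis using l(2) shift[OF l(1), of b c] shift[OF l(1), of "\<not> b" c] f[of b c]
        by simp
    qed
  qed
  have all: "Z False False = Z True True" "Z False True = Z True True" "Z True False = Z True True"
    using flip[of False True] flip[of True True] flip[of True False] by simp_all
  have "bits N = {r \<in> bits N. dot r u = False \<and> dot r v = False} \<union>
      ({r \<in> bits N. dot r u = False \<and> dot r v = True} \<union>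
      ({r \<in> bits N. dot r u = True \<and> dot r v = False} \<union>
       {r \<in> bits N. dot r u = True \<and> dot r v = True}))" by auto
  then have "card (bits N) = card ({r \<in> bits N. dot r u = False \<and> dot r v = False} \<union>
      ({r \<in> bits N. dot r u = False \<and> dot r v = True} \<union>
      ({r \<in> bits N. dot r u = True \<and> dot r v = False} \<union>
       {r \<in> bits N. dot r u = True \<and> dot r v = True})))" by simp
  also have "\<dots> = Z False False + (Z False True + (Z True False + Z True True))"
    unfolding Z_def by (subst card_Un_disjoint; (auto; fail)?)+
  finally have "4 * Z False False = 2 ^ N" using all by simp
  then show ?thesis unfolding Z_def by simp
qed

text \<open>The rows of the matrix are laid out one after the other in \<open>r\<close>, each reversed because a
  program that reads a row from the tape pushes its bits onto a list.\<close>

definition hash0 :: "nat \<Rightarrow> nat \<Rightarrow> bool list \<Rightarrow> bool list \<Rightarrow> bool" where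
  "hash0 N j u r \<longleftrightarrow> (\<forall>i<j. \<not> dot (rev (take N (drop (i * N) r))) u)"

text \<open>The first row is split off by \<open>card_bits_append\<close>; the \<open>J - j\<close>
  rows that are not tested remain free.\<close>

lemma card_rows:
  assumes "j \<le> J"
  shows "card {r \<in> bits (J * N). \<forall>i<j. P (take N (drop (i * N) r))} =
    card {r \<in> bits N. P r} ^ j * 2 ^ ((J - j) * N)"
  using assms
proof (induction j arbitrary: J)
  case (Suc j)
  then obtain K where J: "J = Suc K" "j \<le> K" by (cases J) auto
  have "{r \<in> bits (J * N). \<forall>i<Suc j. P (take N (drop (i * N) r))} =
      {r \<in> bits (N + K * N). P (take N r) \<and> (\<forall>i<j. P (take N (drop (i * N) (drop N r))))}"
    using J by (auto simp: All_less_Suc2 add.commute)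
  also have "card \<dots> = card {r \<in> bits N. P r} *
      card {r \<in> bits (K * N). \<forall>i<j. P (take N (drop (i * N) r))}"
    by (rule card_bits_append)
  finally show ?case
    using Suc.IH[OF J(2)] J(1) by simp
qed simp

lemma card_hash0:
  assumes "j \<le> J" "u \<in> bits N" "True \<in> set u"
  shows "card {r \<in> bits (J * N). hash0 N j u r} * 2 ^ j = 2 ^ (J * N)"
proof -
  have "card {r \<in> bits (J * N). hash0 N j u r} * 2 ^ j
      = (card {r \<in> bits N. \<not> dot r u} * 2) ^ j * 2 ^ ((J - j) * N)"
    unfolding hash0_def card_rows[OF assms(1), where P = "\<lambda>w. \<not> dot (rev w) u"]
      card_bits_rev[where P = "\<lambda>w. \<not> dot w u"]
    by (simp add: power_mult_distrib)
  also have "\<dots> = 2 ^ (N * j + (J - j) * N)"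
    unfolding card_dot1[OF assms(2,3)] by (simp add: power_add power_mult)
  also have "N * j + (J - j) * N = J * N"
    using assms(1) by (simp add: mult.commute[of N] flip: add_mult_distrib)
  finally show ?thesis .
qed

text \<open>Pairwise independence of the hash values, which is all that the variance computation for
  the second moment needs.\<close>

lemma card_hash0_pair:
  assumes "j \<le> J" "u \<in> bits N" "True \<in> set u" "v \<in> bits N" "True \<in> set v" "u \<noteq> v"
  shows "card {r \<in> bits (J * N). hash0 N j u r \<and> hash0 N j v r} * 4 ^ j = 2 ^ (J * N)"
proof -
  have "{r \<in> bits (J * N). hash0 N j u r \<and> hash0 N j v r} =
    {r \<in> bits (J * N). \<forall>i<j. \<not> dot (rev (take N (drop (i * N) r))) u \<and>
      \<not> dot (rev (take N (drop (i * N) r))) v}"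
    by (auto simp: hash0_def)
  then have "card {r \<in> bits (J * N). hash0 N j u r \<and> hash0 N j v r} * 4 ^ j
      = (card {r \<in> bits N. \<not> dot r u \<and> \<not> dot r v} * 4) ^ j * 2 ^ ((J - j) * N)"
    using card_rows[OF assms(1), where P = "\<lambda>w. \<not> dot (rev w) u \<and> \<not> dot (rev w) v" and N = N]
      card_bits_rev[where P = "\<lambda>w. \<not> dot w u \<and> \<not> dot w v" and n = N]
    by (simp add: power_mult_distrib)
  also have "\<dots> = 2 ^ (N * j + (J - j) * N)"
    unfolding card_dot2[OF assms(2-)] by (simp add: power_add power_mult)
  also have "N * j + (J - j) * N = J * N"
    using assms(1) by (simp add: mult.commute[of N] flip: add_mult_distrib)
  finally show ?thesis .
qed

text \<open>Union bound: each nonzero vector hashes to zero on \<open>j\<close> rows with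
  probability \<open>1 / 2 ^ j\<close>.\<close>

lemma hash_first_moment:
  assumes "finite S" "S \<subseteq> bits N" "\<And>u. u \<in> S \<Longrightarrow> True \<in> set u" "j \<le> J"
  shows "card {r \<in> bits (J * N). \<exists>u \<in> S. hash0 N j u r} * 2 ^ j \<le> card S * 2 ^ (J * N)"
proof -
  have "{r \<in> bits (J * N). \<exists>u \<in> S. hash0 N j u r} = (\<Union>u \<in> S. {r \<in> bits (J * N). hash0 N j u r})"
    by auto
  then have "card {r \<in> bits (J * N). \<exists>u \<in> S. hash0 N j u r}
      \<le> (\<Sum>u \<in> S. card {r \<in> bits (J * N). hash0 N j u r})"
    using card_UN_le[OF assms(1)] by simp
  then have "card {r \<in> bits (J * N). \<exists>u \<in> S. hash0 N j u r} * 2 ^ j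
      \<le> (\<Sum>u \<in> S. card {r \<in> bits (J * N). hash0 N j u r} * 2 ^ j)"
    by (simp flip: sum_distrib_right)
  also have "\<dots> = (\<Sum>u \<in> S. 2 ^ (J * N))"
    using assms by (intro sum.cong card_hash0) auto
  finally show ?thesis by simp
qed

text \<open>Chebyshev's inequality for the number of elements of \<open>S\<close> that hash to zero.\<close>

lemma hash_second_moment:
  assumes S: "finite S" "S \<subseteq> bits N" "\<And>u. u \<in> S \<Longrightarrow> True \<in> set u" and j: "j \<le> J"
  shows "card {r \<in> bits (J * N). \<forall>u \<in> S. \<not> hash0 N j u r} * card S \<le> 2 ^ j * 2 ^ (J * N)"
proof (cases "S = {}")
  case False
  let ?R = "bits (J * N)"
  define T where "T = (2 :: real) ^ (J * N)"
  define \<mu> where "\<mu> = real (card S) / 2 ^ j"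
  define I where "I u r = (of_bool (hash0 N j u r) :: real)" for u r
  define X where "X r = (\<Sum>u \<in> S. I u r)" for r
  define bad where "bad = {r \<in> ?R. \<forall>u \<in> S. \<not> hash0 N j u r}"
  have \<mu>: "\<mu> > 0" using False S(1) by (simp add: \<mu>_def card_gt_0_iff)
  have I1: "(\<Sum>r \<in> ?R. I u r) = T / 2 ^ j" if "u \<in> S" for u
  proof -
    have "(\<Sum>r \<in> ?R. I u r) = real (card {r \<in> ?R. hash0 N j u r})"
      by (simp add: I_def of_bool_def sum.If_cases Int_def)
    moreover have "real (card {r \<in> ?R. hash0 N j u r} * 2 ^ j) = real (2 ^ (J * N))"
      by (subst card_hash0[OF j]) (use that S(2,3) in auto)
    then have "real (card {r \<in> ?R. hash0 N j u r}) * 2 ^ j = T"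
      unfolding T_def by simp
    ultimately show ?thesis by (simp add: field_simps)
  qed
  have I2: "(\<Sum>r \<in> ?R. I u r * I v r) = T / 4 ^ j" if "u \<in> S" "v \<in> S" "u \<noteq> v" for u v
  proof -
    have "(\<Sum>r \<in> ?R. I u r * I v r) = real (card {r \<in> ?R. hash0 N j u r \<and> hash0 N j v r})"
    proof -
      have "I u r * I v r = (if hash0 N j u r \<and> hash0 N j v r then 1 else 0)" for r
        by (simp add: I_def)
      then show ?thesis by (simp add: sum.If_cases Int_def)
    qed
    moreover have "real (card {r \<in> ?R. hash0 N j u r \<and> hash0 N j v r} * 4 ^ j) = real (2 ^ (J * N))"
      by (subst card_hash0_pair[OF j]) (use that S(2,3) in auto)
    then have "real (card {r \<in> ?R. hash0 N j u r \<and> hash0 N j v r}) * 4 ^ j = T"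
      unfolding T_def by simp
    ultimately show ?thesis by (simp add: field_simps)
  qed
  have EX: "(\<Sum>r \<in> ?R. X r) = \<mu> * T"
    unfolding X_def by (subst sum.swap) (simp add: I1 \<mu>_def)
  \<comment> \<open>The square is expanded over pairs: distinct pairs contribute at most
    \<open>\<mu>\<^sup>2 * T\<close>, the diagonal \<open>\<mu> * T\<close>.\<close>
  have "(\<Sum>r \<in> ?R. (X r)\<^sup>2) = (\<Sum>u \<in> S. \<Sum>v \<in> S. \<Sum>r \<in> ?R. I u r * I v r)"
    unfolding X_def power2_eq_square sum_product
    by (subst sum.swap) (intro sum.cong refl sum.swap)
  also have "\<dots> \<le> (\<Sum>u \<in> S. \<mu> * T / 2 ^ j + T / 2 ^ j)"
  proof (rule sum_mono)
    fix u assume u: "u \<in> S"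
    \<comment> \<open>The off-diagonal value is charged to \<open>v = u\<close> as well; this
      loosens the bound slightly but makes the summand constant in \<open>v\<close> up to the
      diagonal term.\<close>
    have "(\<Sum>v \<in> S. \<Sum>r \<in> ?R. I u r * I v r) \<le> (\<Sum>v \<in> S. T / 4 ^ j + (if v = u then T / 2 ^ j else 0))"
    proof (rule sum_mono)
      fix v assume v: "v \<in> S"
      have sq: "I u r * I u r = I u r" for r by (simp add: I_def)
      have "T \<ge> 0" by (simp add: T_def)
      then show "(\<Sum>r \<in> ?R. I u r * I v r) \<le> T / 4 ^ j + (if v = u then T / 2 ^ j else 0)"
        using I2[OF u v] I1[OF u] by (cases "v = u") (auto simp: sq)
    qed
    also have "\<dots> = \<mu> * T / 2 ^ j + T / 2 ^ j"
      using u S(1) by (simp add: sum.distrib \<mu>_def flip: power_mult_distrib)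
    finally show "(\<Sum>v \<in> S. \<Sum>r \<in> ?R. I u r * I v r) \<le> \<mu> * T / 2 ^ j + T / 2 ^ j" .
  qed
  also have "\<dots> = \<mu>\<^sup>2 * T + \<mu> * T"
    by (simp add: \<mu>_def field_simps power2_eq_square)
  finally have EX2: "(\<Sum>r \<in> ?R. (X r)\<^sup>2) \<le> \<mu>\<^sup>2 * T + \<mu> * T" .
  have "(\<Sum>r \<in> ?R. (X r - \<mu>)\<^sup>2) = (\<Sum>r \<in> ?R. (X r)\<^sup>2) - 2 * \<mu> * (\<Sum>r \<in> ?R. X r) + \<mu>\<^sup>2 * T"
    by (simp add: power2_diff sum.distrib sum_subtractf sum_distrib_left T_def ac_simps)
  moreover have "2 * \<mu> * (\<Sum>r \<in> ?R. X r) = 2 * (\<mu>\<^sup>2 * T)"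
    unfolding EX by (simp add: power2_eq_square)
  ultimately have var: "(\<Sum>r \<in> ?R. (X r - \<mu>)\<^sup>2) \<le> \<mu> * T" using EX2 by linarith
  \<comment> \<open>On a bad tape \<open>X r\<close> is 0 and thus deviates from the mean by exactly
    \<open>\<mu>\<close>.\<close>
  have "real (card bad) * \<mu>\<^sup>2 = (\<Sum>r \<in> bad. (X r - \<mu>)\<^sup>2)"
    by (simp add: bad_def X_def I_def)
  also have "\<dots> \<le> (\<Sum>r \<in> ?R. (X r - \<mu>)\<^sup>2)"
    by (intro sum_mono2) (auto simp: bad_def)
  finally have "real (card bad) * \<mu> * \<mu> \<le> T * \<mu>"
    using var by (simp add: power2_eq_square mult.commute)
  then have "real (card bad) * \<mu> \<le> T" using \<mu> by simp
  then have "real (card bad * card S) \<le> real (2 ^ j * 2 ^ (J * N))"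
    by (simp add: \<mu>_def T_def field_simps)
  then show ?thesis unfolding bad_def by (simp only: of_nat_le_iff)
qed simp


section \<open>Approximately maximal sets by hashing\<close>

text \<open>The leading \<open>True\<close> keeps every vector nonzero; a zero vector would hash to
  zero at every level.\<close>

definition tuples :: "nat \<Rightarrow> bool list set \<Rightarrow> bool list set" where
  "tuples t A = {True # concat xs |xs. length xs = t \<and> set xs \<subseteq> A}"

lemma concat_inject:
  assumes "concat xs = concat ys" "length xs = length ys" "set xs \<subseteq> bits n" "set ys \<subseteq> bits n"
  shows "xs = ys"
  using assms(2,1,3,4)
  by (induction xs ys rule: list_induct2) (auto simp: bits_def)

lemma card_tuples:
  assumes "A \<subseteq> bits n" shows "card (tuples t A) = card A ^ t"
proof -
  have fin: "finite A" using assms by (rule finite_subset) simp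
  have "tuples t A = (\<lambda>xs. True # concat xs) ` {xs. set xs \<subseteq> A \<and> length xs = t}"
    by (auto simp: tuples_def)
  moreover have "inj_on (\<lambda>xs. True # concat xs) {xs. set xs \<subseteq> A \<and> length xs = t}"
    using assms by (auto intro!: inj_onI concat_inject)
  ultimately show ?thesis by (simp add: card_image card_lists_length_eq[OF fin])
qed

lemma tuples_bits:
  assumes "A \<subseteq> bits n" shows "tuples t A \<subseteq> bits (t * n + 1)"
proof -
  have "length (concat xs) = length xs * n" if "set xs \<subseteq> A" for xs
    using that assms by (induction xs) (auto simp: bits_def)
  then show ?thesis by (auto simp: tuples_def bits_def)
qed

lemma tuples_True: "u \<in> tuples t A \<Longrightarrow> True \<in> set u"
  by (auto simp: tuples_def)

definition near_max :: "nat \<Rightarrow> (bool list \<Rightarrow> bool list set) \<Rightarrow> bool list \<Rightarrow> bool" where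
  "near_max m A y \<longleftrightarrow> (\<forall>y' \<in> bits m. card (A y') \<le> 2 * card (A y))"

text \<open>This describes the outcome of the search without naming the largest level:
  \<open>hash0 N j u r\<close> gets weaker as \<open>j\<close> decreases, so a tuple alive at the
  deepest level that any \<open>y'\<close> reaches is alive at all levels reached.\<close>

definition survivor ::
  "nat \<Rightarrow> nat \<Rightarrow> nat \<Rightarrow> (bool list \<Rightarrow> bool list set) \<Rightarrow> bool list \<Rightarrow> bool list \<Rightarrow> bool" where
  "survivor m N t A r y \<longleftrightarrow> y \<in> bits m \<and> (\<forall>j\<le>N. (\<exists>y' \<in> bits m. \<exists>u \<in> tuples t (A y'). hash0 N j u r) \<longrightarrow>
     (\<exists>u \<in> tuples t (A y). hash0 N j u r))"

text \<open>Taking \<open>t\<close>-th powers turns a factor 2 between \<open>card (A y)\<close> and the maximum into a factor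
  \<open>2 ^ t\<close>, enough for a union bound over all \<open>y\<close>. At the level \<open>j\<close> where
  about \<open>2 ^ c\<close> of the tuples for a maximal set survive, no tuple for a set less than half as large
  survives.\<close>

lemma survivor_near_max:
  assumes A: "\<And>y. y \<in> bits m \<Longrightarrow> A y \<subseteq> bits n"
    and t: "t = m + 2 * c + 1" and N: "N = t * n + 1"
  shows "card {r \<in> bits (N * N). \<not> (\<forall>y. survivor m N t A r y \<longrightarrow> near_max m A y)} * 2 ^ c
    \<le> 2 * 2 ^ (N * N)"
proof -
  define M where "M = Max ((\<lambda>y. card (A y)) ` bits m)"
  have ne: "bits m \<noteq> {}" using card_bits[of m] by (metis card.empty power_eq_0_iff zero_neq_numeral)
  have "M \<in> (\<lambda>y. card (A y)) ` bits m" unfolding M_def using ne by (intro Max_in) auto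
  then obtain z where z: "z \<in> bits m" "card (A z) = M" by auto
  have M: "card (A y) \<le> M" if "y \<in> bits m" for y
    unfolding M_def using that by (intro Max_ge) auto
  show ?thesis
  proof (cases "M = 0")
    case True
    have "{r \<in> bits (N * N). \<not> (\<forall>y. survivor m N t A r y \<longrightarrow> near_max m A y)} = {}"
      using M True by (auto simp: near_max_def)
    then show ?thesis by (simp only: card.empty)
  next
    case False
    have ex: "\<exists>j. M ^ t < 2 ^ (j + c + 1)"
      by (rule exI[of _ "M ^ t"]) (use less_exp[of "M ^ t + c + 1"] in linarith)
    \<comment> \<open>If \<open>j\<close> is not 0, then
      \<open>2 ^ (j + c) \<le> M ^ t < 2 ^ (j + c + 1)\<close>: between \<open>2 ^ c\<close> and
      \<open>2 ^ (c + 1)\<close> tuples of a maximal set are expected to survive at this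
      level.\<close>
    define j where "j = (LEAST j. M ^ t < 2 ^ (j + c + 1))"
    have up: "M ^ t < 2 ^ (j + c + 1)" unfolding j_def using ex by (rule LeastI_ex)
    have low: "2 ^ (j + c) \<le> M ^ t" if "j \<noteq> 0"
    proof -
      from that obtain i where i: "j = Suc i" by (cases j) auto
      then have "i < j" by simp
      then have "\<not> M ^ t < 2 ^ (i + c + 1)" unfolding j_def by (rule not_less_Least)
      then show ?thesis using i by simp
    qed
    \<comment> \<open>\<open>N\<close> rows are enough because a cover has at most
      \<open>2 ^ n\<close> elements, so there are at most \<open>2 ^ (n * t)\<close> tuples and
      \<open>j \<le> n * t < N\<close>.\<close>
    have jN: "j \<le> N"
    proof (cases "j = 0")
      case False
      have "card (A z) \<le> 2 ^ n" using card_mono[OF _ A[OF z(1)]] by simp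
      then have "M ^ t \<le> (2 ^ n) ^ t" unfolding z(2) by (rule power_mono) simp
      with low[OF False] have "(2::nat) ^ (j + c) \<le> 2 ^ (n * t)" by (simp add: power_mult)
      then have "j + c \<le> n * t" by (subst (asm) power_increasing_iff) auto
      then show ?thesis using N by (simp add: mult.commute)
    qed simp
    define bad1 where "bad1 = {r \<in> bits (N * N). \<forall>u \<in> tuples t (A z). \<not> hash0 N j u r}"
    define W where "W = {y \<in> bits m. 2 * card (A y) < M}"
    define S where "S = (\<Union>y \<in> W. tuples t (A y))"
    define bad2 where "bad2 = {r \<in> bits (N * N). \<exists>u \<in> S. hash0 N j u r}"
    have tb: "tuples t (A y) \<subseteq> bits N" if "y \<in> bits m" for y
      using tuples_bits[OF A[OF that]] N by simp
    have fin: "finite (tuples t (A y))" if "y \<in> bits m" for y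
      using tb[OF that] by (rule finite_subset) simp
    have b1: "card bad1 * 2 ^ c \<le> 2 ^ (N * N)"
    \<comment> \<open>At level 0 every tuple survives, so it suffices that \<open>A z\<close> is
      nonempty; the lower bound \<open>low\<close> is available only at positive levels.\<close>
    proof (cases "j = 0")
      case True
      have "card (tuples t (A z)) \<noteq> 0" using card_tuples[OF A[OF z(1)], of t] z(2) False by simp
      then have "tuples t (A z) \<noteq> {}" by auto
      then have "bad1 = {}" using True by (auto simp: bad1_def hash0_def)
      then show ?thesis by simp
    next
      case j: False
      have "card bad1 * card (tuples t (A z)) \<le> 2 ^ j * 2 ^ (N * N)"
        unfolding bad1_def
        by (rule hash_second_moment) (use fin tb z jN tuples_True in auto)
      moreover have "card bad1 * 2 ^ (j + c) \<le> card bad1 * card (tuples t (A z))"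
        using low[OF j] card_tuples[OF A[OF z(1)], of t] z(2) by simp
      moreover have "card bad1 * 2 ^ (j + c) = 2 ^ j * (card bad1 * 2 ^ c)"
        by (simp add: power_add)
      ultimately have "2 ^ j * (card bad1 * 2 ^ c) \<le> 2 ^ j * 2 ^ (N * N)" by linarith
      then show ?thesis by (rule mult_left_le_imp_le) simp
    qed
    \<comment> \<open>The exponent \<open>t = m + 2 * c + 1\<close> is spent as follows:
      \<open>m\<close> on the union over at most \<open>2 ^ m\<close> outputs, \<open>c + 1\<close>
      on the upper bound \<open>2 ^ (j + c + 1)\<close> for \<open>M ^ t\<close>, and
      \<open>c\<close> on the failure probability.\<close>
    have b2: "card bad2 * 2 ^ c \<le> 2 ^ (N * N)"
    proof -
      have "card (tuples t (A y)) * 2 ^ t \<le> 2 ^ (j + c + 1)" if "y \<in> W" for y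
      proof -
        have y: "y \<in> bits m" "2 * card (A y) \<le> M" using that by (auto simp: W_def)
        have "card (tuples t (A y)) * 2 ^ t = (2 * card (A y)) ^ t"
          using card_tuples[OF A[OF y(1)]] by (simp add: power_mult_distrib)
        also have "\<dots> \<le> M ^ t" using y(2) by (rule power_mono) simp
        finally show ?thesis using up by linarith
      qed
      then have "(\<Sum>y \<in> W. card (tuples t (A y)) * 2 ^ t) \<le> (\<Sum>y \<in> W. 2 ^ (j + c + 1))"
        by (rule sum_mono)
      also have "\<dots> \<le> 2 ^ m * 2 ^ (j + c + 1)"
        using card_mono[of "bits m" W] by (simp add: W_def)
      finally have "(\<Sum>y \<in> W. card (tuples t (A y)) * 2 ^ t) \<le> 2 ^ m * 2 ^ (j + c + 1)" .
      moreover have "card S \<le> (\<Sum>y \<in> W. card (tuples t (A y)))"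
        unfolding S_def by (rule card_UN_le) (simp add: W_def)
      then have "card S * 2 ^ t \<le> (\<Sum>y \<in> W. card (tuples t (A y)) * 2 ^ t)"
        by (simp flip: sum_distrib_right)
      ultimately have S: "card S * 2 ^ t \<le> 2 ^ m * 2 ^ (j + c + 1)" by linarith
      have "card bad2 * 2 ^ j \<le> card S * 2 ^ (N * N)"
        unfolding bad2_def
      proof (rule hash_first_moment)
        show "S \<subseteq> bits N" using tb by (auto simp: S_def W_def)
        then show "finite S" by (rule finite_subset) simp
      qed (use jN tuples_True in \<open>auto simp: S_def\<close>)
      then have "card bad2 * 2 ^ j * 2 ^ t \<le> card S * 2 ^ (N * N) * 2 ^ t" by simp
      also have "\<dots> = card S * 2 ^ t * 2 ^ (N * N)" by simp
      also have "\<dots> \<le> 2 ^ m * 2 ^ (j + c + 1) * 2 ^ (N * N)" using S by (rule mult_le_mono1)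
      also have "\<dots> = 2 ^ (j + m + c + 1) * 2 ^ (N * N)"
        by (simp add: power_add)
      finally have "card bad2 * 2 ^ j * 2 ^ t \<le> 2 ^ (j + m + c + 1) * 2 ^ (N * N)" .
      moreover have "card bad2 * 2 ^ j * 2 ^ t = 2 ^ (j + m + c + 1) * (card bad2 * 2 ^ c)"
      proof -
        have "(2::nat) ^ t = 2 ^ (m + c + 1) * 2 ^ c" unfolding t by (simp flip: power_add)
        then show ?thesis by (simp add: power_add)
      qed
      ultimately have "2 ^ (j + m + c + 1) * (card bad2 * 2 ^ c) \<le> 2 ^ (j + m + c + 1) * 2 ^ (N * N)"
        by linarith
      then show ?thesis by (rule mult_left_le_imp_le) simp
    qed
    have "{r \<in> bits (N * N). \<not> (\<forall>y. survivor m N t A r y \<longrightarrow> near_max m A y)} \<subseteq> bad1 \<union> bad2"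
    proof
      fix r assume "r \<in> {r \<in> bits (N * N). \<not> (\<forall>y. survivor m N t A r y \<longrightarrow> near_max m A y)}"
      then obtain y where r: "r \<in> bits (N * N)" and y: "survivor m N t A r y" "\<not> near_max m A y"
        by blast
      from y(2) have "2 * card (A y) < M" using M unfolding near_max_def by force
      then have W: "y \<in> W" using y(1) by (auto simp: W_def survivor_def)
      show "r \<in> bad1 \<union> bad2"
      proof (cases "r \<in> bad1")
        case False
        then have "\<exists>u \<in> tuples t (A z). hash0 N j u r" using r by (auto simp: bad1_def)
        then have "\<exists>u \<in> tuples t (A y). hash0 N j u r"
          using y(1) z(1) jN unfolding survivor_def by blast
        then show ?thesis using W r by (auto simp: bad2_def S_def)
      qed simp
    qed
    then have "card {r \<in> bits (N * N). \<not> (\<forall>y. survivor m N t A r y \<longrightarrow> near_max m A y)}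
        \<le> card (bad1 \<union> bad2)"
      by (rule card_mono[rotated]) (auto simp: bad1_def bad2_def)
    also have "\<dots> \<le> card bad1 + card bad2" by (rule card_Un_le)
    finally have "card {r \<in> bits (N * N). \<not> (\<forall>y. survivor m N t A r y \<longrightarrow> near_max m A y)} * 2 ^ c
        \<le> (card bad1 + card bad2) * 2 ^ c" by (rule mult_le_mono1)
    with b1 b2 show ?thesis by (simp add: add_mult_distrib)
  qed
qed


section \<open>The greedy algorithm\<close>

primrec finishes ::
  "('s \<Rightarrow> nat) \<Rightarrow> ('s \<Rightarrow> bool list \<Rightarrow> 's) \<Rightarrow> nat \<Rightarrow> nat \<Rightarrow> 's \<Rightarrow> bool list \<Rightarrow> bool" where
  "finishes d step M 0 s r \<longleftrightarrow> d s = 0"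
| "finishes d step M (Suc R) s r \<longleftrightarrow>
     d s = 0 \<or> finishes d step M R (step s (take M r)) (drop M r)"

text \<open>Union bound over adaptive rounds, by splitting off the first block: either it fails to
  contract \<open>d\<close>, or the remaining rounds fail from a state with contracted
  \<open>d\<close>. At the end \<open>d s\<close> is a natural number below 1, hence 0.\<close>

lemma card_not_finishes:
  fixes \<delta> \<rho> :: real
  assumes inv: "\<And>s r. I s \<Longrightarrow> d s \<noteq> 0 \<Longrightarrow> r \<in> bits M \<Longrightarrow> I (step s r)"
    and prob: "\<And>s. I s \<Longrightarrow> d s \<noteq> 0 \<Longrightarrow>
      real (card {r \<in> bits M. \<not> real (d (step s r)) \<le> \<rho> * real (d s)}) \<le> \<delta> * 2 ^ M"
    and \<rho>: "0 \<le> \<rho>" and \<delta>: "0 \<le> \<delta>"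
    and "I s" and "\<rho> ^ R * real (d s) < 1"
  shows "real (card {r \<in> bits (R * M). \<not> finishes d step M R s r}) \<le> real R * \<delta> * 2 ^ (R * M)"
  using assms(5,6)
proof (induction R arbitrary: s)
  case 0
  then have "d s = 0" by simp
  then show ?case by simp
next
  case (Suc R)
  show ?case
  proof (cases "d s = 0")
    case False
    let ?g = "\<lambda>r. real (d (step s r)) \<le> \<rho> * real (d s)"
    let ?B = "{r \<in> bits M. \<not> ?g r}" and ?G = "{r \<in> bits M. ?g r}"
    let ?F = "\<lambda>s. {r \<in> bits (R * M). \<not> finishes d step M R s r}"
    have sub: "{r \<in> bits (Suc R * M). \<not> finishes d step M (Suc R) s r} \<subseteq>
        (\<lambda>(x, y). x @ y) ` (?B \<times> bits (R * M) \<union> (SIGMA x : ?G. ?F (step s x)))"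
    proof
      fix r assume r: "r \<in> {r \<in> bits (Suc R * M). \<not> finishes d step M (Suc R) s r}"
      let ?x = "take M r" and ?y = "drop M r"
      have "?x \<in> bits M" "?y \<in> bits (R * M)" "\<not> finishes d step M R (step s ?x) ?y"
        using r by (auto simp: bits_def)
      then have "(?x, ?y) \<in> ?B \<times> bits (R * M) \<union> (SIGMA x : ?G. ?F (step s x))"
        by (cases "?g ?x") auto
      then show "r \<in> (\<lambda>(x, y). x @ y) ` (?B \<times> bits (R * M) \<union> (SIGMA x : ?G. ?F (step s x)))"
        by (rule rev_image_eqI) simp
    qed
    have IH: "real (card (?F (step s x))) \<le> real R * \<delta> * 2 ^ (R * M)" if "x \<in> ?G" for x
    proof (rule Suc.IH)
      show "I (step s x)" using inv[OF Suc.prems(1) False] that by simp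
      have "\<rho> ^ R * real (d (step s x)) \<le> \<rho> ^ R * (\<rho> * real (d s))"
        using that \<rho> by (intro mult_left_mono) auto
      with Suc.prems(2) show "\<rho> ^ R * real (d (step s x)) < 1" by (simp add: ac_simps)
    qed
    have "card {r \<in> bits (Suc R * M). \<not> finishes d step M (Suc R) s r}
        \<le> card (?B \<times> bits (R * M) \<union> (SIGMA x : ?G. ?F (step s x)))"
      by (rule surj_card_le[OF _ sub]) auto
    also have "\<dots> \<le> card (?B \<times> bits (R * M)) + card (SIGMA x : ?G. ?F (step s x))"
      by (rule card_Un_le)
    also have "\<dots> = card ?B * 2 ^ (R * M) + (\<Sum>x \<in> ?G. card (?F (step s x)))"
      by (subst card_SigmaI) (auto simp: card_cartesian_product)
    finally have "real (card {r \<in> bits (Suc R * M). \<not> finishes d step M (Suc R) s r})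
        \<le> real (card ?B * 2 ^ (R * M) + (\<Sum>x \<in> ?G. card (?F (step s x))))"
      by (rule of_nat_mono)
    also have "\<dots> = real (card ?B) * 2 ^ (R * M) + (\<Sum>x \<in> ?G. real (card (?F (step s x))))"
      by simp
    also have "\<dots> \<le> \<delta> * 2 ^ M * 2 ^ (R * M) + (\<Sum>x \<in> bits M. real R * \<delta> * 2 ^ (R * M))"
    proof (intro add_mono mult_right_mono prob Suc.prems False)
      have "(\<Sum>x \<in> ?G. real (card (?F (step s x)))) \<le> (\<Sum>x \<in> ?G. real R * \<delta> * 2 ^ (R * M))"
        by (rule sum_mono) (rule IH)
      also have "\<dots> \<le> (\<Sum>x \<in> bits M. real R * \<delta> * 2 ^ (R * M))"
        using \<delta> by (intro sum_mono2) auto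
      finally show "(\<Sum>x \<in> ?G. real (card (?F (step s x)))) \<le> (\<Sum>x \<in> bits M. real R * \<delta> * 2 ^ (R * M))" .
    qed simp
    also have "\<dots> = real (Suc R) * \<delta> * 2 ^ (Suc R * M)"
      by (simp add: power_add algebra_simps)
    finally show ?thesis .
  qed (use \<delta> in simp)
qed

section \<open>Bit streams and unary arithmetic on trees\<close>

lemma pt_app1: "ptime L f \<Longrightarrow> ptime L (\<lambda>v. f (left v))"
  by (rule pt_comp[OF _ pt_left1])

lemma funpow_right: "(right ^^ i) w = enc_list (drop i (elems w))"
proof (induction i)
  case (Suc i)
  have "right (enc_list us) = enc_list (tl us)" for us by (cases us) auto
  with Suc show ?case by (simp add: drop_Suc tl_drop)
qed simp

text \<open>Any tree is read as an infinite stream: beyond the end of its right spine all bits are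
  \<open>False\<close>, as \<open>left\<close> and \<open>right\<close> map \<open>Leaf\<close> to
  \<open>Leaf\<close>.\<close>

definition sbit :: "tree \<Rightarrow> nat \<Rightarrow> bool" where
  "sbit w i \<longleftrightarrow> left ((right ^^ i) w) \<noteq> Leaf"

definition sbits :: "nat \<Rightarrow> tree \<Rightarrow> bool list" where
  "sbits n w = map (sbit w) [0..<n]"

definition enc_bits :: "bool list \<Rightarrow> tree" where
  "enc_bits bs = enc_list (map tree_of_bool bs)"

lemma sbits_in_bits [simp]: "sbits n w \<in> bits n"
  by (simp add: sbits_def bits_def)

lemma length_sbits [simp]: "length (sbits n w) = n"
  by (simp add: sbits_def)

lemma nth_sbits [simp]: "i < n \<Longrightarrow> sbits n w ! i = sbit w i"
  by (simp add: sbits_def)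

lemma sbit_Node_0 [simp]: "sbit (Node a w) 0 \<longleftrightarrow> a \<noteq> Leaf"
  by (simp add: sbit_def)

lemma sbit_Node_Suc [simp]: "sbit (Node a w) (Suc i) = sbit w i"
  by (simp add: sbit_def funpow_Suc_right del: funpow.simps)

lemma sbit_funpow_right: "sbit ((right ^^ j) w) i = sbit w (j + i)"
  by (simp add: sbit_def funpow_right add.commute)

lemma sbits_Suc: "sbits (Suc n) w = sbit w 0 # sbits n (right w)"
  using sbit_funpow_right[of 1 w]
  by (simp add: sbits_def upt_conv_Cons map_Suc_upt[symmetric] comp_def del: upt_Suc)

lemma sbits_enc_bits [simp]: "length bs = n \<Longrightarrow> sbits n (enc_bits bs) = bs"
proof (induction bs arbitrary: n)
  case (Cons b bs)
  then show ?case by (cases n) (auto simp: sbits_Suc enc_bits_def)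
qed (simp add: sbits_def)

lemma tsize_enc_bits: "tsize (enc_bits bs) \<le> 1 + 4 * length bs"
proof (induction bs)
  case (Cons b bs)
  then show ?case using tsize_tree_of_bool[of b] by (simp add: enc_bits_def)
qed (simp add: enc_bits_def)

lemma concat_sbits:
  "concat (map (\<lambda>i. sbits n ((right ^^ (i * n)) w)) [0..<t]) = sbits (t * n) w"
proof (induction t)
  case (Suc t)
  have "sbits (Suc t * n) w = sbits (t * n) w @ map (sbit w) [t * n..<t * n + n]"
  proof -
    have "[0..<Suc t * n] = [0..<t * n] @ [t * n..<t * n + n]"
      using upt_add_eq_append[of 0 "t * n" n] by (simp add: add.commute)
    then show ?thesis unfolding sbits_def by simp
  qed
  moreover have "map (sbit w) [t * n..<t * n + n] = sbits n ((right ^^ (t * n)) w)"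
    by (rule nth_equalityI) (simp_all add: sbit_funpow_right)
  ultimately show ?case using Suc by simp
qed (simp add: sbits_def)

definition len :: "tree \<Rightarrow> nat" where
  "len v = length (elems v)"

lemma len_simps [simp]: "len Leaf = 0" "len (Node a v) = Suc (len v)"
  by (simp_all add: len_def)

lemma len_enc_nat [simp]: "len (enc_nat n) = n"
  by (induction n) auto

lemma tsize_enc_nat [simp]: "tsize (enc_nat n) = 2 * n + 1"
  by (induction n) auto

text \<open>Only the length of the spine of \<open>k\<close> counts, so any list can serve as a
  unary number.\<close>

definition dropt :: "tree \<Rightarrow> tree \<Rightarrow> tree" where
  "dropt k w = foldl (\<lambda>x e. right x) w (elems k)"

lemma dropt_eq: "dropt k w = (right ^^ len k) w"
proof -
  have "foldl (\<lambda>x e. right x) w es = (right ^^ length es) w" for es :: "tree list"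
    by (induction es arbitrary: w) (simp_all add: funpow_swap1)
  then show ?thesis by (simp add: dropt_def len_def)
qed

lemma tsize_dropt: "tsize (dropt k w) \<le> tsize w"
  unfolding dropt_eq funpow_right by (rule tsize_enc_list_drop)

lemma pt_dropt:
  assumes f: "ptime L f" and g: "ptime L g" shows "ptime L (\<lambda>v. dropt (f v) (g v))"
  unfolding dropt_def
proof (rule pt_foldl[OF g f])
  show "ptime L (\<lambda>p. right (left (right p)))" by (intro pt_intros)
  show "tsize (right x) \<le> tsize x + 0" for x using tsize_right[of x] by simp
qed (rule pbd_const)

definition revapp :: "tree \<Rightarrow> tree \<Rightarrow> tree" where
  "revapp p w = foldl (\<lambda>x e. Node e x) w (elems p)"

lemma revapp_eq: "revapp p w = enc_list (rev (elems p) @ elems w)"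
proof -
  have "foldl (\<lambda>x e. Node e x) w es = enc_list (rev es @ elems w)" for es
    by (induction es arbitrary: w) auto
  then show ?thesis by (simp add: revapp_def)
qed

lemma pt_revapp:
  assumes f: "ptime L f" and g: "ptime L g" shows "ptime L (\<lambda>v. revapp (f v) (g v))"
  unfolding revapp_def
proof (rule pt_foldl[OF g f])
  show "ptime L (\<lambda>p. Node (right (right p)) (left (right p)))" by (intro pt_intros)
  show "tsize (Node e x) \<le> tsize x + tsize (Node v e)" for e x v by simp
qed (rule pbd_tsize)

definition uadd :: "tree \<Rightarrow> tree \<Rightarrow> tree" where
  "uadd a b = foldl (\<lambda>x e. Node Leaf x) a (elems b)"

lemma uadd_enc_nat [simp]: "uadd (enc_nat a) (enc_nat b) = enc_nat (a + b)"
proof (induction b arbitrary: a)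
  case (Suc b)
  then show ?case using Suc[of "Suc a"] by (simp add: uadd_def)
qed (simp add: uadd_def)

lemma tsize_uadd: "tsize (uadd a b) \<le> tsize a + 2 * tsize b"
proof -
  have "tsize (uadd a b) \<le> tsize a + length (elems b) * 2"
    unfolding uadd_def by (rule tsize_foldl) simp
  then show ?thesis using length_elems[of b] by linarith
qed

lemma pt_uadd:
  assumes f: "ptime L f" and g: "ptime L g" shows "ptime L (\<lambda>v. uadd (f v) (g v))"
  unfolding uadd_def
proof (rule pt_foldl[OF f g])
  show "ptime L (\<lambda>p. Node Leaf (left (right p)))" by (intro pt_intros)
  show "tsize (Node Leaf x) \<le> tsize x + 2" for x by simp
qed (rule pbd_const)

definition umul :: "tree \<Rightarrow> tree \<Rightarrow> tree" where
  "umul a b = foldl (\<lambda>x e. uadd x b) Leaf (elems a)"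

lemma umul_enc_nat [simp]: "umul (enc_nat a) (enc_nat b) = enc_nat (a * b)"
proof -
  have "foldl (\<lambda>x e. uadd x (enc_nat b)) (enc_nat c) (elems (enc_nat a)) = enc_nat (c + a * b)" for c
    by (induction a arbitrary: c) (auto simp: add.assoc)
  from this[of 0] show ?thesis by (simp add: umul_def)
qed

lemma pt_umul:
  assumes f: "ptime L f" and g: "ptime L g" shows "ptime L (\<lambda>v. umul (f v) (g v))"
  unfolding umul_def
proof (rule pt_foldl[OF pt_const f])
  show "ptime L (\<lambda>p. uadd (left (right p)) (g (left p)))"
    by (intro pt_uadd pt_intros pt_app1 g)
  show "tsize (uadd x (g v)) \<le> tsize x + 2 * tsize (g (left (Node v e)))" for x v e
    using tsize_uadd by simp
  show "pbd (\<lambda>z. 2 * tsize (g (left z)))" by (intro pbd_intros ptime_size[OF pt_app1[OF g]])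
qed


section \<open>Evaluating formulas\<close>

text \<open>A formula is flattened into the list of its subformulas in postfix order, which a stack
  machine can process from left to right.\<close>

primrec post :: "formula \<Rightarrow> tree list" where
  "post (Const b) = [enc_formula (Const b)]"
| "post (Atom v) = [enc_formula (Atom v)]"
| "post (Neg F) = post F @ [enc_formula (Neg F)]"
| "post (Conj F G) = post G @ post F @ [enc_formula (Conj F G)]"
| "post (Disj F G) = post G @ post F @ [enc_formula (Disj F G)]"

text \<open>A preorder traversal with a stack of pending subformulas (tag 2 has one operand, tags 3
  and 4 have two). Every visited node is pushed onto the output, and reversed preorder is exactly
  the postfix order of \<open>post\<close>.\<close>

definition flat_step :: "tree \<Rightarrow> tree" where
  "flat_step z = (if left z = Leaf then z else
     Node (if left (left (left z)) = enc_nat 2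
         then Node (right (left (left z))) (right (left z))
       else if left (left (left z)) = enc_nat 3 \<or> left (left (left z)) = enc_nat 4
         then Node (left (right (left (left z)))) (Node (right (right (left (left z)))) (right (left z)))
       else right (left z))
     (Node (left (left z)) (right z)))"

definition flat_init :: "tree \<Rightarrow> tree" where
  "flat_init v = Node (Node v Leaf) Leaf"

definition flat_time :: "tree \<Rightarrow> nat" where
  "flat_time v = (LEAST k. left ((flat_step ^^ k) (flat_init v)) = Leaf)"

definition flatten :: "tree \<Rightarrow> tree" where
  "flatten v = right ((flat_step ^^ flat_time v) (flat_init v))"

text \<open>The operands pushed are proper parts of the node popped. Arbitrary trees are covered
  because the traversal has to terminate on malformed input too.\<close>

lemma flat_step_less:
  assumes "left z \<noteq> Leaf" shows "tsize (left (flat_step z)) < tsize (left z)"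
proof -
  from assms obtain f s where z: "left z = Node f s" by (cases "left z") auto
  show ?thesis
  proof (cases f)
    case Leaf
    then show ?thesis using assms z by (simp add: flat_step_def numeral_eq_Suc)
  next
    case f: (Node tag body)
    show ?thesis
    proof (cases body)
      case Leaf
      then show ?thesis using assms z f by (auto simp: flat_step_def numeral_eq_Suc)
    next
      case (Node a b)
      then show ?thesis using assms z f by (auto simp: flat_step_def numeral_eq_Suc)
    qed
  qed
qed

text \<open>The pending stack starts with size \<open>tsize v + 2\<close> and shrinks in every step.
  This bounds both the number of steps and the size of each node emitted.\<close>

lemma flat_invariant:
  assumes "\<And>j. j < i \<Longrightarrow> left ((flat_step ^^ j) (flat_init v)) \<noteq> Leaf"
  shows "tsize (left ((flat_step ^^ i) (flat_init v))) + i \<le> tsize v + 2 \<and>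
    tsize (right ((flat_step ^^ i) (flat_init v))) \<le> 1 + i * (tsize v + 3)"
  using assms
proof (induction i)
  case (Suc i)
  let ?z = "(flat_step ^^ i) (flat_init v)"
  have IH: "tsize (left ?z) + i \<le> tsize v + 2" "tsize (right ?z) \<le> 1 + i * (tsize v + 3)"
    using Suc by auto
  have ne: "left ?z \<noteq> Leaf" using Suc.prems by simp
  have "tsize (left (flat_step ?z)) < tsize (left ?z)" by (rule flat_step_less[OF ne])
  moreover have "tsize (right (flat_step ?z)) = 1 + tsize (left (left ?z)) + tsize (right ?z)"
    using ne by (simp add: flat_step_def)
  moreover have "tsize (left (left ?z)) \<le> tsize (left ?z)" by (rule tsize_left)
  ultimately show ?case using IH by simp
qed (simp add: flat_init_def)

lemma flat_terminates: "\<exists>k. left ((flat_step ^^ k) (flat_init v)) = Leaf"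
proof (rule ccontr)
  assume "\<not> ?thesis"
  then have "tsize (left ((flat_step ^^ (tsize v + 2)) (flat_init v))) + (tsize v + 2) \<le> tsize v + 2"
    using flat_invariant[of "tsize v + 2" v] by blast
  then show False using tsize_pos[of "left ((flat_step ^^ (tsize v + 2)) (flat_init v))"] by linarith
qed

lemma flat_time_stop: "left ((flat_step ^^ flat_time v) (flat_init v)) = Leaf"
  unfolding flat_time_def using flat_terminates by (rule LeastI_ex)

lemma flat_time_go: "i < flat_time v \<Longrightarrow> left ((flat_step ^^ i) (flat_init v)) \<noteq> Leaf"
  unfolding flat_time_def by (rule not_less_Least)

lemma pt_flat_step: "ptime L flat_step"
proof -
  have "ptime L (\<lambda>z. flat_step z)"
    unfolding flat_step_def by (intro pt_intros)
  then show ?thesis by simp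
qed

lemma pt_flatten1: "ptime L flatten"
proof -
  have "ptime L (\<lambda>v. (flat_step ^^ flat_time v) (flat_init v))"
  proof (rule pt_loop[OF _ pt_flat_step])
    show "ptime L flat_init" unfolding flat_init_def by (intro pt_intros)
    show inv: "flat_time v \<le> tsize v + 2" for v
      using flat_invariant[of "flat_time v" v] flat_time_go by force
    show "tsize ((flat_step ^^ i) (flat_init v)) \<le> tsize v + 4 + (tsize v + 2) * (tsize v + 3)"
      if "i \<le> flat_time v" for v i
    proof -
      have 1: "tsize (left ((flat_step ^^ i) (flat_init v))) + i \<le> tsize v + 2"
        "tsize (right ((flat_step ^^ i) (flat_init v))) \<le> 1 + i * (tsize v + 3)"
        using flat_invariant[of i v] flat_time_go[of _ v] that by auto
      have "i * (tsize v + 3) \<le> (tsize v + 2) * (tsize v + 3)"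
        using that inv[of v] by (intro mult_le_mono1) linarith
      moreover have "tsize z \<le> 1 + tsize (left z) + tsize (right z)" for z by (cases z) auto
      note this[of "(flat_step ^^ i) (flat_init v)"]
      ultimately show ?thesis using 1 by linarith
    qed
  qed (use flat_time_stop flat_time_go in \<open>auto intro!: pbd_intros\<close>)
  from pt_right[OF this] show ?thesis unfolding flatten_def[symmetric] by simp
qed

lemma pt_flatten: "ptime L f \<Longrightarrow> ptime L (\<lambda>v. flatten (f v))"
  by (rule pt_comp[OF pt_flatten1])

text \<open>The pending stack \<open>S\<close> and the output \<open>acc\<close> are arbitrary so
  that the runs for subformulas can be chained.\<close>

lemma flat_step_formula:
  "\<exists>k. (flat_step ^^ k) (Node (Node (enc_formula F) S) acc) = Node S (enc_list (post F @ elems acc))"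
proof (induction F arbitrary: S acc)
  case (Const b)
  show ?case by (rule exI[of _ 1]) (simp add: flat_step_def numeral_eq_Suc)
next
  case (Atom v)
  show ?case by (rule exI[of _ 1]) (simp add: flat_step_def numeral_eq_Suc)
next
  case (Neg F)
  let ?e = "enc_formula (Neg F)"
  from Neg obtain k where k: "(flat_step ^^ k) (Node (Node (enc_formula F) S) (Node ?e acc)) =
      Node S (enc_list (post F @ elems (Node ?e acc)))" by blast
  have "flat_step (Node (Node ?e S) acc) = Node (Node (enc_formula F) S) (Node ?e acc)"
    by (simp add: flat_step_def numeral_eq_Suc)
  then have "(flat_step ^^ (k + 1)) (Node (Node ?e S) acc) =
      Node S (enc_list (post F @ elems (Node ?e acc)))"
    unfolding funpow_add comp_apply by (simp add: k del: enc_formula.simps)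
  then show ?case
    by (intro exI[of _ "k + 1"])
      (simp only: post.simps append_assoc elems.simps append.simps elems_enc_list)
next
  case (Conj F G)
  let ?e = "enc_formula (Conj F G)"
  from Conj(1) obtain k where k: "(flat_step ^^ k) (Node (Node (enc_formula F) (Node (enc_formula G) S)) (Node ?e acc)) =
      Node (Node (enc_formula G) S) (enc_list (post F @ elems (Node ?e acc)))" by blast
  from Conj(2) obtain l where l: "(flat_step ^^ l) (Node (Node (enc_formula G) S) (enc_list (post F @ elems (Node ?e acc)))) =
      Node S (enc_list (post G @ elems (enc_list (post F @ elems (Node ?e acc)))))" by blast
  have "flat_step (Node (Node ?e S) acc) = Node (Node (enc_formula F) (Node (enc_formula G) S)) (Node ?e acc)"
    by (simp add: flat_step_def numeral_eq_Suc)
  then have "(flat_step ^^ (l + (k + 1))) (Node (Node ?e S) acc) =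
      Node S (enc_list (post G @ elems (enc_list (post F @ elems (Node ?e acc)))))"
    unfolding funpow_add comp_apply by (simp only: One_nat_def funpow.simps comp_apply id_apply k l)
  then show ?case
    by (intro exI[of _ "l + (k + 1)"])
      (simp only: post.simps append_assoc elems.simps append.simps elems_enc_list)
next
  case (Disj F G)
  let ?e = "enc_formula (Disj F G)"
  from Disj(1) obtain k where k: "(flat_step ^^ k) (Node (Node (enc_formula F) (Node (enc_formula G) S)) (Node ?e acc)) =
      Node (Node (enc_formula G) S) (enc_list (post F @ elems (Node ?e acc)))" by blast
  from Disj(2) obtain l where l: "(flat_step ^^ l) (Node (Node (enc_formula G) S) (enc_list (post F @ elems (Node ?e acc)))) =
      Node S (enc_list (post G @ elems (enc_list (post F @ elems (Node ?e acc)))))" by blast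
  have "flat_step (Node (Node ?e S) acc) = Node (Node (enc_formula F) (Node (enc_formula G) S)) (Node ?e acc)"
    by (simp add: flat_step_def numeral_eq_Suc)
  then have "(flat_step ^^ (l + (k + 1))) (Node (Node ?e S) acc) =
      Node S (enc_list (post G @ elems (enc_list (post F @ elems (Node ?e acc)))))"
    unfolding funpow_add comp_apply by (simp only: One_nat_def funpow.simps comp_apply id_apply k l)
  then show ?case
    by (intro exI[of _ "l + (k + 1)"])
      (simp only: post.simps append_assoc elems.simps append.simps elems_enc_list)
qed

lemma flatten_formula: "flatten (enc_formula F) = enc_list (post F)"
proof -
  let ?z = "\<lambda>k. (flat_step ^^ k) (flat_init (enc_formula F))"
  obtain k where k: "?z k = Node Leaf (enc_list (post F))"
    using flat_step_formula[of F Leaf Leaf] by (auto simp: flat_init_def)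
  then have le: "flat_time (enc_formula F) \<le> k" unfolding flat_time_def by (intro Least_le) simp
  \<comment> \<open>With an empty stack the step is the identity, so running for \<open>k\<close>
    steps gives the same state as stopping at the least time.\<close>
  have stay: "(flat_step ^^ i) z = z" if "left z = Leaf" for i z
    using that by (induction i) (auto simp: flat_step_def)
  have "?z k = (flat_step ^^ (k - flat_time (enc_formula F)) \<circ> flat_step ^^ flat_time (enc_formula F))
      (flat_init (enc_formula F))"
    using le by (simp del: comp_apply flip: funpow_add)
  also have "\<dots> = (flat_step ^^ (k - flat_time (enc_formula F))) (?z (flat_time (enc_formula F)))"
    by (rule comp_apply)
  also have "\<dots> = ?z (flat_time (enc_formula F))" by (rule stay[OF flat_time_stop])
  finally have "flatten (enc_formula F) = right (?z k)" unfolding flatten_def by (rule arg_cong[OF sym])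
  then show ?thesis unfolding k by simp
qed

text \<open>\<open>z\<close> pairs the input stream with the output stream. Within an atom,
  \<open>Leaf = enc_nat 0\<close> is the mark of an \<open>X\<close> variable.\<close>

definition eval_step :: "tree \<Rightarrow> tree \<Rightarrow> tree \<Rightarrow> tree" where
  "eval_step z stk tok =
    (if left tok = enc_nat 0 then Node (tree_of_bool (right tok \<noteq> Leaf)) stk
     else if left tok = enc_nat 1 then
       (if left (right tok) = Leaf
        then Node (tree_of_bool (left (dropt (right (right tok)) (left z)) \<noteq> Leaf)) stk
        else Node (tree_of_bool (left (dropt (right (right tok)) (right z)) \<noteq> Leaf)) stk)
     else if left tok = enc_nat 2 then Node (tree_of_bool (left stk = Leaf)) (right stk)
     else if left tok = enc_nat 3 then
       Node (tree_of_bool (left stk \<noteq> Leaf \<and> left (right stk) \<noteq> Leaf)) (right (right stk))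
     else Node (tree_of_bool (left stk \<noteq> Leaf \<or> left (right stk) \<noteq> Leaf)) (right (right stk)))"

definition eval_tokens :: "tree \<Rightarrow> tree \<Rightarrow> tree \<Rightarrow> bool" where
  "eval_tokens toks x y \<longleftrightarrow> left (foldl (eval_step (Node x y)) Leaf (elems toks)) \<noteq> Leaf"

lemma tsize_If: "tsize a \<le> k \<Longrightarrow> tsize b \<le> k \<Longrightarrow> tsize (if c then a else b) \<le> k"
  by simp

lemma tsize_push: "tsize s \<le> k \<Longrightarrow> tsize (Node (tree_of_bool b) s) \<le> k + 4"
  using tsize_tree_of_bool[of b] by simp

lemma tsize_eval_step: "tsize (eval_step z stk tok) \<le> tsize stk + 4"
  unfolding eval_step_def
  by (intro tsize_If tsize_push order_refl tsize_right order_trans[OF tsize_right tsize_right])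

lemma pt_eval_step:
  assumes "ptime L f" "ptime L g" "ptime L h"
  shows "ptime L (\<lambda>v. eval_step (f v) (g v) (h v))"
  unfolding eval_step_def by (intro pt_intros pt_dropt assms)

lemma pt_eval_tokens:
  assumes f: "ptime L f" and g: "ptime L g" and h: "ptime L h"
  shows "ptime L (\<lambda>v. tree_of_bool (eval_tokens (f v) (g v) (h v)))"
proof -
  have "ptime L (\<lambda>v. foldl (eval_step (Node (g v) (h v))) Leaf (elems (f v)))"
  proof (rule pt_foldl[OF pt_const f])
    show "ptime L (\<lambda>p. eval_step (Node (g (left p)) (h (left p))) (left (right p)) (right (right p)))"
      by (intro pt_eval_step pt_intros pt_app1 g h)
  qed (rule pbd_const, rule tsize_eval_step)
  then show ?thesis unfolding eval_tokens_def by (intro pt_not pt_eq pt_left pt_const)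
qed

lemma foldl_eval_step:
  assumes "is_spec n m F"
  shows "foldl (eval_step (Node x y)) stk (post F) =
    Node (tree_of_bool (holds F (sbits n x) (sbits m y))) stk"
  using assms
proof (induction F arbitrary: stk)
  case (Atom v)
  then show ?case
    by (cases v) (auto simp: eval_step_def numeral_eq_Suc is_spec_def dropt_eq sbit_def[symmetric])
qed (auto simp: eval_step_def numeral_eq_Suc is_spec_def tree_of_bool_def)

lemma eval_tokens_formula:
  assumes "is_spec n m F"
  shows "eval_tokens (enc_list (post F)) x y \<longleftrightarrow> holds F (sbits n x) (sbits m y)"
  by (simp add: eval_tokens_def foldl_eval_step[OF assms])

section \<open>The NP language\<close>

text \<open>The set \<open>A y\<close> of the overview, relative to the outputs \<open>ys\<close>
  chosen so far.\<close>

definition cover :: "nat \<Rightarrow> formula \<Rightarrow> bool list list \<Rightarrow> bool list \<Rightarrow> bool list set" where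
  "cover n F ys y = {x \<in> bits n. holds F x y \<and> (\<forall>y' \<in> set ys. \<not> holds F x y')}"

text \<open>\<open>c\<close> consists of the tokens of the formula, \<open>n\<close>, the earlier
  outputs and \<open>y\<close>; \<open>st\<close> of the unread stream and a flag telling whether
  all blocks so far lie in the cover of \<open>y\<close>.\<close>

definition block_step :: "tree \<Rightarrow> tree \<Rightarrow> tree" where
  "block_step c st = Node (dropt (left (right c)) (left st))
    (tree_of_bool (right st \<noteq> Leaf \<and> eval_tokens (left c) (left st) (right (right (right c))) \<and>
      (\<forall>e \<in> set (elems (left (right (right c)))). \<not> eval_tokens (left c) (left st) e)))"

definition all_blocks :: "tree \<Rightarrow> tree \<Rightarrow> tree \<Rightarrow> bool" where
  "all_blocks t c w \<longleftrightarrow>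
    right (foldl (\<lambda>st e. block_step c st) (Node w (tree_of_bool True)) (elems t)) \<noteq> Leaf"

text \<open>\<open>st\<close> holds the unread stream and the parity so far. Exclusive or is written
  as inequality of normalised truth values, which \<open>pt_eq\<close> and \<open>pt_not\<close>
  handle.\<close>

definition dot_step :: "tree \<Rightarrow> tree \<Rightarrow> tree" where
  "dot_step st e = Node (right (left st)) (tree_of_bool
    (tree_of_bool (right st \<noteq> Leaf) \<noteq> tree_of_bool (e \<noteq> Leaf \<and> left (left st) \<noteq> Leaf)))"

definition dot_tree :: "tree \<Rightarrow> tree \<Rightarrow> bool" where
  "dot_tree rw w \<longleftrightarrow> right (foldl dot_step (Node w (tree_of_bool False)) (elems rw)) \<noteq> Leaf"

text \<open>A query \<open>q\<close> consists of a state, the rows of a hash matrix and a reversed prefix of \<open>y\<close>; the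
  state consists of fixed data (see \<open>base_tree\<close> below) and the list of the \<open>y\<close> found so far. A witness
  \<open>w\<close> supplies the rest of \<open>y\<close> and a stream of bits that is cut into \<open>x\<^sub>1, \<dots>, x\<^sub>t\<close>. Streams are
  total, so no witness is malformed.\<close>

definition check :: "tree \<Rightarrow> tree \<Rightarrow> bool" where
  "check q w \<longleftrightarrow>
    all_blocks (left (right (right (right (left (left q))))))
      (Node (left (left (left q))) (Node (left (right (right (left (left q)))))
        (Node (right (left q)) (revapp (right (right q)) (left w))))) (right w) \<and>
    (\<forall>e \<in> set (elems (left (right q))). \<not> dot_tree e (Node (Node Leaf Leaf) (right w)))"

text \<open>A witness needs at most \<open>m\<close> bits for \<open>y\<close> and
  \<open>t * n\<close> bits for the blocks, each of size at most 4, plus 3. As \<open>m\<close>,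
  \<open>t\<close> and \<open>n\<close> occur in \<open>q\<close> in unary,
  \<open>3 + 4 * m + 4 * (t * n)\<close> is at most \<open>11 * tsize q ^ 2\<close>.\<close>

definition search_lang :: "tree set" where
  "search_lang = {q. \<exists>w. tsize w \<le> 11 * tsize q ^ 2 \<and> check q w}"

lemma tsize_flagged: "tsize a \<le> tsize (left st) \<Longrightarrow> tsize (Node a (tree_of_bool b)) \<le> tsize st + 4"
  using tsize_tree_of_bool[of b] by (cases st) auto

lemma tsize_block_step: "tsize (block_step c st) \<le> tsize st + 4"
  unfolding block_step_def by (intro tsize_flagged tsize_dropt)

lemma pt_block_step:
  assumes "ptime L f" "ptime L g" shows "ptime L (\<lambda>v. block_step (f v) (g v))"
  unfolding block_step_def
  by (intro pt_ball pt_eval_tokens pt_dropt pt_intros assms pt_app1)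

lemma pt_all_blocks:
  assumes f: "ptime L f" and g: "ptime L g" and h: "ptime L h"
  shows "ptime L (\<lambda>v. tree_of_bool (all_blocks (f v) (g v) (h v)))"
proof -
  have "ptime L (\<lambda>v. foldl (\<lambda>st e. block_step (g v) st) (Node (h v) (tree_of_bool True)) (elems (f v)))"
  proof (rule pt_foldl[OF pt_Node[OF h pt_const] f])
    show "ptime L (\<lambda>p. block_step (g (left p)) (left (right p)))"
      by (intro pt_block_step pt_intros pt_app1 g)
  qed (rule pbd_const, rule tsize_block_step)
  then show ?thesis unfolding all_blocks_def by (intro pt_not pt_eq pt_right pt_const)
qed

lemma tsize_dot_step: "tsize (dot_step st e) \<le> tsize st + 4"
  unfolding dot_step_def by (intro tsize_flagged tsize_right)

lemma pt_dot_tree: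
  assumes f: "ptime L f" and g: "ptime L g"
  shows "ptime L (\<lambda>v. tree_of_bool (dot_tree (f v) (g v)))"
proof -
  have "ptime L (\<lambda>v. foldl dot_step (Node (g v) (tree_of_bool False)) (elems (f v)))"
  proof (rule pt_foldl[OF pt_Node[OF g pt_const] f])
    show "ptime L (\<lambda>p. dot_step (left (right p)) (right (right p)))"
      unfolding dot_step_def by (intro pt_intros)
  qed (rule pbd_const, rule tsize_dot_step)
  then show ?thesis unfolding dot_tree_def by (intro pt_not pt_eq pt_right pt_const)
qed

lemma search_lang_NP: "search_lang \<in> NP"
  unfolding search_lang_def
proof (rule NP_I)
  show "ptime {} (\<lambda>z. tree_of_bool (check (left z) (right z)))"
    unfolding check_def
    by (intro pt_ball pt_all_blocks pt_dot_tree pt_revapp pt_intros pt_app1)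
qed

definition base_tree :: "nat \<Rightarrow> nat \<Rightarrow> formula \<Rightarrow> nat \<Rightarrow> tree" where
  "base_tree n m F t = Node (enc_list (post F)) (Node (enc_nat m) (Node (enc_nat n)
    (Node (enc_nat t) (enc_nat (t * n + 1)))))"

definition state_tree :: "nat \<Rightarrow> nat \<Rightarrow> formula \<Rightarrow> nat \<Rightarrow> bool list list \<Rightarrow> tree" where
  "state_tree n m F t ys = Node (base_tree n m F t) (enc_list (map enc_bits ys))"

lemma all_blocks_eq:
  assumes F: "is_spec n m F" and ys: "set ys \<subseteq> bits m"
  shows "all_blocks (enc_nat t)
      (Node (enc_list (post F)) (Node (enc_nat n) (Node (enc_list (map enc_bits ys)) y))) w \<longleftrightarrow>
    (\<forall>i<t. sbits n ((right ^^ (i * n)) w) \<in> cover n F ys (sbits m y))"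
proof -
  let ?c = "Node (enc_list (post F)) (Node (enc_nat n) (Node (enc_list (map enc_bits ys)) y))"
  let ?P = "\<lambda>w. sbits n w \<in> cover n F ys (sbits m y)"
  have ys': "sbits m (enc_bits y') = y'" if "y' \<in> set ys" for y'
    using that ys by (intro sbits_enc_bits) (auto simp: bits_def)
  have step: "block_step ?c (Node w (tree_of_bool b)) =
      Node ((right ^^ n) w) (tree_of_bool (b \<and> ?P w))" for w b
    using ys' by (auto simp: block_step_def dropt_eq eval_tokens_formula[OF F] cover_def
        intro!: arg_cong[where f = tree_of_bool])
  have "foldl (\<lambda>st e. block_step ?c st) (Node w (tree_of_bool b)) es =
      Node ((right ^^ (length es * n)) w)
        (tree_of_bool (b \<and> (\<forall>i<length es. ?P ((right ^^ (i * n)) w))))" for w b and es :: "tree list"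
  proof (induction es arbitrary: w b)
    case (Cons e es)
    have "(right ^^ (i * n)) ((right ^^ n) w) = (right ^^ (Suc i * n)) w" for i
      by (simp add: funpow_right add.commute)
    then show ?case by (simp add: step Cons All_less_Suc2 del: mult_Suc)
  qed simp
  from this[of w True "elems (enc_nat t)"] show ?thesis
    by (simp add: all_blocks_def flip: len_def)
qed

lemma dot_tree_eq: "dot_tree (enc_bits rw) w \<longleftrightarrow> dot rw (sbits (length rw) w)"
proof -
  have "foldl dot_step (Node w (tree_of_bool a)) (map tree_of_bool rw) =
      Node ((right ^^ length rw) w) (tree_of_bool (a \<noteq> dot rw (sbits (length rw) w)))" for a w
  proof (induction rw arbitrary: a w)
    case (Cons b rw)
    have "dot_step (Node w (tree_of_bool a)) (tree_of_bool b) =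
        Node (right w) (tree_of_bool (a \<noteq> (b \<and> sbit w 0)))"
      by (auto simp: dot_step_def tree_of_bool_def sbit_def)
    then show ?case
      by (auto simp: Cons sbits_Suc funpow_Suc_right simp del: funpow.simps
          intro!: arg_cong[where f = tree_of_bool])
  qed (simp add: sbits_def)
  from this[of w False] show ?thesis by (simp add: dot_tree_def enc_bits_def)
qed

lemma sbits_revapp:
  assumes "length pre \<le> m"
  shows "take (length pre) (sbits m (revapp (enc_bits pre) w)) = rev pre"
proof -
  have "sbit (revapp (enc_bits pre) w) i = rev pre ! i" if "i < length pre" for i
  proof -
    have "drop i (map tree_of_bool (rev pre)) = tree_of_bool (rev pre ! i) # drop (Suc i) (map tree_of_bool (rev pre))"
      using that by (subst Cons_nth_drop_Suc[symmetric]) auto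
    then show ?thesis using that
      by (simp add: sbit_def funpow_right revapp_eq enc_bits_def rev_map)
  qed
  then show ?thesis using assms by (intro nth_equalityI) simp_all
qed

lemma revapp_enc_bits: "revapp (enc_bits pre) (enc_bits ys) = enc_bits (rev pre @ ys)"
  by (simp add: revapp_eq enc_bits_def rev_map)

lemma length_concat_bits: "set xs \<subseteq> bits n \<Longrightarrow> length (concat xs) = length xs * n"
  by (induction xs) (auto simp: bits_def)

lemma sum_sizes_le: "(1 + (1 + 4 * m) + (1 + 4 * (t * n))) \<le> 11 * q ^ 2"
  if "m \<le> q" "t \<le> q" "n \<le> q" "1 \<le> q" for m t n q :: nat
proof -
  have "t * n \<le> q * q" using that by (intro mult_le_mono)
  moreover have "1 * q \<le> q * q" using that by (intro mult_le_mono1)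
  ultimately show ?thesis using that unfolding power2_eq_square by linarith
qed

text \<open>The later correctness arguments reason about the oracle through this equivalence. Read
  as streams, any witness yields an output and a tuple; conversely a matching \<open>y\<close> and
  tuple, written as bit lists, form a witness of the permitted size.\<close>

lemma query_iff:
  assumes F: "is_spec n m F" and ys: "set ys \<subseteq> bits m"
    and Rs: "set Rs \<subseteq> bits (t * n + 1)" and pre: "length pre \<le> m"
  shows "Node (state_tree n m F t ys) (Node (enc_list (map enc_bits Rs)) (enc_bits pre)) \<in> search_lang \<longleftrightarrow>
    (\<exists>y \<in> bits m. take (length pre) y = rev pre \<and>
      (\<exists>u \<in> tuples t (cover n F ys y). \<forall>rw \<in> set Rs. \<not> dot rw u))" (is "?q \<in> search_lang \<longleftrightarrow> ?R")
proof -
  have check: "check ?q (Node wy wx) \<longleftrightarrow>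
    (\<forall>i<t. sbits n ((right ^^ (i * n)) wx) \<in> cover n F ys (sbits m (revapp (enc_bits pre) wy))) \<and>
    (\<forall>rw \<in> set Rs. \<not> dot rw (True # sbits (t * n) wx))" for wy wx
  proof -
    have "length rw = Suc (t * n)" if "rw \<in> set Rs" for rw
      using that Rs by (auto simp: bits_def)
    moreover have "sbits (Suc (t * n)) (Node (Node Leaf Leaf) wx) = True # sbits (t * n) wx"
      by (simp add: sbits_Suc)
    ultimately show ?thesis
      by (simp add: check_def state_tree_def base_tree_def all_blocks_eq[OF F ys] dot_tree_eq)
  qed
  show ?thesis
  proof
    assume "?q \<in> search_lang"
    then obtain w where w: "check ?q w" by (auto simp: search_lang_def)
    \<comment> \<open>A \<open>Leaf\<close> witness acts like \<open>Node Leaf Leaf\<close>, so a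
      witness may be assumed to be a pair.\<close>
    obtain wy wx where "check ?q (Node wy wx)"
    proof (cases w)
      case Leaf
      have "check ?q Leaf = check ?q (Node Leaf Leaf)" by (simp add: check_def)
      then show ?thesis using that w Leaf by blast
    qed (use w that in blast)
    note c = this[unfolded check]
    let ?y = "sbits m (revapp (enc_bits pre) wy)"
    let ?xs = "map (\<lambda>i. sbits n ((right ^^ (i * n)) wx)) [0..<t]"
    have "True # sbits (t * n) wx \<in> tuples t (cover n F ys ?y)"
      unfolding tuples_def concat_sbits[symmetric] using c
      by (intro CollectI exI[of _ ?xs]) auto
    with c have "\<exists>u \<in> tuples t (cover n F ys ?y). \<forall>rw \<in> set Rs. \<not> dot rw u" by blast
    then show ?R
      using sbits_revapp[OF pre] by (intro bexI[of _ ?y]) simp_all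
  next
    assume ?R
    then obtain y xs where y: "y \<in> bits m" "take (length pre) y = rev pre"
      and xs: "length xs = t" "set xs \<subseteq> cover n F ys y"
      and Rs0: "\<forall>rw \<in> set Rs. \<not> dot rw (True # concat xs)"
      by (auto simp: tuples_def)
    let ?wy = "enc_bits (drop (length pre) y)" and ?wx = "enc_bits (concat xs)"
    have xb: "set xs \<subseteq> bits n" using xs(2) by (auto simp: cover_def)
    have sx: "sbits (t * n) ?wx = concat xs"
      using length_concat_bits[OF xb] xs(1) by (intro sbits_enc_bits) simp
    have sy: "sbits m (revapp (enc_bits pre) ?wy) = y"
      unfolding revapp_enc_bits y(2)[symmetric] append_take_drop_id using y(1)
      by (intro sbits_enc_bits) (simp add: bits_def)
    have "map (\<lambda>i. sbits n ((right ^^ (i * n)) ?wx)) [0..<t] = xs"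
      by (rule concat_inject[of _ _ n]) (use concat_sbits sx xs(1) xb in auto)
    then have "sbits n ((right ^^ (i * n)) ?wx) = xs ! i" if "i < t" for i
      using that by (metis (no_types, lifting) add_0 length_upt minus_nat.diff_0 nth_map nth_upt)
    then have "check ?q (Node ?wy ?wx)"
      unfolding check sy sx using Rs0 xs by (auto dest!: nth_mem)
    moreover have "tsize (Node ?wy ?wx) \<le> 11 * tsize ?q ^ 2"
    proof -
      have "length (drop (length pre) y) \<le> m" using y(1) by (simp add: bits_def)
      moreover have "length (concat xs) = t * n" using length_concat_bits[OF xb] xs(1) by simp
      ultimately have "tsize (Node ?wy ?wx) \<le> 1 + (1 + 4 * m) + (1 + 4 * (t * n))"
        using tsize_enc_bits[of "drop (length pre) y"] tsize_enc_bits[of "concat xs"] by simp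
      also have "\<dots> \<le> 11 * tsize ?q ^ 2"
        by (rule sum_sizes_le) (simp_all add: state_tree_def base_tree_def)
      finally show ?thesis .
    qed
    ultimately show "?q \<in> search_lang" unfolding search_lang_def by blast
  qed
qed

section \<open>Generating circuits\<close>

text \<open>The compiler state consists of the reversed gate list, its length in unary, and a stack of
  positions. Literals arrive as gates; an operator token only contributes its tag.\<close>

definition gate_step :: "tree \<Rightarrow> tree \<Rightarrow> tree" where
  "gate_step z tok =
    (if left tok = enc_nat 0 \<or> left tok = enc_nat 1
     then Node (Node tok (left z))
       (Node (Node Leaf (left (right z))) (Node (left (right z)) (right (right z))))
     else if left tok = enc_nat 2
     then Node (Node (Node (enc_nat 2) (left (right (right z)))) (left z))
       (Node (Node Leaf (left (right z))) (Node (left (right z)) (right (right (right z)))))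
     else Node (Node (Node (left tok) (Node (left (right (right z))) (left (right (right (right z)))))) (left z))
       (Node (Node Leaf (left (right z))) (Node (left (right z)) (right (right (right (right z)))))))"

definition compile :: "tree \<Rightarrow> tree" where
  "compile toks = revapp (left (foldl gate_step (Node Leaf (Node Leaf Leaf)) (elems toks))) Leaf"

lemma elems_right_subset: "set (elems (right v)) \<subseteq> set (elems v)"
  by (cases v) auto

lemma left_elems: "left v = Leaf \<or> left v \<in> set (elems v)"
  by (cases v) auto

text \<open>Invariant after \<open>i\<close> of at most \<open>K\<close> tokens of size at most
  \<open>\<tau>\<close>. Gates copy unary positions from the stack, so growth depends on the
  accumulator and \<open>pt_foldl\<close> does not apply; bounding every stack entry by
  \<open>1 + 2 * K\<close> repairs this.\<close>

definition gate_bound :: "nat \<Rightarrow> nat \<Rightarrow> nat \<Rightarrow> tree \<Rightarrow> bool" where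
  "gate_bound K \<tau> i z \<longleftrightarrow> (\<exists>g p stk. z = Node g (Node p stk) \<and> tsize p = 1 + 2 * i \<and>
     (\<forall>e \<in> set (elems stk). tsize e \<le> 1 + 2 * K) \<and> tsize stk \<le> 1 + i * (2 + 2 * K) \<and>
     tsize g \<le> 1 + i * (\<tau> + 4 * K + 10))"

lemma gate_bound_step:
  assumes z: "gate_bound K \<tau> i z" and i: "i < K" and tok: "tsize tok \<le> \<tau>"
  shows "gate_bound K \<tau> (Suc i) (gate_step z tok)"
proof -
  from z obtain g p stk where z: "z = Node g (Node p stk)" and p: "tsize p = 1 + 2 * i"
    and e: "\<forall>e \<in> set (elems stk). tsize e \<le> 1 + 2 * K" and s: "tsize stk \<le> 1 + i * (2 + 2 * K)"
    and g: "tsize g \<le> 1 + i * (\<tau> + 4 * K + 10)" unfolding gate_bound_def by blast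
  have emit: "gate_bound K \<tau> (Suc i) (Node (Node h g) (Node (Node Leaf p) (Node p s')))"
    if "tsize h \<le> \<tau> + 4 * K + 9" "set (elems s') \<subseteq> set (elems stk)" "tsize s' \<le> tsize stk" for h s'
    unfolding gate_bound_def using that p e s g i by (auto simp: subset_eq)
  have l1: "tsize (left stk) \<le> 1 + 2 * K" using left_elems[of stk] e by auto
  have l2: "tsize (left (right stk)) \<le> 1 + 2 * K"
    using left_elems[of "right stk"] elems_right_subset[of stk] e by auto
  have r: "set (elems (right stk)) \<subseteq> set (elems stk)"
    "set (elems (right (right stk))) \<subseteq> set (elems stk)"
    "tsize (right stk) \<le> tsize stk" "tsize (right (right stk)) \<le> tsize stk"
    using elems_right_subset[of stk] elems_right_subset[of "right stk"]
      tsize_right[of stk] tsize_right[of "right stk"] by auto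
  have lt: "tsize (left tok) \<le> \<tau>" using tsize_left[of tok] tok by linarith
  consider "left tok = enc_nat 0 \<or> left tok = enc_nat 1" | "\<not> (left tok = enc_nat 0 \<or> left tok = enc_nat 1)"
    "left tok = enc_nat 2" | "\<not> (left tok = enc_nat 0 \<or> left tok = enc_nat 1)" "left tok \<noteq> enc_nat 2"
    by blast
  then show ?thesis
  proof cases
    case 1
    then have "gate_step z tok = Node (Node tok g) (Node (Node Leaf p) (Node p stk))"
      by (simp add: gate_step_def z)
    then show ?thesis using emit[of tok stk] tok by simp
  next
    case 2
    then have "gate_step z tok = Node (Node (Node (enc_nat 2) (left stk)) g) (Node (Node Leaf p) (Node p (right stk)))"
      unfolding gate_step_def z by (simp del: enc_nat.simps)
    then show ?thesis
      using emit[of "Node (enc_nat 2) (left stk)" "right stk"] l1 r tok i tsize_pos[of tok]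
      by (simp del: enc_nat.simps tsize_pos)
  next
    case 3
    then have "gate_step z tok = Node (Node (Node (left tok) (Node (left stk) (left (right stk)))) g)
        (Node (Node Leaf p) (Node p (right (right stk))))"
      unfolding gate_step_def z by (simp del: enc_nat.simps)
    then show ?thesis
      using emit[of "Node (left tok) (Node (left stk) (left (right stk)))" "right (right stk)"] l1 l2 r lt
      by simp
  qed
qed

lemma gate_bound_foldl:
  assumes "length es \<le> K" "\<And>e. e \<in> set es \<Longrightarrow> tsize e \<le> \<tau>"
  shows "gate_bound K \<tau> (length es) (foldl gate_step (Node Leaf (Node Leaf Leaf)) es)"
  using assms
proof (induction es rule: rev_induct)
  case Nil
  show ?case by (simp add: gate_bound_def)
next
  case (snoc e es)
  then show ?case by (simp add: gate_bound_step)
qed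

lemma gate_bound_tsize:
  assumes "gate_bound K \<tau> i z" "i \<le> K"
  shows "tsize z \<le> 5 + 2 * K + K * (2 + 2 * K) + K * (\<tau> + 4 * K + 10)"
proof -
  from assms(1) obtain g p stk where z: "z = Node g (Node p stk)" and le: "tsize p = 1 + 2 * i"
    "tsize stk \<le> 1 + i * (2 + 2 * K)" "tsize g \<le> 1 + i * (\<tau> + 4 * K + 10)"
    unfolding gate_bound_def by blast
  have "i * (2 + 2 * K) \<le> K * (2 + 2 * K)" "i * (\<tau> + 4 * K + 10) \<le> K * (\<tau> + 4 * K + 10)"
    by (rule mult_le_mono1[OF assms(2)])+
  with le assms(2) show ?thesis unfolding z tsize.simps by linarith
qed

lemma pt_compile:
  assumes f: "ptime L f" shows "ptime L (\<lambda>v. compile (f v))"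
proof -
  have "ptime L (\<lambda>v. foldl gate_step (Node Leaf (Node Leaf Leaf)) (elems (f v)))"
  proof (rule pt_foldl_bounded[OF pt_const f])
    show "ptime L (\<lambda>p. gate_step (left (right p)) (right (right p)))"
      unfolding gate_step_def by (intro pt_intros)
    let ?B = "\<lambda>v. 5 + 2 * tsize (f v) + tsize (f v) * (2 + 2 * tsize (f v)) +
      tsize (f v) * (tsize (f v) + 4 * tsize (f v) + 10)"
    show "pbd ?B" by (intro pbd_intros ptime_size[OF f])
    fix v i assume i: "i \<le> length (elems (f v))"
    have "gate_bound (tsize (f v)) (tsize (f v)) (length (take i (elems (f v))))
        (foldl gate_step (Node Leaf (Node Leaf Leaf)) (take i (elems (f v))))"
    proof (rule gate_bound_foldl)
      show "length (take i (elems (f v))) \<le> tsize (f v)"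
        using i length_elems[of "f v"] by simp
      show "tsize e \<le> tsize (f v)" if "e \<in> set (take i (elems (f v)))" for e
        using tsize_elems in_set_takeD[OF that] .
    qed
    then show "tsize (foldl gate_step (Node Leaf (Node Leaf Leaf)) (take i (elems (f v)))) \<le> ?B v"
      by (rule gate_bound_tsize) (use i length_elems[of "f v"] in simp)
  qed
  then show ?thesis unfolding compile_def by (intro pt_revapp pt_left pt_const)
qed

section \<open>Correctness of the emitted gates\<close>

definition gate_vals :: "circuit \<Rightarrow> bool list \<Rightarrow> bool list" where
  "gate_vals C x = foldl (\<lambda>vs g. vs @ [gate_val x vs g]) [] C"

lemma gate_vals_snoc [simp]: "gate_vals (C @ [g]) x = gate_vals C x @ [gate_val x (gate_vals C x) g]"
  by (simp add: gate_vals_def)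

lemma length_gate_vals [simp]: "length (gate_vals C x) = length C"
  by (induction C rule: rev_induct) (simp_all, simp add: gate_vals_def)

text \<open>The stack positions \<open>stk\<close> compute the functions \<open>fs\<close>. The last
  conjunct puts the newest gate on top of the stack, since the output of a circuit is read off its
  last gate.\<close>

definition compiled :: "nat \<Rightarrow> tree \<Rightarrow> circuit \<Rightarrow> (bool list \<Rightarrow> bool) list \<Rightarrow> bool" where
  "compiled n z C fs \<longleftrightarrow> (\<exists>stk. z = Node (enc_list (map enc_gate (rev C)))
       (Node (enc_nat (length C)) (enc_list (map enc_nat stk))) \<and>
     (\<forall>p < length C. gate_ok n p (C ! p)) \<and>
     list_all2 (\<lambda>p f. p < length C \<and> (\<forall>x \<in> bits n. gate_vals C x ! p = f x)) stk fs \<and>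
     (C \<noteq> [] \<longrightarrow> stk \<noteq> [] \<and> hd stk = length C - 1))"

lemma compiled_push:
  assumes "\<forall>p < length C. gate_ok n p (C ! p)"
    and "list_all2 (\<lambda>p f. p < length C \<and> (\<forall>x \<in> bits n. gate_vals C x ! p = f x)) stk fs"
    and "gate_ok n (length C) g" and "\<And>x. x \<in> bits n \<Longrightarrow> gate_val x (gate_vals C x) g = f x"
  shows "compiled n (Node (Node (enc_gate g) (enc_list (map enc_gate (rev C))))
      (Node (Node Leaf (enc_nat (length C))) (Node (enc_nat (length C)) (enc_list (map enc_nat stk)))))
      (C @ [g]) (f # fs)"
  unfolding compiled_def
proof (intro exI[of _ "length C # stk"] conjI)
  show "\<forall>p < length (C @ [g]). gate_ok n p ((C @ [g]) ! p)"
    using assms(1,3) by (auto simp: nth_append less_Suc_eq)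
  show "list_all2 (\<lambda>p f. p < length (C @ [g]) \<and> (\<forall>x \<in> bits n. gate_vals (C @ [g]) x ! p = f x))
      (length C # stk) (f # fs)"
    using assms(2,4) by (auto simp: nth_append elim!: list_all2_mono)
qed simp_all

lemma compiled_const:
  assumes "compiled n z C fs"
  shows "compiled n (gate_step z (Node Leaf (tree_of_bool b))) (C @ [GConst b]) ((\<lambda>x. b) # fs)"
proof -
  from assms obtain stk where *: "z = Node (enc_list (map enc_gate (rev C)))
       (Node (enc_nat (length C)) (enc_list (map enc_nat stk)))"
     "\<forall>p < length C. gate_ok n p (C ! p)"
     "list_all2 (\<lambda>p f. p < length C \<and> (\<forall>x \<in> bits n. gate_vals C x ! p = f x)) stk fs"
    unfolding compiled_def by blast
  from compiled_push[OF *(2,3), of "GConst b" "\<lambda>x. b"] show ?thesis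
    by (simp add: *(1) gate_step_def)
qed

lemma compiled_input:
  assumes "compiled n z C fs" "i < n"
  shows "compiled n (gate_step z (Node (enc_nat 1) (enc_nat i))) (C @ [GIn i]) ((\<lambda>x. x ! i) # fs)"
proof -
  from assms(1) obtain stk where *: "z = Node (enc_list (map enc_gate (rev C)))
       (Node (enc_nat (length C)) (enc_list (map enc_nat stk)))"
     "\<forall>p < length C. gate_ok n p (C ! p)"
     "list_all2 (\<lambda>p f. p < length C \<and> (\<forall>x \<in> bits n. gate_vals C x ! p = f x)) stk fs"
    unfolding compiled_def by blast
  from compiled_push[OF *(2,3), of "GIn i" "\<lambda>x. x ! i"] assms(2) show ?thesis
    by (simp add: *(1) gate_step_def)
qed

text \<open>The payload \<open>w\<close> is arbitrary because operator tokens come both from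
  subformulas and, with payload \<open>Leaf\<close>, from \<open>add_case\<close>.\<close>

lemma compiled_not:
  assumes "compiled n z C (f # fs)"
  shows "\<exists>C'. compiled n (gate_step z (Node (enc_nat 2) w)) C' ((\<lambda>x. \<not> f x) # fs)"
proof -
  from assms obtain a stk where *: "z = Node (enc_list (map enc_gate (rev C)))
       (Node (enc_nat (length C)) (enc_list (map enc_nat (a # stk))))"
     "\<forall>p < length C. gate_ok n p (C ! p)"
     "list_all2 (\<lambda>p f. p < length C \<and> (\<forall>x \<in> bits n. gate_vals C x ! p = f x)) stk fs"
     "a < length C" "\<forall>x \<in> bits n. gate_vals C x ! a = f x"
    unfolding compiled_def by (auto simp: list_all2_Cons2)
  from compiled_push[OF *(2,3), of "GNot a" "\<lambda>x. \<not> f x"] *(4,5) show ?thesis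
    by (auto simp: *(1) gate_step_def numeral_eq_Suc)
qed

lemma compiled_binary:
  assumes "compiled n z C (f # g # fs)"
  shows "\<exists>C'. compiled n (gate_step z (Node (enc_nat 3) w)) C' ((\<lambda>x. f x \<and> g x) # fs)"
    and "\<exists>C'. compiled n (gate_step z (Node (enc_nat 4) w)) C' ((\<lambda>x. f x \<or> g x) # fs)"
proof -
  from assms obtain a b stk where *: "z = Node (enc_list (map enc_gate (rev C)))
       (Node (enc_nat (length C)) (enc_list (map enc_nat (a # b # stk))))"
     "\<forall>p < length C. gate_ok n p (C ! p)"
     "list_all2 (\<lambda>p f. p < length C \<and> (\<forall>x \<in> bits n. gate_vals C x ! p = f x)) stk fs"
     "a < length C" "\<forall>x \<in> bits n. gate_vals C x ! a = f x"
     "b < length C" "\<forall>x \<in> bits n. gate_vals C x ! b = g x"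
    unfolding compiled_def by (auto simp: list_all2_Cons2)
  from compiled_push[OF *(2,3), of "GAnd a b" "\<lambda>x. f x \<and> g x"] *(4-)
  show "\<exists>C'. compiled n (gate_step z (Node (enc_nat 3) w)) C' ((\<lambda>x. f x \<and> g x) # fs)"
    by (auto simp: *(1) gate_step_def numeral_eq_Suc)
  from compiled_push[OF *(2,3), of "GOr a b" "\<lambda>x. f x \<or> g x"] *(4-)
  show "\<exists>C'. compiled n (gate_step z (Node (enc_nat 4) w)) C' ((\<lambda>x. f x \<or> g x) # fs)"
    by (auto simp: *(1) gate_step_def numeral_eq_Suc)
qed

text \<open>Literals become encodings of gates: constants already have the form of
  \<open>GConst\<close>, an input atom turns into \<open>GIn\<close>, and an output atom into its
  value under the fixed \<open>y\<close>.\<close>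

definition subst_token :: "tree \<Rightarrow> tree \<Rightarrow> tree" where
  "subst_token y tok =
    (if left tok = enc_nat 1 then
       (if left (right tok) = Leaf then Node (enc_nat 1) (right (right tok))
        else Node Leaf (tree_of_bool (left (dropt (right (right tok)) y) \<noteq> Leaf)))
     else tok)"

definition add_tokens :: "tree \<Rightarrow> tree \<Rightarrow> tree \<Rightarrow> tree" where
  "add_tokens toks acc y = foldl (\<lambda>x tok. Node (subst_token y tok) x) acc (elems toks)"

text \<open>Bit \<open>idx\<close> of "if \<open>F\<close> holds with \<open>y\<close> then
  \<open>y\<close> else the previous choice". As the bit of \<open>y\<close> is known, this is a
  disjunction with \<open>F\<close> if it is set and a conjunction with the negation of
  \<open>F\<close> otherwise. Token lists are reversed, so operators stand in front.\<close>

definition add_case :: "tree \<Rightarrow> tree \<Rightarrow> tree \<Rightarrow> tree \<Rightarrow> tree" where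
  "add_case toks idx acc y =
    (if left (dropt idx y) \<noteq> Leaf then Node (Node (enc_nat 4) Leaf) (add_tokens toks acc y)
     else Node (Node (enc_nat 3) Leaf) (Node (Node (enc_nat 2) Leaf) (add_tokens toks acc y)))"

text \<open>The initial token \<open>Node Leaf Leaf\<close> is the constant \<open>False\<close>,
  the value where no listed output works.\<close>

definition bit_tokens :: "tree \<Rightarrow> tree \<Rightarrow> tree \<Rightarrow> tree" where
  "bit_tokens toks ylist idx =
    revapp (foldl (add_case toks idx) (Node (Node Leaf Leaf) Leaf) (elems ylist)) Leaf"

definition bit_circuit :: "tree \<Rightarrow> tree \<Rightarrow> tree \<Rightarrow> tree" where
  "bit_circuit toks ylist idx = compile (bit_tokens toks ylist idx)"

text \<open>The list \<open>x\<close> built so far doubles as a unary counter: the next index is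
  \<open>m - 1\<close> minus its length. Prepending in decreasing order leaves the circuits in
  increasing order.\<close>

definition all_circuits :: "tree \<Rightarrow> tree" where
  "all_circuits s = foldl (\<lambda>x e. Node (bit_circuit (left (left s)) (right s)
     (right (dropt x (left (right (left s)))))) x) Leaf (elems (left (right (left s))))"

lemma tsize_subst_token: "tsize (subst_token y tok) \<le> tsize tok + 5"
proof -
  have "tsize (right (right tok)) \<le> tsize tok"
    using tsize_right[of tok] tsize_right[of "right tok"] by linarith
  moreover have "tsize (tree_of_bool b) \<le> 3" for b by (rule tsize_tree_of_bool)
  moreover have "tsize (Node Leaf (tree_of_bool b)) \<le> tsize tok + 5" for b
    using tsize_tree_of_bool[of b] by simp
  ultimately show ?thesis unfolding subst_token_def by (intro tsize_If) simp_all
qed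

lemma pt_subst_token: "ptime L f \<Longrightarrow> ptime L g \<Longrightarrow> ptime L (\<lambda>v. subst_token (f v) (g v))"
  unfolding subst_token_def by (intro pt_intros pt_dropt)

lemma tsize_add_tokens:
  "tsize (add_tokens toks acc y) \<le> tsize acc + tsize toks * (tsize toks + 6)"
proof -
  have "tsize (add_tokens toks acc y) \<le> tsize acc + length (elems toks) * (tsize toks + 6)"
    unfolding add_tokens_def
  proof (rule tsize_foldl)
    fix x e assume "e \<in> set (elems toks)"
    then have "tsize e \<le> tsize toks" by (rule tsize_elems)
    then show "tsize (Node (subst_token y e) x) \<le> tsize x + (tsize toks + 6)"
      using tsize_subst_token[of y e] by simp
  qed
  also have "length (elems toks) * (tsize toks + 6) \<le> tsize toks * (tsize toks + 6)"
    by (rule mult_le_mono1[OF length_elems])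
  finally show ?thesis by simp
qed

lemma pt_add_tokens:
  assumes f: "ptime L f" and g: "ptime L g" and h: "ptime L h"
  shows "ptime L (\<lambda>v. add_tokens (f v) (g v) (h v))"
  unfolding add_tokens_def
proof (rule pt_foldl[OF g f])
  show "ptime L (\<lambda>p. Node (subst_token (h (left p)) (right (right p))) (left (right p)))"
    by (intro pt_subst_token pt_intros pt_app1 h)
  show "tsize (Node (subst_token (h v) e) x) \<le> tsize x + (tsize (Node v e) + 6)" for v e x
    using tsize_subst_token[of "h v" e] by simp
qed (intro pbd_intros)

lemma pt_add_case:
  assumes "ptime L f" "ptime L g" "ptime L h" "ptime L k"
  shows "ptime L (\<lambda>v. add_case (f v) (g v) (h v) (k v))"
  unfolding add_case_def by (intro pt_add_tokens pt_dropt pt_intros assms)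

lemma tsize_add_case: "tsize (add_case toks idx acc y) \<le> tsize acc + (tsize toks * (tsize toks + 6) + 20)"
  using tsize_add_tokens[of toks acc y] unfolding add_case_def by (intro tsize_If) simp_all

lemma pt_bit_tokens:
  assumes f: "ptime L f" and g: "ptime L g" and h: "ptime L h"
  shows "ptime L (\<lambda>v. bit_tokens (f v) (g v) (h v))"
  unfolding bit_tokens_def
proof (rule pt_revapp[OF pt_foldl[OF pt_const g] pt_const])
  show "ptime L (\<lambda>p. add_case (f (left p)) (h (left p)) (left (right p)) (right (right p)))"
    by (intro pt_add_case pt_intros pt_app1 f h)
  show "tsize (add_case (f v) (h v) x e) \<le> tsize x +
      (\<lambda>z. tsize (f (left z)) * (tsize (f (left z)) + 6) + 20) (Node v e)" for v x e
    using tsize_add_case by simp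
  show "pbd (\<lambda>z. tsize (f (left z)) * (tsize (f (left z)) + 6) + 20)"
    by (intro pbd_intros ptime_size[OF pt_app1[OF f]])
qed

lemma pt_bit_circuit:
  assumes "ptime L f" "ptime L g" "ptime L h"
  shows "ptime L (\<lambda>v. bit_circuit (f v) (g v) (h v))"
  unfolding bit_circuit_def by (intro pt_compile pt_bit_tokens assms)

lemma pt_all_circuits: "ptime L all_circuits"
proof -
  let ?m = "\<lambda>s. left (right (left s))"
  let ?C = "\<lambda>z. bit_circuit (left (left (left z))) (right (left z)) (right z)"
  have C: "ptime L ?C" by (intro pt_bit_circuit pt_intros)
  from ptime_size[OF C] obtain a d where ad: "\<And>z. tsize (?C z) \<le> a * tsize z ^ d"
    unfolding pbd_def by auto
  have "ptime L (\<lambda>s. all_circuits s)"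
    unfolding all_circuits_def
  proof (rule pt_foldl[OF pt_const])
    show "ptime L ?m" by (intro pt_intros)
    show "ptime L (\<lambda>p. Node (bit_circuit (left (left (left p))) (right (left p))
        (right (dropt (left (right p)) (?m (left p))))) (left (right p)))"
      by (intro pt_bit_circuit pt_dropt pt_intros)
    show "pbd (\<lambda>z. 1 + a * (1 + tsize z + tsize z) ^ d)" by (intro pbd_intros)
    fix v x e
    let ?i = "right (dropt x (?m v))"
    \<comment> \<open>The new circuit depends on \<open>x\<close> only through an index no larger
      than \<open>v\<close>, so the growth is independent of the accumulator as
      \<open>pt_foldl\<close> demands.\<close>
    have "tsize ?i \<le> tsize v"
      using tsize_right[of "dropt x (?m v)"] tsize_dropt[of x "?m v"] tsize_left[of "right (left v)"]
        tsize_right[of "left v"] tsize_left[of v] by linarith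
    define Q where "Q = a * (1 + tsize (Node v e) + tsize (Node v e)) ^ d"
    have "a * tsize (Node v ?i) ^ d \<le> Q"
      unfolding Q_def using \<open>tsize ?i \<le> tsize v\<close> by (intro mult_le_mono2 power_mono) auto
    with ad[of "Node v ?i"] have "tsize (?C (Node v ?i)) \<le> Q" by (rule order_trans)
    then show "tsize (Node (bit_circuit (left (left v)) (right v) ?i) x)
        \<le> tsize x + (1 + a * (1 + tsize (Node v e) + tsize (Node v e)) ^ d)"
      unfolding Q_def[symmetric] by simp
  qed
  then show ?thesis by simp
qed

text \<open>\<open>post\<close> emits the second operand first, so the value of the first one ends
  on top of the stack, as \<open>compiled_binary\<close> expects.\<close>

lemma compiled_formula:
  assumes "is_spec n m F" "y \<in> bits m" "compiled n z C fs"
  shows "\<exists>C'. compiled n (foldl gate_step z (map (subst_token (enc_bits y)) (post F))) C'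
    ((\<lambda>x. holds F x y) # fs)"
  using assms
proof (induction F arbitrary: z C fs)
  case (Const b)
  then show ?case using compiled_const[OF Const(3), of b] by (auto simp: subst_token_def)
next
  case (Atom v)
  show ?case
  proof (cases v)
    case (X i)
    then have "i < n" using Atom(1) by (auto simp: is_spec_def)
    from compiled_input[OF Atom(3) this] show ?thesis using X by (auto simp: subst_token_def)
  next
    case (Y j)
    then have j: "j < m" using Atom(1) by (auto simp: is_spec_def)
    have "sbit (enc_bits y) j = y ! j"
      using sbits_enc_bits[of y m] nth_sbits[OF j, of "enc_bits y"] Atom(2) by (simp add: bits_def)
    then have "subst_token (enc_bits y) (enc_formula (Atom v)) = Node Leaf (tree_of_bool (y ! j))"
      using Y by (simp add: subst_token_def dropt_eq sbit_def[symmetric])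
    with compiled_const[OF Atom(3), of "y ! j"] show ?thesis using Y by auto
  qed
next
  case (Neg F)
  from Neg.IH[OF _ Neg.prems(2,3)] Neg.prems(1) obtain C1 where
    C1: "compiled n (foldl gate_step z (map (subst_token (enc_bits y)) (post F))) C1 ((\<lambda>x. holds F x y) # fs)"
    by (auto simp: is_spec_def)
  have "subst_token (enc_bits y) (enc_formula (Neg F)) = Node (enc_nat 2) (enc_formula F)"
    by (simp add: subst_token_def numeral_eq_Suc)
  with compiled_not[OF C1] show ?case by simp
next
  case (Conj F G)
  from Conj.IH(2)[OF _ Conj.prems(2,3)] Conj.prems(1) obtain C1 where
    C1: "compiled n (foldl gate_step z (map (subst_token (enc_bits y)) (post G))) C1 ((\<lambda>x. holds G x y) # fs)"
    by (auto simp: is_spec_def)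
  from Conj.IH(1)[OF _ Conj.prems(2) C1] Conj.prems(1) obtain C2 where
    C2: "compiled n (foldl gate_step z (map (subst_token (enc_bits y)) (post G @ post F))) C2
      ((\<lambda>x. holds F x y) # (\<lambda>x. holds G x y) # fs)"
    by (auto simp: is_spec_def)
  have "subst_token (enc_bits y) (enc_formula (Conj F G)) = Node (enc_nat 3) (Node (enc_formula F) (enc_formula G))"
    by (simp add: subst_token_def numeral_eq_Suc)
  with compiled_binary(1)[OF C2] show ?case by simp
next
  case (Disj F G)
  from Disj.IH(2)[OF _ Disj.prems(2,3)] Disj.prems(1) obtain C1 where
    C1: "compiled n (foldl gate_step z (map (subst_token (enc_bits y)) (post G))) C1 ((\<lambda>x. holds G x y) # fs)"
    by (auto simp: is_spec_def)
  from Disj.IH(1)[OF _ Disj.prems(2) C1] Disj.prems(1) obtain C2 where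
    C2: "compiled n (foldl gate_step z (map (subst_token (enc_bits y)) (post G @ post F))) C2
      ((\<lambda>x. holds F x y) # (\<lambda>x. holds G x y) # fs)"
    by (auto simp: is_spec_def)
  have "subst_token (enc_bits y) (enc_formula (Disj F G)) = Node (enc_nat 4) (Node (enc_formula F) (enc_formula G))"
    by (simp add: subst_token_def numeral_eq_Suc)
  with compiled_binary(2)[OF C2] show ?case by simp
qed

definition select :: "formula \<Rightarrow> bool list list \<Rightarrow> nat \<Rightarrow> bool list \<Rightarrow> bool" where
  "select F ys i x = foldl (\<lambda>b y. if holds F x y then y ! i else b) False ys"

text \<open>All bits have to come from the same output: for every \<open>i\<close> it is the last
  element of \<open>ys\<close> that works for \<open>x\<close>.\<close>

lemma select_works:
  assumes "\<exists>y \<in> set ys. holds F x y"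
  shows "\<exists>y \<in> set ys. holds F x y \<and> (\<forall>i. select F ys i x = y ! i)"
  using assms
proof (induction ys rule: rev_induct)
  case (snoc y ys)
  then show ?case by (cases "holds F x y") (auto simp: select_def)
qed simp

lemma compiled_bit_tokens:
  assumes F: "is_spec n m F" and ys: "set ys \<subseteq> bits m" and i: "i < m"
  shows "\<exists>C. compiled n (foldl gate_step (Node Leaf (Node Leaf Leaf))
    (elems (bit_tokens (enc_list (post F)) (enc_list (map enc_bits ys)) (enc_nat i)))) C [select F ys i]"
proof -
  let ?acc = "foldl (add_case (enc_list (post F)) (enc_nat i)) (Node (Node Leaf Leaf) Leaf) (map enc_bits ys)"
  have toks: "elems (add_tokens (enc_list (post F)) acc y) = rev (map (subst_token y) (post F)) @ elems acc" for acc y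
  proof -
    have "elems (foldl (\<lambda>x tok. Node (subst_token y tok) x) acc es) =
        rev (map (subst_token y) es) @ elems acc" for es
      by (induction es arbitrary: acc) auto
    then show ?thesis by (simp add: add_tokens_def)
  qed
  have "\<exists>C. compiled n (foldl gate_step (Node Leaf (Node Leaf Leaf)) (rev (elems ?acc))) C [select F ys i]"
    using ys
  proof (induction ys rule: rev_induct)
    case Nil
    have "compiled n (Node Leaf (Node Leaf Leaf)) [] []" by (simp add: compiled_def)
    from compiled_const[OF this, of False] show ?case by (auto simp: select_def tree_of_bool_def)
  next
    case (snoc y ys)
    then obtain C where C: "compiled n (foldl gate_step (Node Leaf (Node Leaf Leaf)) (rev (elems
        (foldl (add_case (enc_list (post F)) (enc_nat i)) (Node (Node Leaf Leaf) Leaf) (map enc_bits ys))))) C [select F ys i]"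
      by auto
    have y: "y \<in> bits m" using snoc.prems by simp
    from compiled_formula[OF F y C] obtain C1 where C1:
      "compiled n (foldl gate_step (Node Leaf (Node Leaf Leaf)) (rev (elems
        (foldl (add_case (enc_list (post F)) (enc_nat i)) (Node (Node Leaf Leaf) Leaf) (map enc_bits ys))) @
        map (subst_token (enc_bits y)) (post F))) C1 ((\<lambda>x. holds F x y) # [select F ys i])"
      by auto
    have bit: "left (dropt (enc_nat i) (enc_bits y)) \<noteq> Leaf \<longleftrightarrow> y ! i"
      using sbits_enc_bits[of y m] nth_sbits[OF i, of "enc_bits y"] y
      by (simp add: bits_def dropt_eq sbit_def[symmetric])
    show ?case
    proof (cases "y ! i")
      case True
      then have "select F (ys @ [y]) i = (\<lambda>x. holds F x y \<or> select F ys i x)"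
        by (intro ext) (simp add: select_def)
      moreover have "add_case T (enc_nat i) acc (enc_bits y) =
          Node (Node (enc_nat 4) Leaf) (add_tokens T acc (enc_bits y))" for T acc
        using True bit by (simp add: add_case_def)
      ultimately show ?thesis using compiled_binary(2)[OF C1, of Leaf] by (simp add: toks)
    next
      case False
      then have sel: "select F (ys @ [y]) i = (\<lambda>x. \<not> holds F x y \<and> select F ys i x)"
        by (intro ext) (simp add: select_def)
      from compiled_not[OF C1, of Leaf] obtain C2 where C2: "compiled n (gate_step
          (foldl gate_step (Node Leaf (Node Leaf Leaf)) (rev (elems
          (foldl (add_case (enc_list (post F)) (enc_nat i)) (Node (Node Leaf Leaf) Leaf) (map enc_bits ys))) @
          map (subst_token (enc_bits y)) (post F))) (Node (enc_nat 2) Leaf)) C2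
          ((\<lambda>x. \<not> holds F x y) # [select F ys i])" by blast
      have "add_case T (enc_nat i) acc (enc_bits y) = Node (Node (enc_nat 3) Leaf)
          (Node (Node (enc_nat 2) Leaf) (add_tokens T acc (enc_bits y)))" for T acc
        using False bit by (simp add: add_case_def)
      with compiled_binary(1)[OF C2, of Leaf] show ?thesis by (simp add: toks sel)
    qed
  qed
  then show ?thesis by (simp add: bit_tokens_def revapp_eq)
qed

lemma bit_circuit_correct:
  assumes "is_spec n m F" "set ys \<subseteq> bits m" "i < m"
  shows "\<exists>C. bit_circuit (enc_list (post F)) (enc_list (map enc_bits ys)) (enc_nat i) = enc_list (map enc_gate C) \<and>
    circuit_ok n C \<and> (\<forall>x \<in> bits n. circuit_fun C x = select F ys i x)"
proof -
  from compiled_bit_tokens[OF assms] obtain C where C: "compiled n (foldl gate_step (Node Leaf (Node Leaf Leaf))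
    (elems (bit_tokens (enc_list (post F)) (enc_list (map enc_bits ys)) (enc_nat i)))) C [select F ys i]" by blast
  then obtain p where p: "left (foldl gate_step (Node Leaf (Node Leaf Leaf))
    (elems (bit_tokens (enc_list (post F)) (enc_list (map enc_bits ys)) (enc_nat i)))) = enc_list (map enc_gate (rev C))"
    "\<forall>p < length C. gate_ok n p (C ! p)" "p < length C" "p = length C - 1"
    "\<forall>x \<in> bits n. gate_vals C x ! p = select F ys i x"
    unfolding compiled_def by (auto simp: list_all2_Cons2)
  have ne: "C \<noteq> []" using p(3) by auto
  have "circuit_fun C x = select F ys i x" if "x \<in> bits n" for x
  proof -
    have "gate_vals C x \<noteq> []" using ne length_gate_vals[of C x] by (metis length_0_conv)
    then have "circuit_fun C x = gate_vals C x ! (length C - 1)"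
      by (simp add: circuit_fun_def gate_vals_def[symmetric] last_conv_nth)
    then show ?thesis using p(4,5) that by simp
  qed
  moreover have "bit_circuit (enc_list (post F)) (enc_list (map enc_bits ys)) (enc_nat i) = enc_list (map enc_gate C)"
    unfolding bit_circuit_def compile_def p(1) by (simp add: revapp_eq rev_map)
  ultimately show ?thesis using ne p(2) by (auto simp: circuit_ok_def)
qed

lemma all_circuits_correct:
  assumes F: "is_spec n m F" and ys: "set ys \<subseteq> bits m"
  shows "\<exists>Cs. all_circuits (state_tree n m F t ys) = enc_circuits Cs \<and> length Cs = m \<and>
    (\<forall>C \<in> set Cs. circuit_ok n C) \<and>
    (\<forall>i<m. \<forall>x \<in> bits n. circuit_fun (Cs ! i) x = select F ys i x)"
proof -
  let ?bc = "\<lambda>i. bit_circuit (enc_list (post F)) (enc_list (map enc_bits ys)) (enc_nat i)"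
  obtain c where c: "\<And>i. i < m \<Longrightarrow> ?bc i = enc_list (map enc_gate (c i)) \<and>
    circuit_ok n (c i) \<and> (\<forall>x \<in> bits n. circuit_fun (c i) x = select F ys i x)"
    using bit_circuit_correct[OF F ys] by metis
  let ?G = "\<lambda>x e. Node (bit_circuit (enc_list (post F)) (enc_list (map enc_bits ys))
     (right (dropt x (enc_nat m)))) x"
  have idx: "right (dropt (enc_list us) (enc_nat m)) = enc_nat (m - Suc (length us))" for us
  proof -
    have "right (enc_nat a) = enc_nat (a - 1)" for a by (cases a) auto
    then have "(right ^^ k) (enc_nat a) = enc_nat (a - k)" for a k
      by (induction k) simp_all
    from this[of "Suc (length us)" m] show ?thesis by (simp add: dropt_eq len_def)
  qed
  have "foldl ?G Leaf es = enc_list (map ?bc [m - length es..<m])"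
    if "length es \<le> m" for es :: "tree list"
    using that
  proof (induction es rule: rev_induct)
    case (snoc e es)
    then have "[m - length (es @ [e])..<m] = (m - Suc (length es)) # [m - length es..<m]"
      by (simp add: upt_conv_Cons Suc_diff_Suc)
    then show ?case using snoc by (simp add: idx)
  qed simp
  from this[of "elems (enc_nat m)"] have "all_circuits (state_tree n m F t ys) = enc_list (map ?bc [0..<m])"
    by (simp add: all_circuits_def state_tree_def base_tree_def flip: len_def)
  also have "\<dots> = enc_circuits (map c [0..<m])"
    unfolding enc_circuits_def using c by (intro arg_cong[where f = enc_list]) simp
  finally show ?thesis using c by (intro exI[of _ "map c [0..<m]"]) auto
qed

lemma skolem_circuits:
  assumes F: "is_spec n m F" and ys: "set ys \<subseteq> bits m"
    and covered: "\<forall>y \<in> bits m. cover n F ys y = {}"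
    and Cs: "length Cs = m" "\<forall>i<m. \<forall>x \<in> bits n. circuit_fun (Cs ! i) x = select F ys i x"
  shows "skolem n m F (map circuit_fun Cs)"
  unfolding skolem_def
proof (intro conjI ballI iffI)
  fix x assume x: "x \<in> bits n"
  have app: "app_tuple (map circuit_fun Cs) x = map (\<lambda>i. select F ys i x) [0..<m]"
    using Cs x by (intro nth_equalityI) (simp_all add: app_tuple_def)
  show "\<exists>y \<in> bits m. holds F x y" if "holds F x (app_tuple (map circuit_fun Cs) x)"
    using that by (rule bexI) (simp add: app bits_def)
  assume "\<exists>y \<in> bits m. holds F x y"
  then have "\<exists>y \<in> set ys. holds F x y" using covered x by (auto simp: cover_def)
  then obtain y where y: "y \<in> set ys" "holds F x y" "\<forall>i. select F ys i x = y ! i"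
    using select_works by blast
  have "app_tuple (map circuit_fun Cs) x = y"
    unfolding app using y ys by (intro nth_equalityI) (auto simp: bits_def)
  with y(2) show "holds F x (app_tuple (map circuit_fun Cs) x)" by simp
qed (simp add: Cs)

section \<open>A greedy round\<close>

text \<open>Search for the largest level: rows are stored with the last one first, so removing the
  head leaves the first \<open>j\<close> rows. Folding over \<open>R\<close> merely supplies enough
  passes.\<close>

definition pick_rows :: "tree \<Rightarrow> tree \<Rightarrow> tree" where
  "pick_rows S R =
    foldl (\<lambda>x e. if Node S (Node x Leaf) \<in> search_lang then x else right x) R (elems R)"

text \<open>Self-reduction: a bit is \<open>True\<close> whenever the oracle can still complete the
  prefix. The prefix \<open>x\<close> is kept reversed, and the unary \<open>m\<close> in the state
  supplies the passes.\<close>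

definition pick_prefix :: "tree \<Rightarrow> tree \<Rightarrow> tree" where
  "pick_prefix S R = foldl (\<lambda>x e.
     if Node S (Node R (Node (tree_of_bool True) x)) \<in> search_lang then Node (tree_of_bool True) x
     else Node (tree_of_bool False) x) Leaf (elems (left (right (left S))))"

definition pick :: "tree \<Rightarrow> tree" where
  "pick z = Node (left (left z))
     (Node (revapp (pick_prefix (left z) (pick_rows (left z) (right z))) Leaf) (right (left z)))"

text \<open>\<open>3 * m + 2 * n + 9\<close> is \<open>m + 2 * c + 1\<close> for
  \<open>c = n + m + 4\<close>.\<close>

definition setup_time :: "tree \<Rightarrow> tree" where
  "setup_time v = uadd (uadd (left (right v)) (uadd (left (right v)) (left (right v))))
     (uadd (uadd (left v) (left v)) (enc_nat 9))"

definition setup_state :: "tree \<Rightarrow> tree" where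
  "setup_state v = Node (Node (flatten (right (right v))) (Node (left (right v)) (Node (left v)
     (Node (setup_time v) (uadd (umul (setup_time v) (left v)) (enc_nat 1)))))) Leaf"

text \<open>Without hash rows and without a prefix the query only asks whether some
  \<open>t\<close>-tuple over a cover exists; for positive \<open>t\<close> this means that some
  cover is nonempty.\<close>

definition unfinished :: "tree \<Rightarrow> tree" where
  "unfinished S = tree_of_bool (Node S (Node Leaf Leaf) \<in> search_lang)"

lemma pt_unfinished: "ptime search_lang unfinished"
proof -
  have "ptime search_lang (\<lambda>S. unfinished S)" unfolding unfinished_def by (intro pt_intros)
  then show ?thesis by simp
qed

lemma pt_setup_state: "ptime L setup_state"
proof -
  have "ptime L (\<lambda>v. setup_state v)"
    unfolding setup_state_def setup_time_def by (intro pt_flatten pt_umul pt_uadd pt_intros)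
  then show ?thesis by simp
qed

lemma pt_pick_rows:
  assumes f: "ptime search_lang f" and g: "ptime search_lang g"
  shows "ptime search_lang (\<lambda>v. pick_rows (f v) (g v))"
  unfolding pick_rows_def
proof (rule pt_foldl[OF g g])
  show "ptime search_lang (\<lambda>p. if Node (f (left p)) (Node (left (right p)) Leaf) \<in> search_lang
      then left (right p) else right (left (right p)))"
    by (intro pt_if pt_query pt_Node pt_left pt_right pt_id pt_const pt_app1 f)
  show "tsize (if Node (f v) (Node x Leaf) \<in> search_lang then x else right x) \<le> tsize x + 0" for v x
    using tsize_right[of x] by simp
qed (rule pbd_const)

lemma pt_pick_prefix:
  assumes f: "ptime search_lang f" and g: "ptime search_lang g"
  shows "ptime search_lang (\<lambda>v. pick_prefix (f v) (g v))"
  unfolding pick_prefix_def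
proof (rule pt_foldl[OF pt_const])
  show "ptime search_lang (\<lambda>v. left (right (left (f v))))" by (intro pt_left pt_right f)
  show "ptime search_lang (\<lambda>p. if Node (f (left p)) (Node (g (left p)) (Node (tree_of_bool True) (left (right p))))
        \<in> search_lang then Node (tree_of_bool True) (left (right p))
      else Node (tree_of_bool False) (left (right p)))"
    by (intro pt_if pt_query pt_Node pt_left pt_right pt_id pt_const pt_app1 f g)
  show "tsize (if Node (f v) (Node (g v) (Node (tree_of_bool True) x)) \<in> search_lang
      then Node (tree_of_bool True) x else Node (tree_of_bool False) x) \<le> tsize x + 4" for v x
    by (simp add: tree_of_bool_def)
qed (rule pbd_const)

lemma pt_pick: "ptime search_lang pick"
proof -
  have "ptime search_lang (\<lambda>z. pick z)"
    unfolding pick_def by (intro pt_pick_prefix pt_pick_rows pt_revapp pt_Node pt_left pt_right pt_id pt_const)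
  then show ?thesis by simp
qed

lemma setup_state_spec:
  "setup_state (enc_spec n m F) = state_tree n m F (3 * m + 2 * n + 9) []"
proof -
  have "m + (m + m) + (n + n + 9) = 3 * m + 2 * n + 9" by simp
  then have "setup_time (enc_spec n m F) = enc_nat (3 * m + 2 * n + 9)"
    unfolding setup_time_def enc_spec_def left.simps right.simps uadd_enc_nat by (rule arg_cong)
  then show ?thesis
    by (simp add: setup_state_def enc_spec_def state_tree_def base_tree_def flatten_formula
        del: enc_nat.simps)
qed

text \<open>The last row comes first, which is the order in which the tossing loop pushes rows and
  the one in which \<open>pick_rows\<close> discards them.\<close>

definition hash_rows :: "nat \<Rightarrow> nat \<Rightarrow> bool list \<Rightarrow> bool list list" where
  "hash_rows N J r = map (\<lambda>i. rev (take N (drop (i * N) r))) (rev [0..<J])"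

lemma hash_rows_Suc: "hash_rows N (Suc J) r = hash_rows N J (drop N r) @ [rev (take N r)]"
proof -
  have "rev [0..<Suc J] = map Suc (rev [0..<J]) @ [0]"
    by (simp add: rev_map[symmetric] map_Suc_upt upt_conv_Cons del: upt_Suc)
  then show ?thesis by (simp add: hash_rows_def add.commute del: upt_Suc)
qed

lemma hash_rows_take: "hash_rows N N (take (N * N) r) = hash_rows N N r"
proof -
  have "take N (drop (i * N) (take (N * N) r)) = take N (drop (i * N) r)" if "i < N" for i
  proof -
    have "Suc i * N \<le> N * N" using that by (intro mult_le_mono1) simp
    then have "N \<le> N * N - i * N" by simp
    then show ?thesis by (simp add: drop_take)
  qed
  then show ?thesis by (auto simp: hash_rows_def)
qed

lemma drop_hash_rows: "j \<le> N \<Longrightarrow> drop (N - j) (hash_rows N N r) = hash_rows N j r"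
proof -
  assume j: "j \<le> N"
  have "drop (N - j) (rev [0..<N]) = rev (take j [0..<N])"
    using j by (simp add: drop_rev)
  then show ?thesis using j by (simp add: hash_rows_def drop_map)
qed

lemma hash_rows_bits:
  assumes "N * N \<le> length r" shows "set (hash_rows N N r) \<subseteq> bits N"
proof -
  have "length (take N (drop (i * N) r)) = N" if "i < N" for i
  proof -
    have "Suc i * N \<le> N * N" using that by (intro mult_le_mono1) simp
    then show ?thesis using assms by simp
  qed
  then show ?thesis by (auto simp: hash_rows_def bits_def)
qed

lemma hash0_iff: "hash0 N j u r \<longleftrightarrow> (\<forall>rw \<in> set (hash_rows N j r). \<not> dot rw u)"
  by (auto simp: hash0_def hash_rows_def)

lemma enc_bits_Nil [simp]: "enc_bits [] = Leaf"
  by (simp add: enc_bits_def)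

text \<open>The last disjunct serves the induction: before a hit every pass removes one element, so
  \<open>length R\<close> passes lead at worst to \<open>[]\<close>, where \<open>Q\<close>
  holds.\<close>

lemma foldl_drop_until:
  assumes "Q []"
  shows "\<exists>i \<le> length R. foldl (\<lambda>x e. if Q x then x else tl x) R es = drop i R \<and>
    (\<forall>i' < i. \<not> Q (drop i' R)) \<and> (length es \<ge> length R \<longrightarrow> Q (drop i R)) \<and>
    (Q (drop i R) \<or> i = length es)"
proof (induction es rule: rev_induct)
  case Nil
  show ?case using assms by (intro exI[of _ 0]) auto
next
  case (snoc e es)
  then obtain i where i: "i \<le> length R"
    "foldl (\<lambda>x e. if Q x then x else tl x) R es = drop i R" "\<forall>i' < i. \<not> Q (drop i' R)"
    "Q (drop i R) \<or> i = length es" by blast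
  show ?case
  proof (cases "Q (drop i R)")
    case True
    then show ?thesis using i by (intro exI[of _ i]) auto
  next
    case False
    then have lt: "i < length R" using i(1) assms by (cases "i = length R") auto
    have "Q (drop (Suc i) R)" if "length (es @ [e]) \<ge> length R"
    proof -
      have "Suc i = length R" using that i(4) False lt by simp
      then show ?thesis using assms by simp
    qed
    moreover have "i = length es" using i(4) False by simp
    ultimately show ?thesis
      using False i lt by (intro exI[of _ "Suc i"]) (auto simp: less_Suc_eq tl_drop drop_Suc)
  qed
qed

section \<open>Correctness of the search for an output\<close>

context
  fixes n m :: nat and F :: formula and t :: nat and ys :: "bool list list"
  assumes F: "is_spec n m F" and ys: "set ys \<subseteq> bits m"
begin

abbreviation query :: "bool list list \<Rightarrow> bool list \<Rightarrow> bool" where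
  "query Rs pre \<equiv>
    Node (state_tree n m F t ys) (Node (enc_list (map enc_bits Rs)) (enc_bits pre)) \<in> search_lang"

lemma query_empty:
  "query [] [] \<longleftrightarrow> (\<exists>y \<in> bits m. tuples t (cover n F ys y) \<noteq> {})"
  by (subst query_iff[OF F ys]) auto

lemma pick_prefix_spec:
  assumes Rs: "set Rs \<subseteq> bits (t * n + 1)" and q: "query Rs []"
  shows "\<exists>y \<in> bits m. pick_prefix (state_tree n m F t ys) (enc_list (map enc_bits Rs)) = enc_bits (rev y) \<and>
    (\<exists>u \<in> tuples t (cover n F ys y). \<forall>rw \<in> set Rs. \<not> dot rw u)"
proof -
  let ?S = "state_tree n m F t ys" and ?R = "enc_list (map enc_bits Rs)"
  let ?G = "\<lambda>x e. if Node ?S (Node ?R (Node (tree_of_bool True) x)) \<in> search_lang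
     then Node (tree_of_bool True) x else Node (tree_of_bool False) x"
  have "\<exists>p. foldl ?G Leaf es = enc_bits p \<and> length p = length es \<and> query Rs p"
    if "length es \<le> m" for es :: "tree list"
    using that
  proof (induction es rule: rev_induct)
    case Nil
    show ?case using q by (intro exI[of _ "[]"]) simp
  next
    case (snoc e es)
    then obtain p where p: "foldl ?G Leaf es = enc_bits p" "length p = length es" "query Rs p" by auto
    have cons: "Node (tree_of_bool b) (enc_bits p) = enc_bits (b # p)" for b
      by (simp add: enc_bits_def)
    show ?case
    proof (cases "query Rs (True # p)")
      case True
      then show ?thesis using p by (intro exI[of _ "True # p"]) (simp add: cons)
    next
      case False
      have lp: "length p \<le> m" "length (b # p) \<le> m" for b using p(2) snoc.prems by auto
      from p(3) obtain y where y: "y \<in> bits m" "take (length p) y = rev p"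
        "\<exists>u \<in> tuples t (cover n F ys y). \<forall>rw \<in> set Rs. \<not> dot rw u"
        unfolding query_iff[OF F ys Rs lp(1)] by blast
      \<comment> \<open>The output \<open>y\<close> behind the last successful query also extends
        the prefix by its own next bit, so if \<open>True\<close> is refused then
        \<open>False\<close> is possible.\<close>
      have "take (length (y ! length p # p)) y = rev (y ! length p # p)"
        using y(1,2) lp(2)[of True] by (simp add: bits_def take_Suc_conv_app_nth)
      then have "query Rs (y ! length p # p)"
        unfolding query_iff[OF F ys Rs lp(2)] using y by blast
      with False have "query Rs (False # p)" by (cases "y ! length p") auto
      then show ?thesis using p False by (intro exI[of _ "False # p"]) (simp add: cons)
    qed
  qed
  from this[of "elems (enc_nat m)"] obtain p where p: "pick_prefix ?S ?R = enc_bits p" "length p = m" "query Rs p"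
    by (auto simp: pick_prefix_def state_tree_def base_tree_def len_def[symmetric])
  from p(2) have lp: "length p \<le> m" by simp
  from p(3) obtain y where y: "y \<in> bits m" "take (length p) y = rev p"
    "\<exists>u \<in> tuples t (cover n F ys y). \<forall>rw \<in> set Rs. \<not> dot rw u"
    unfolding query_iff[OF F ys Rs lp] by blast
  from y(1,2) p(2) have "p = rev y" by (simp add: bits_def)
  with p y show ?thesis by blast
qed

lemma pick_rows_spec:
  assumes q: "query [] []"
  shows "\<exists>i \<le> length Rs. pick_rows (state_tree n m F t ys) (enc_list (map enc_bits Rs)) =
      enc_list (map enc_bits (drop i Rs)) \<and> query (drop i Rs) [] \<and> (\<forall>i' < i. \<not> query (drop i' Rs) [])"
proof -
  let ?S = "state_tree n m F t ys"
  have right: "right (enc_list us) = enc_list (tl us)" for us by (cases us) auto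
  have "foldl (\<lambda>x e. if Node ?S (Node x Leaf) \<in> search_lang then x else right x)
      (enc_list (map enc_bits Rs)) es =
    enc_list (map enc_bits (foldl (\<lambda>x e. if query x [] then x else tl x) Rs es))" for es :: "tree list"
    by (induction es rule: rev_induct) (simp_all add: right map_tl)
  moreover from foldl_drop_until[where Q = "\<lambda>x. query x []", OF q,
      of Rs "elems (enc_list (map enc_bits Rs))"]
  obtain i where "i \<le> length Rs"
    "foldl (\<lambda>x e. if query x [] then x else tl x) Rs (elems (enc_list (map enc_bits Rs))) = drop i Rs"
    "\<forall>i' < i. \<not> query (drop i' Rs) []" "query (drop i Rs) []"
    by auto
  ultimately show ?thesis unfolding pick_rows_def by (intro exI[of _ i]) simp
qed

text \<open>Dropping \<open>i\<close> rows leaves level \<open>N - i\<close>, the deepest that any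
  output reaches. The output found has a tuple alive there, and this tuple is alive at all smaller
  levels.\<close>

lemma pick_survivor:
  assumes N: "N = t * n + 1" and r: "r \<in> bits (N * N)" and q: "query [] []"
  shows "\<exists>y. survivor m N t (cover n F ys) r y \<and>
    pick (Node (state_tree n m F t ys) (enc_list (map enc_bits (hash_rows N N r)))) =
      state_tree n m F t (y # ys)"
proof -
  let ?Rs = "hash_rows N N r"
  have lenR: "length ?Rs = N" by (simp add: hash_rows_def)
  have bitsR: "set ?Rs \<subseteq> bits (t * n + 1)"
    unfolding N[symmetric] using r by (intro hash_rows_bits) (simp add: bits_def)
  have query_hash: "query (drop (N - j) ?Rs) [] \<longleftrightarrow>
      (\<exists>y \<in> bits m. \<exists>u \<in> tuples t (cover n F ys y). hash0 N j u r)" if "j \<le> N" for j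
  proof -
    have "set (drop (N - j) ?Rs) \<subseteq> bits (t * n + 1)" using bitsR set_drop_subset by fast
    from query_iff[OF F ys this, of "[]"] show ?thesis
      by (simp add: drop_hash_rows[OF that] hash0_iff)
  qed
  from pick_rows_spec[OF q, of ?Rs] obtain i where i: "i \<le> N"
    "pick_rows (state_tree n m F t ys) (enc_list (map enc_bits ?Rs)) = enc_list (map enc_bits (drop i ?Rs))"
    "query (drop i ?Rs) []" "\<forall>i' < i. \<not> query (drop i' ?Rs) []" using lenR by auto
  have sub: "set (drop i ?Rs) \<subseteq> bits (t * n + 1)" using bitsR set_drop_subset by fast
  from pick_prefix_spec[OF sub i(3)] obtain y u where y: "y \<in> bits m"
    "pick_prefix (state_tree n m F t ys) (enc_list (map enc_bits (drop i ?Rs))) = enc_bits (rev y)"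
    and u: "u \<in> tuples t (cover n F ys y)" "\<forall>rw \<in> set (drop i ?Rs). \<not> dot rw u" by blast
  have hash: "hash0 N (N - i) u r"
    unfolding hash0_iff using u(2) drop_hash_rows[of "N - i" N r] i(1) by simp
  have "survivor m N t (cover n F ys) r y"
    unfolding survivor_def
  proof (intro conjI allI impI)
    fix j assume j: "j \<le> N" "\<exists>y' \<in> bits m. \<exists>u \<in> tuples t (cover n F ys y'). hash0 N j u r"
    then have "query (drop (N - j) ?Rs) []" using query_hash by simp
    \<comment> \<open>All queries with fewer than \<open>i\<close> rows dropped failed, so a
      reachable level \<open>j\<close> cannot exceed \<open>N - i\<close>.\<close>
    then have "j \<le> N - i" using i(1,4) j(1) by (metis diff_diff_cancel diff_le_mono2 not_less)
    then have "hash0 N j u r" using hash by (auto simp: hash0_def)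
    then show "\<exists>u \<in> tuples t (cover n F ys y). hash0 N j u r" using u(1) by blast
  qed (rule y(1))
  moreover have "pick (Node (state_tree n m F t ys) (enc_list (map enc_bits ?Rs))) = state_tree n m F t (y # ys)"
  proof -
    have "revapp (enc_bits (rev y)) Leaf = enc_bits y"
      using revapp_enc_bits[of "rev y" "[]"] by (simp add: enc_bits_def)
    then show ?thesis
      unfolding pick_def using i(2) y(2) by (simp add: state_tree_def)
  qed
  ultimately show ?thesis by blast
qed

end

section \<open>The synthesis program\<close>

text \<open>Coins lie outside \<open>ptime\<close>, whose programs leave the tape unread. Variables:
  0 state, 1 rows collected, 2 rows still to come, 3 current row, 4 bits still to come, 5 last
  toss.\<close>

definition toss_bits :: com where
  "toss_bits = While (Var 4)
    (Seq (Toss 5) (Seq (Assign 3 (Join (Var 5) (Var 3))) (Assign 4 (Snd (Var 4)))))"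

definition row_length :: expr where
  "row_length = Snd (Snd (Snd (Snd (Fst (Var 0)))))"

definition toss_rows :: com where
  "toss_rows = While (Var 2) (Seq (Assign 3 Null) (Seq (Assign 4 row_length) (Seq toss_bits
    (Seq (Assign 1 (Join (Var 3) (Var 1))) (Assign 2 (Snd (Var 2)))))))"

text \<open>\<open>cp\<close> and \<open>cq\<close> work at variable 1 and leave variable 0 alone.
  After the new state is copied to variable 0, \<open>cq\<close> turns the other copy into the loop
  flag.\<close>

definition greedy_round :: "com \<Rightarrow> com \<Rightarrow> com" where
  "greedy_round cp cq = Seq (Assign 1 Null) (Seq (Assign 2 row_length) (Seq toss_rows
    (Seq (Assign 1 (Join (Var 0) (Var 1))) (Seq cp (Seq (Assign 0 (Var 1)) cq)))))"

definition synthesizer :: "com \<Rightarrow> com \<Rightarrow> com \<Rightarrow> com \<Rightarrow> com" where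
  "synthesizer cs cp cq co = Seq cs (Seq (Assign 1 (Var 0)) (Seq cq
    (Seq (While (Var 1) (greedy_round cp cq)) co)))"

lemma exec_toss_bits:
  assumes "s 4 = enc_nat c" "s 3 = enc_bits acc" "c \<le> length r"
  shows "\<exists>t s'. exec L toss_bits s r t s' (drop c r) \<and> s' 3 = enc_bits (rev (take c r) @ acc) \<and>
    (\<forall>i. i \<notin> {3, 4, 5} \<longrightarrow> s' i = s i) \<and> t \<le> Suc c * (20 + 20 * (c + length acc))"
  using assms
proof (induction c arbitrary: s acc r)
  case 0
  have "val (Var 4) s = Leaf" using 0 by simp
  from exec.WhileFalse[OF this] have "exec L toss_bits s r (1 + cost (Var 4) s) s r"
    unfolding toss_bits_def .
  then show ?case using 0 by (intro exI[of _ "1 + cost (Var 4) s"] exI[of _ s]) simp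
next
  case (Suc c)
  then obtain b r2 where r: "r = b # r2" by (cases r) auto
  let ?body = "Seq (Toss 5) (Seq (Assign 3 (Join (Var 5) (Var 3))) (Assign 4 (Snd (Var 4))))"
  let ?s1 = "s(5 := tree_of_bool b)"
  let ?s2 = "?s1(3 := val (Join (Var 5) (Var 3)) ?s1)"
  let ?s3 = "?s2(4 := val (Snd (Var 4)) ?s2)"
  let ?t = "1 + ((1 + cost (Join (Var 5) (Var 3)) ?s1) + (1 + cost (Snd (Var 4)) ?s2))"
  have body: "exec L ?body s r ?t ?s3 r2"
    unfolding r by (rule exec.Seq[OF exec.Toss exec.Seq[OF exec.Assign exec.Assign]])
  have "?s3 4 = enc_nat c" "?s3 3 = enc_bits (b # acc)" "c \<le> length r2"
    using Suc.prems r by (simp_all add: enc_bits_def)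
  from Suc.IH[OF this] obtain t s' where
    IH: "exec L toss_bits ?s3 r2 t s' (drop c r2)" "s' 3 = enc_bits (rev (take c r2) @ b # acc)"
    "\<forall>i. i \<notin> {3, 4, 5} \<longrightarrow> s' i = ?s3 i" "t \<le> Suc c * (20 + 20 * (c + length (b # acc)))" by blast
  have "val (Var 4) s \<noteq> Leaf" using Suc.prems(1) by simp
  from exec.WhileTrue[OF this body IH(1)[unfolded toss_bits_def]]
  have ex: "exec L toss_bits s r (1 + cost (Var 4) s + ?t + t) s' (drop (Suc c) r)"
    unfolding toss_bits_def r by simp
  have "tsize (enc_bits acc) \<le> 1 + 4 * length acc" by (rule tsize_enc_bits)
  moreover have "tsize (tree_of_bool b) \<le> 3" by (rule tsize_tree_of_bool)
  ultimately have "1 + cost (Var 4) s + ?t \<le> 20 + 20 * (Suc c + length acc)"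
    using Suc.prems(1,2) by simp
  with IH(4) have "1 + cost (Var 4) s + ?t + t \<le> Suc (Suc c) * (20 + 20 * (Suc c + length acc))"
    by simp
  moreover have "s' 3 = enc_bits (rev (take (Suc c) r) @ acc)" using IH(2) r by simp
  moreover have "\<forall>i. i \<notin> {3, 4, 5} \<longrightarrow> s' i = s i" using IH(3) by simp
  ultimately show ?case using ex by blast
qed

lemma tsize_rows:
  assumes "set rs \<subseteq> bits N" shows "tsize (enc_list (map enc_bits rs)) \<le> 1 + length rs * (4 * N + 2)"
  using assms
proof (induction rs)
  case (Cons a rs)
  then show ?case using tsize_enc_bits[of a] by (simp add: bits_def)
qed simp

definition toss_row_time :: "nat \<Rightarrow> nat \<Rightarrow> nat \<Rightarrow> nat" where
  "toss_row_time Z N W = 20 + 6 * W + 6 * Z + Suc N * (20 + 20 * N) + 8 * N + 2 * (W * (4 * N + 2))"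

lemma cost_row_length: "cost row_length s \<le> 6 * tsize (s 0)"
proof -
  have "tsize (left v) \<le> tsize v" "tsize (right v) \<le> tsize v" for v
    by (rule tsize_left, rule tsize_right)
  from this(1)[of "s 0"] this(2)[of "left (s 0)"] this(2)[of "right (left (s 0))"]
    this(2)[of "right (right (left (s 0)))"] this(2)[of "right (right (right (left (s 0))))"]
  show ?thesis by (simp add: row_length_def)
qed

lemma exec_toss_rows:
  assumes "s 2 = enc_nat c" "s 1 = enc_list (map enc_bits acc)" "set acc \<subseteq> bits N"
    and "val row_length s = enc_nat N" "tsize (s 0) \<le> Z" "c + length acc \<le> W" "c * N \<le> length r"
  shows "\<exists>t s'. exec L toss_rows s r t s' (drop (c * N) r) \<and>
    s' 1 = enc_list (map enc_bits (hash_rows N c r @ acc)) \<and> s' 0 = s 0 \<and>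
    t \<le> Suc c * toss_row_time Z N W"
  using assms
proof (induction c arbitrary: s acc r)
  case 0
  have "val (Var 2) s = Leaf" using 0 by simp
  from exec.WhileFalse[OF this] have "exec L toss_rows s r (1 + cost (Var 2) s) s r"
    unfolding toss_rows_def .
  then show ?case using 0
    by (intro exI[of _ "1 + cost (Var 2) s"] exI[of _ s]) (simp add: hash_rows_def toss_row_time_def)
next
  case (Suc c)
  let ?s1 = "s(3 := val Null s)"
  let ?s2 = "?s1(4 := val row_length ?s1)"
  have rl: "val row_length ?s1 = enc_nat N" using Suc.prems(4) by (simp add: row_length_def)
  have "?s2 4 = enc_nat N" "?s2 3 = enc_bits []" "N \<le> length r" using rl Suc.prems(7) by simp_all
  from exec_toss_bits[OF this] obtain t3 s3 where 3: "exec L toss_bits ?s2 r t3 s3 (drop N r)"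
    "s3 3 = enc_bits (rev (take N r) @ [])" "\<forall>i. i \<notin> {3, 4, 5} \<longrightarrow> s3 i = ?s2 i"
    "t3 \<le> Suc N * (20 + 20 * (N + length ([] :: bool list)))"
    by blast
  note 3 = 3[unfolded append_Nil2 list.size(3) add_0_right]
  let ?s4 = "s3(1 := val (Join (Var 3) (Var 1)) s3)"
  let ?s5 = "?s4(2 := val (Snd (Var 2)) ?s4)"
  let ?body = "Seq (Assign 3 Null) (Seq (Assign 4 row_length) (Seq toss_bits
    (Seq (Assign 1 (Join (Var 3) (Var 1))) (Assign 2 (Snd (Var 2))))))"
  let ?t = "(1 + cost Null s) + ((1 + cost row_length ?s1) + (t3 +
    ((1 + cost (Join (Var 3) (Var 1)) s3) + (1 + cost (Snd (Var 2)) ?s4))))"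
  have body: "exec L ?body s r ?t ?s5 (drop N r)"
    by (intro exec.Seq[OF exec.Assign exec.Seq[OF exec.Assign exec.Seq[OF 3(1) exec.Seq[OF exec.Assign exec.Assign]]]])
  have s3: "s3 0 = s 0" "s3 1 = s 1" "s3 2 = s 2" using 3(3) by simp_all
  have row: "rev (take N r) \<in> bits N" using Suc.prems(7) by (simp add: bits_def)
  have "?s5 2 = enc_nat c" "?s5 1 = enc_list (map enc_bits (rev (take N r) # acc))"
    "set (rev (take N r) # acc) \<subseteq> bits N" "val row_length ?s5 = enc_nat N" "tsize (?s5 0) \<le> Z"
    "c + length (rev (take N r) # acc) \<le> W" "c * N \<le> length (drop N r)"
    using Suc.prems s3 3(2) row by (simp_all add: row_length_def)
  from Suc.IH[OF this] obtain t s' where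
    IH: "exec L toss_rows ?s5 (drop N r) t s' (drop (c * N) (drop N r))"
    "s' 1 = enc_list (map enc_bits (hash_rows N c (drop N r) @ rev (take N r) # acc))"
    "s' 0 = ?s5 0" "t \<le> Suc c * toss_row_time Z N W" by blast
  have "val (Var 2) s \<noteq> Leaf" using Suc.prems(1) by simp
  from exec.WhileTrue[OF this body IH(1)[unfolded toss_rows_def]]
  have ex: "exec L toss_rows s r (1 + cost (Var 2) s + ?t + t) s' (drop (Suc c * N) r)"
    unfolding toss_rows_def by (simp add: add.commute)
  have "1 + cost (Var 2) s + ?t \<le> toss_row_time Z N W"
  proof -
    obtain A where A: "Suc N * (20 + 20 * N) = A" by blast
    obtain B where B: "W * (4 * N + 2) = B" by blast
    have 1: "cost row_length ?s1 \<le> 6 * Z" using cost_row_length[of ?s1] Suc.prems(5) by simp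
    have 2: "tsize (s3 3) \<le> 1 + 4 * N"
      unfolding 3(2) using tsize_enc_bits[of "rev (take N r)"] Suc.prems(7) by simp
    have 4: "tsize (s 1) \<le> 1 + B"
    proof -
      have "length acc * (4 * N + 2) \<le> W * (4 * N + 2)" using Suc.prems(6) by (intro mult_le_mono1) simp
      then show ?thesis unfolding Suc.prems(2) using tsize_rows[OF Suc.prems(3)] B by linarith
    qed
    have 5: "cost (Var 2) s = 2 * c + 3" "cost Null s = 1" "c + 1 \<le> W"
      "cost (Join (Var 3) (Var 1)) s3 = 1 + 2 * tsize (s3 3) + 2 * tsize (s 1)"
      "cost (Snd (Var 2)) ?s4 = 4 * c + 4" using s3 Suc.prems(1,6) by simp_all
    from 1 2 4 5 3(4) show ?thesis unfolding toss_row_time_def A B by linarith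
  qed
  then have "1 + cost (Var 2) s + ?t + t \<le> Suc (Suc c) * toss_row_time Z N W" using IH(4) by simp
  moreover have "s' 1 = enc_list (map enc_bits (hash_rows N (Suc c) r @ acc))"
    using IH(2) by (simp add: hash_rows_Suc)
  moreover have "s' 0 = s 0" using IH(3) s3 by simp
  ultimately show ?case using ex by blast
qed

definition node_bound :: "nat \<Rightarrow> nat" where
  "node_bound Z = 2 + Z + Z * (4 * Z + 2)"

text \<open>The last summand is the time of \<open>cq\<close>, which runs on a result of
  \<open>cp\<close> of size up to \<open>a2 * node_bound Z ^ d2\<close>.\<close>

definition round_time :: "nat \<Rightarrow> nat \<Rightarrow> nat \<Rightarrow> nat \<Rightarrow> nat \<Rightarrow> nat \<Rightarrow> nat \<Rightarrow> nat" where
  "round_time a1 d1 a2 d2 a3 d3 Z = 5 + 6 * Z + Suc Z * toss_row_time Z Z Z + 2 * node_bound Z +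
     a1 * node_bound Z ^ d1 + a2 * node_bound Z ^ d2 + a3 * (a2 * node_bound Z ^ d2) ^ d3"

lemma toss_row_time_mono: "N \<le> Z \<Longrightarrow> toss_row_time Z N N \<le> toss_row_time Z Z Z"
  unfolding toss_row_time_def by (intro add_mono mult_le_mono) auto

lemma exec_greedy_round:
  assumes cp: "implements L 1 cp f pp" and pp: "\<And>v. pp v \<le> a1 * tsize v ^ d1"
    and fs: "\<And>v. tsize (f v) \<le> a2 * tsize v ^ d2"
    and cq: "implements L 1 cq q pq" and pq: "\<And>v. pq v \<le> a3 * tsize v ^ d3"
    and s: "val row_length s = enc_nat N" "tsize (s 0) \<le> Z" "N \<le> Z"
    and r: "N * N \<le> length r"
  shows "\<exists>t s'. exec L (greedy_round cp cq) s r t s' (drop (N * N) r) \<and>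
    s' 0 = f (Node (s 0) (enc_list (map enc_bits (hash_rows N N r)))) \<and> s' 1 = q (s' 0) \<and>
    t \<le> round_time a1 d1 a2 d2 a3 d3 Z"
proof -
  let ?s1 = "s(1 := val Null s)"
  let ?s2 = "?s1(2 := val row_length ?s1)"
  have rl: "val row_length ?s1 = enc_nat N" "val row_length ?s2 = enc_nat N"
    using s(1) by (simp_all add: row_length_def)
  have "?s2 2 = enc_nat N" "?s2 1 = enc_list (map enc_bits [])" "set [] \<subseteq> bits N"
    "val row_length ?s2 = enc_nat N" "tsize (?s2 0) \<le> Z" "N + length ([] :: bool list list) \<le> N" "N * N \<le> length r"
    using rl s r by simp_all
  from exec_toss_rows[OF this] obtain t3 s3 where 3: "exec L toss_rows ?s2 r t3 s3 (drop (N * N) r)"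
    "s3 1 = enc_list (map enc_bits (hash_rows N N r @ []))" "s3 0 = ?s2 0"
    "t3 \<le> Suc N * toss_row_time Z N N"
    by blast
  have "?s2 0 = s 0" by simp
  note 3 = 3[unfolded append_Nil2 this]
  let ?r = "drop (N * N) r"
  let ?v = "Node (s 0) (enc_list (map enc_bits (hash_rows N N r)))"
  let ?s4 = "s3(1 := val (Join (Var 0) (Var 1)) s3)"
  have s4: "?s4 1 = ?v" using 3(2,3) by simp
  obtain t5 s5 where 5: "exec L cp ?s4 ?r t5 s5 ?r" "s5 1 = f (?s4 1)" "t5 \<le> pp (?s4 1)"
    by (rule implementsE[OF cp, where s = ?s4 and r = ?r]) blast
  let ?s6 = "s5(0 := val (Var 1) s5)"
  obtain t7 s7 where 7: "exec L cq ?s6 ?r t7 s7 ?r" "s7 1 = q (?s6 1)" "s7 0 = ?s6 0" "t7 \<le> pq (?s6 1)"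
    by (rule implementsE[OF cq, where s = ?s6 and r = ?r]) force
  let ?t = "(1 + cost Null s) + ((1 + cost row_length ?s1) + (t3 + ((1 + cost (Join (Var 0) (Var 1)) s3) +
    (t5 + ((1 + cost (Var 1) s5) + t7)))))"
  have "exec L (greedy_round cp cq) s r ?t s7 ?r"
    unfolding greedy_round_def
    by (rule exec.Seq[OF exec.Assign exec.Seq[OF exec.Assign exec.Seq[OF 3(1)
      exec.Seq[OF exec.Assign exec.Seq[OF 5(1) exec.Seq[OF exec.Assign 7(1)]]]]]])
  moreover have "s7 0 = f ?v" "s7 1 = q (s7 0)" using 7 5(2) s4 by simp_all
  moreover have "?t \<le> round_time a1 d1 a2 d2 a3 d3 Z"
  proof -
    have rows: "set (hash_rows N N r) \<subseteq> bits N" by (rule hash_rows_bits[OF r])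
    have "N * (4 * N + 2) \<le> Z * (4 * Z + 2)" using s(3) by (intro mult_le_mono) auto
    with tsize_rows[OF rows] s(2) have v: "tsize ?v \<le> node_bound Z"
      by (simp add: hash_rows_def node_bound_def)
    have "pp ?v \<le> a1 * node_bound Z ^ d1"
      using pp[of ?v] v by (meson order_trans mult_le_mono2 power_mono zero_le)
    moreover have fv: "tsize (f ?v) \<le> a2 * node_bound Z ^ d2"
      using fs[of ?v] v by (meson order_trans mult_le_mono2 power_mono zero_le)
    moreover have "pq (f ?v) \<le> a3 * (a2 * node_bound Z ^ d2) ^ d3"
      using pq[of "f ?v"] fv by (meson order_trans mult_le_mono2 power_mono zero_le)
    moreover have "t3 \<le> Suc Z * toss_row_time Z Z Z"
      using 3(4) s(3) toss_row_time_mono[OF s(3)] by (meson Suc_le_mono mult_le_mono order_trans)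
    moreover have "cost row_length ?s1 \<le> 6 * Z" using cost_row_length[of ?s1] s(2) by simp
    moreover have "cost Null s = 1" "cost (Var 1) s5 = tsize (f ?v)" using 5(2) s4 by simp_all
    moreover have "cost (Join (Var 0) (Var 1)) s3 + 1 = 2 * tsize ?v" using 3(2,3) by simp
    moreover have "t5 \<le> pp ?v" "t7 \<le> pq (f ?v)" using 5 7 s4 by simp_all
    ultimately show ?thesis using v unfolding round_time_def by linarith
  qed
  ultimately show ?thesis by blast
qed

text \<open>\<open>lev\<close> counts completed rounds. States grow with every round, so the bound
  \<open>Bd\<close> is required only below level \<open>W\<close>. The loop may stop before its
  \<open>R\<close> blocks of coins are used up.\<close>

lemma exec_greedy_loop:
  assumes round: "\<And>x s r. I x \<Longrightarrow> lev x < W \<Longrightarrow> d x \<noteq> 0 \<Longrightarrow> s 0 = enc x \<Longrightarrow> M \<le> length r \<Longrightarrow>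
      \<exists>t s'. exec L B s r t s' (drop M r) \<and> s' 0 = enc (step x (take M r)) \<and>
        s' 1 = tree_of_bool (d (step x (take M r)) \<noteq> 0) \<and> t \<le> Bd"
    and step: "\<And>x r. I x \<Longrightarrow> d x \<noteq> 0 \<Longrightarrow> r \<in> bits M \<Longrightarrow> I (step x r) \<and> lev (step x r) = Suc (lev x)"
    and "finishes d step M R x r" "I x" "lev x + R \<le> W" "R * M \<le> length r"
    and "s 0 = enc x" "s 1 = tree_of_bool (d x \<noteq> (0::nat))"
  shows "\<exists>t s' r' x'. exec L (While (Var 1) B) s r t s' r' \<and> s' 0 = enc x' \<and> d x' = 0 \<and> I x' \<and>
    lev x' \<le> W \<and> t \<le> Suc R * (5 + Bd)"
  using assms(3-)
proof (induction R arbitrary: x r s)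
  case 0
  then have "val (Var 1) s = Leaf" by simp
  note E = exec.WhileFalse[OF this, of L B r]
  show ?case by (intro exI conjI, rule E) (use 0 in \<open>auto simp: tree_of_bool_def\<close>)
next
  case (Suc R)
  show ?case
  proof (cases "d x = 0")
    case True
    then have "val (Var 1) s = Leaf" using Suc.prems by simp
    note E = exec.WhileFalse[OF this, of L B r]
    show ?thesis by (intro exI conjI, rule E) (use Suc.prems True in \<open>auto simp: tree_of_bool_def\<close>)
  next
    case False
    let ?x = "step x (take M r)"
    have len: "M \<le> length r" "R * M \<le> length (drop M r)" using Suc.prems(4) by auto
    have lev: "lev x < W" using Suc.prems(3) by simp
    obtain t1 s1 where 1: "exec L B s r t1 s1 (drop M r)" "s1 0 = enc ?x"
      "s1 1 = tree_of_bool (d ?x \<noteq> 0)" "t1 \<le> Bd"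
      using round[where x = x and s = s and r = r, OF Suc.prems(2) lev False Suc.prems(5) len(1)] by blast
    have x: "I ?x" "lev ?x = Suc (lev x)"
      using step[OF Suc.prems(2) False, of "take M r"] len(1) by (auto simp: bits_def)
    have "finishes d step M R ?x (drop M r)" using Suc.prems(1) False by simp
    from Suc.IH[OF this x(1) _ len(2) 1(2,3)] x(2) Suc.prems(3)
    obtain t2 s2 r2 x2 where 2: "exec L (While (Var 1) B) s1 (drop M r) t2 s2 r2" "s2 0 = enc x2"
      "d x2 = 0" "I x2" "lev x2 \<le> W" "t2 \<le> Suc R * (5 + Bd)" by auto
    have "val (Var 1) s \<noteq> Leaf" using Suc.prems(6) False by simp
    note E = exec.WhileTrue[OF this 1(1) 2(1)]
    have "cost (Var 1) s \<le> 3" using Suc.prems(6) tsize_tree_of_bool by simp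
    then have le: "1 + cost (Var 1) s + t1 + t2 \<le> Suc (Suc R) * (5 + Bd)" using 1(4) 2(6) by simp
    show ?thesis by (intro exI conjI, rule E) (use 2 le in auto)
  qed
qed

lemma finishes_take: "finishes d step M R s (take (R * M) r) \<longleftrightarrow> finishes d step M R s r"
  by (induction R arbitrary: s r) (simp_all add: drop_take min_def)


section \<open>Progress of the greedy algorithm\<close>

definition uncovered :: "nat \<Rightarrow> nat \<Rightarrow> formula \<Rightarrow> bool list list \<Rightarrow> nat" where
  "uncovered n m F ys = card (\<Union>y \<in> bits m. cover n F ys y)"

lemma cover_bits: "cover n F ys y \<subseteq> bits n"
  by (auto simp: cover_def)

lemma finite_cover [simp]: "finite (cover n F ys y)"
  by (rule finite_subset[OF cover_bits]) simp

lemma uncovered_eq_0: "uncovered n m F ys = 0 \<longleftrightarrow> (\<forall>y \<in> bits m. cover n F ys y = {})"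
  by (simp add: uncovered_def)

lemma uncovered_le: "uncovered n m F ys \<le> 2 ^ n"
  using card_mono[of "bits n" "\<Union>y \<in> bits m. cover n F ys y"] cover_bits
  by (force simp: uncovered_def)

lemma uncovered_Cons:
  assumes "y \<in> bits m"
  shows "uncovered n m F (y # ys) + card (cover n F ys y) = uncovered n m F ys"
proof -
  let ?U = "\<lambda>ys. \<Union>y \<in> bits m. cover n F ys y"
  have "?U (y # ys) \<union> cover n F ys y = ?U ys" "?U (y # ys) \<inter> cover n F ys y = {}"
    using assms by (auto simp: cover_def)
  then show ?thesis unfolding uncovered_def by (metis card_Un_disjoint finite_UN_I finite_bits finite_cover)
qed

lemma skolem_image_bits: "skolem n m F \<Psi> \<Longrightarrow> skolem_image n F \<Psi> \<subseteq> bits m"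
  by (auto simp: skolem_image_def skolem_def app_tuple_def bits_def)

text \<open>An uncovered input that has an output lies in the cover of its image under
  \<open>\<Psi>\<close>, so \<open>k\<close> covers suffice, each at most twice as large as that of
  the near-maximal \<open>y\<close>.\<close>

lemma uncovered_le_image:
  assumes sk: "skolem n m F \<Psi>" and k: "card (skolem_image n F \<Psi>) = k"
    and nm: "near_max m (cover n F ys) y"
  shows "uncovered n m F ys \<le> k * (2 * card (cover n F ys y))"
proof -
  have im: "skolem_image n F \<Psi> \<subseteq> bits m" by (rule skolem_image_bits[OF sk])
  then have fin: "finite (skolem_image n F \<Psi>)" by (rule finite_subset) simp
  have "(\<Union>y \<in> bits m. cover n F ys y) \<subseteq> (\<Union>y \<in> skolem_image n F \<Psi>. cover n F ys y)"
  proof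
    fix x assume "x \<in> (\<Union>y \<in> bits m. cover n F ys y)"
    then obtain y where x: "y \<in> bits m" "x \<in> bits n" "holds F x y" "\<forall>y' \<in> set ys. \<not> holds F x y'"
      by (auto simp: cover_def)
    then have "holds F x (app_tuple \<Psi> x)" using sk by (auto simp: skolem_def)
    with x show "x \<in> (\<Union>y \<in> skolem_image n F \<Psi>. cover n F ys y)"
      by (auto simp: skolem_image_def cover_def)
  qed
  then have "uncovered n m F ys \<le> card (\<Union>y \<in> skolem_image n F \<Psi>. cover n F ys y)"
    unfolding uncovered_def using fin by (intro card_mono) auto
  also have "\<dots> \<le> (\<Sum>y \<in> skolem_image n F \<Psi>. card (cover n F ys y))" by (rule card_UN_le[OF fin])
  also have "\<dots> \<le> (\<Sum>y' \<in> skolem_image n F \<Psi>. 2 * card (cover n F ys y))"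
    using nm im by (intro sum_mono) (auto simp: near_max_def)
  finally show ?thesis using k by simp
qed

section \<open>Number of rounds and total failure probability\<close>

lemma card_skolem_image_le:
  assumes "skolem n m F \<Psi>" shows "card (skolem_image n F \<Psi>) \<le> 2 ^ m"
  using card_mono[OF finite_bits skolem_image_bits[OF assms]] by simp

text \<open>From \<open>1 - z \<le> exp (- z)\<close> and \<open>exp 1 \<ge> 2\<close>.\<close>

lemma half_power:
  fixes k :: nat assumes "k > 0" shows "(1 - 1 / (2 * real k)) ^ (2 * k) \<le> 1 / 2"
proof -
  have "(1 - 1 / (2 * real k)) ^ (2 * k) \<le> exp (- (1 / (2 * real k))) ^ (2 * k)"
    using assms exp_ge_add_one_self[of "- (1 / (2 * real k))"] by (intro power_mono) (auto simp: field_simps)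
  also have "\<dots> = exp (- 1)" using assms by (simp flip: exp_of_nat_mult)
  also have "\<dots> \<le> 1 / 2" using exp_ge_add_one_self[of 1] by (simp add: exp_minus field_simps)
  finally show ?thesis .
qed

text \<open>Every \<open>2 * k\<close> rounds halve the number of uncovered inputs, and
  \<open>n + 1\<close> halvings bring at most \<open>2 ^ n\<close> of them below 1.\<close>

lemma decay:
  fixes k n :: nat assumes "k > 0"
  shows "(1 - 1 / (2 * real k)) ^ (2 * k * (n + 1)) * 2 ^ n < 1"
proof -
  have "(1 - 1 / (2 * real k)) ^ (2 * k * (n + 1)) \<le> (1 / 2) ^ (n + 1)"
    unfolding power_mult[of _ "2 * k" "n + 1"] using half_power[OF assms] assms by (intro power_mono) (auto simp: field_simps)
  then have "(1 - 1 / (2 * real k)) ^ (2 * k * (n + 1)) * 2 ^ n \<le> (1 / 2) ^ (n + 1) * 2 ^ n"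
    by (rule mult_right_mono) simp
  also have "\<dots> < 1" by (simp add: power_divide)
  finally show ?thesis .
qed

text \<open>The origin of \<open>c = n + m + 4\<close>: as \<open>k \<le> 2 ^ m\<close> and
  \<open>n + 1 \<le> 2 ^ n\<close>, the product is at most 4/16.\<close>

lemma failure_bound:
  fixes k n m :: nat assumes "k \<le> 2 ^ m"
  shows "real (2 * k * (n + 1)) * (2 / 2 ^ (n + m + 4)) \<le> 1 / 3"
proof -
  have "n + 1 \<le> 2 ^ n" using less_exp[of n] by linarith
  then have "k * (n + 1) \<le> 2 ^ m * 2 ^ n" using assms by (intro mult_le_mono)
  then have "real (k * (n + 1)) \<le> real (2 ^ m * 2 ^ n)" by (rule of_nat_mono)
  then have "4 * real (k * (n + 1)) \<le> 4 * (2 ^ m * 2 ^ n)" by simp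
  then have "real (2 * k * (n + 1)) * (2 / 2 ^ (n + m + 4)) \<le> 4 * (2 ^ m * 2 ^ n) / 2 ^ (n + m + 4)"
    by (simp add: divide_right_mono)
  also have "\<dots> \<le> 1 / 3" by (simp add: power_add)
  finally show ?thesis .
qed

lemma unfinished_eq:
  assumes F: "is_spec n m F" and ys: "set ys \<subseteq> bits m" and t: "0 < t"
  shows "unfinished (state_tree n m F t ys) = tree_of_bool (uncovered n m F ys \<noteq> 0)"
proof -
  have "tuples t A \<noteq> {} \<longleftrightarrow> A \<noteq> {}" for A
  proof
    assume "A \<noteq> {}"
    then obtain x where "x \<in> A" by blast
    then have "True # concat (replicate t x) \<in> tuples t A"
      unfolding tuples_def by (intro CollectI exI[of _ "replicate t x"]) auto
    then show "tuples t A \<noteq> {}" by blast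
  next
    assume "tuples t A \<noteq> {}"
    then obtain xs where "length xs = t" "set xs \<subseteq> A" by (auto simp: tuples_def)
    then show "A \<noteq> {}" using t by (cases xs) auto
  qed
  then show ?thesis
    using query_empty[OF F ys, of t] by (simp add: unfinished_def uncovered_eq_0)
qed

section \<open>Sizes of inputs and states, and progress per round\<close>

lemma tsize_enc_formula:
  "is_spec n m F \<Longrightarrow> tsize (enc_formula F) \<le> fsize F * (2 * (n + m) + 11)"
proof (induction F)
  case (Const b)
  then show ?case using tsize_tree_of_bool[of b] by simp
next
  case (Atom v)
  then show ?case by (cases v) (auto simp: is_spec_def)
next
  case (Neg F)
  then have "tsize (enc_formula F) \<le> fsize F * (2 * (n + m) + 11)" by (simp add: is_spec_def)
  then show ?case by simp
next
  case (Conj F G)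
  then have "tsize (enc_formula F) \<le> fsize F * (2 * (n + m) + 11)"
    "tsize (enc_formula G) \<le> fsize G * (2 * (n + m) + 11)" by (simp_all add: is_spec_def)
  then show ?case by (simp add: add_mult_distrib)
next
  case (Disj F G)
  then have "tsize (enc_formula F) \<le> fsize F * (2 * (n + m) + 11)"
    "tsize (enc_formula G) \<le> fsize G * (2 * (n + m) + 11)" by (simp_all add: is_spec_def)
  then show ?case by (simp add: add_mult_distrib)
qed

definition spec_bound :: "nat \<Rightarrow> nat" where
  "spec_bound x = 4 + 4 * x + x * (4 * x + 11)"

lemma tsize_enc_spec:
  assumes "is_spec n m F" "n \<le> x" "m \<le> x" "fsize F \<le> x"
  shows "tsize (enc_spec n m F) \<le> spec_bound x"
proof -
  have "fsize F * (2 * (n + m) + 11) \<le> x * (4 * x + 11)" using assms by (intro mult_le_mono) auto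
  with tsize_enc_formula[OF assms(1)] have "tsize (enc_formula F) \<le> x * (4 * x + 11)" by linarith
  then show ?thesis using assms(2,3) by (simp add: enc_spec_def spec_bound_def)
qed

lemma tsize_state_tree:
  assumes "set ys \<subseteq> bits m"
  shows "tsize (state_tree n m F t ys) \<le> tsize (state_tree n m F t []) + length ys * (4 * m + 2)"
  using tsize_rows[OF assms] by (simp add: state_tree_def)

text \<open>The case \<open>k = 0\<close>, where the factor \<open>1 - 1 / (2 * k)\<close> is
  meaningless: an empty image means that no input has an output.\<close>

lemma uncovered_Nil_eq_0:
  assumes sk: "skolem n m F \<Psi>" and k: "card (skolem_image n F \<Psi>) = 0"
  shows "uncovered n m F [] = 0"
proof -
  have "finite (skolem_image n F \<Psi>)" by (rule finite_subset[OF skolem_image_bits[OF sk]]) simp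
  with k have "skolem_image n F \<Psi> = {}" by simp
  then show ?thesis using sk by (auto simp: uncovered_eq_0 cover_def skolem_image_def skolem_def)
qed

lemma near_max_progress:
  assumes sk: "skolem n m F \<Psi>" and k: "card (skolem_image n F \<Psi>) = k" "0 < k"
    and y: "y \<in> bits m" "near_max m (cover n F ys) y"
  shows "real (uncovered n m F (y # ys)) \<le> (1 - 1 / (2 * real k)) * real (uncovered n m F ys)"
proof -
  let ?c = "real (card (cover n F ys y))"
  have "real (uncovered n m F ys) \<le> real (k * (2 * card (cover n F ys y)))"
    by (rule of_nat_mono) (rule uncovered_le_image[OF sk k(1) y(2)])
  then have "real (uncovered n m F ys) / (2 * real k) \<le> ?c"
    using k(2) by (simp add: field_simps)
  moreover have "real (uncovered n m F (y # ys)) + ?c = real (uncovered n m F ys)"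
    using uncovered_Cons[OF y(1), of n F ys] by (simp flip: of_nat_add)
  ultimately show ?thesis by (simp add: algebra_simps)
qed

lemma prob_bits_ge:
  assumes "real (card {r \<in> bits T. \<not> P r}) \<le> 1 / 3 * 2 ^ T" and "\<And>r. r \<in> bits T \<Longrightarrow> P r \<Longrightarrow> r \<in> S"
  shows "measure_pmf.prob (pmf_of_set (bits T)) S \<ge> 2 / 3"
proof -
  have ne: "bits T \<noteq> {}" using card_bits[of T] by (metis card.empty power_eq_0_iff zero_neq_numeral)
  have "card (bits T) = card ({r \<in> bits T. \<not> P r} \<union> {r \<in> bits T. P r})"
    by (rule arg_cong[where f = card]) auto
  also have "\<dots> = card {r \<in> bits T. \<not> P r} + card {r \<in> bits T. P r}"
    by (rule card_Un_disjoint) auto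
  finally have "real (card (bits T)) = real (card {r \<in> bits T. \<not> P r}) + real (card {r \<in> bits T. P r})"
    by simp
  moreover have "card {r \<in> bits T. P r} \<le> card (bits T \<inter> S)"
    using assms(2) by (intro card_mono) auto
  ultimately have "2 / 3 * 2 ^ T \<le> real (card (bits T \<inter> S))" using assms(1) by simp
  then show ?thesis
    by (simp add: measure_pmf_of_set[OF ne] field_simps)
qed

definition state_bound :: "nat \<Rightarrow> nat \<Rightarrow> nat \<Rightarrow> nat" where
  "state_bound a d x = a * spec_bound x ^ d + 2 * x * (x + 1) * (4 * x + 2)"

text \<open>The last summand pays for no computation; it makes a tape of length \<open>T\<close>
  long enough for all blocks of coins.\<close>

definition total_time :: "nat \<Rightarrow> nat \<Rightarrow> nat \<Rightarrow> nat \<Rightarrow> nat \<Rightarrow> nat \<Rightarrow> nat \<Rightarrow> nat \<Rightarrow> nat \<Rightarrow> nat \<Rightarrow> nat \<Rightarrow> nat \<Rightarrow> nat \<Rightarrow> nat" where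
  "total_time a0 d0 a1 d1 a2 d2 a3 d3 a4 d4 a5 d5 x =
     a0 * spec_bound x ^ d0 + (1 + state_bound a5 d5 x) + a3 * state_bound a5 d5 x ^ d3 +
     Suc (2 * x * (x + 1)) * (5 + round_time a1 d1 a2 d2 a3 d3 (state_bound a5 d5 x)) +
     a4 * state_bound a5 d5 x ^ d4 + 2 * x * (x + 1) * (state_bound a5 d5 x * state_bound a5 d5 x)"

lemma pbd_total_time: "pbd (\<lambda>v. total_time a0 d0 a1 d1 a2 d2 a3 d3 a4 d4 a5 d5 (tsize v))"
  unfolding total_time_def state_bound_def spec_bound_def round_time_def node_bound_def toss_row_time_def
  by (intro pbd_intros)

lemma synthesizer_works:
  assumes cs: "implements search_lang 0 cs setup_state ps" and ps: "\<And>v. ps v \<le> a0 * tsize v ^ d0"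
    and cp: "implements search_lang 1 cp pick pp" and pp: "\<And>v. pp v \<le> a1 * tsize v ^ d1"
    and pick: "\<And>v. tsize (pick v) \<le> a2 * tsize v ^ d2"
    and cq: "implements search_lang 1 cq unfinished pq" and pq: "\<And>v. pq v \<le> a3 * tsize v ^ d3"
    and co: "implements search_lang 0 co all_circuits po" and po: "\<And>v. po v \<le> a4 * tsize v ^ d4"
    and setup_size: "\<And>v. tsize (setup_state v) \<le> a5 * tsize v ^ d5"
    and F: "is_spec n m F" and sk: "skolem n m F \<Psi>" and k: "card (skolem_image n F \<Psi>) = k"
    and x: "n \<le> x" "m \<le> x" "fsize F \<le> x" "k \<le> x"
    and T: "total_time a0 d0 a1 d1 a2 d2 a3 d3 a4 d4 a5 d5 x \<le> T"
  shows "synthesizes_within search_lang (synthesizer cs cp cq co) n m F T"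
proof -
  define t where "t = 3 * m + 2 * n + 9"
  define N where "N = t * n + 1"
  define M where "M = N * N"
  define R where "R = 2 * k * (n + 1)"
  define d where "d = uncovered n m F"
  define enc where "enc = state_tree n m F t"
  define Z where "Z = state_bound a5 d5 x"
  define I where "I ys \<longleftrightarrow> set ys \<subseteq> bits m" for ys :: "bool list list"
  \<comment> \<open>\<open>step\<close> models a round on lists of outputs. The output is recovered
    from the resulting tree by choice, because \<open>pick_survivor\<close> only asserts that one
    exists.\<close>
  define chosen where "chosen ys r y \<longleftrightarrow> survivor m N t (cover n F ys) r y \<and>
    pick (Node (enc ys) (enc_list (map enc_bits (hash_rows N N r)))) = enc (y # ys)" for ys r y
  define step where "step ys r = (SOME y. chosen ys r y) # ys" for ys r
  have t: "0 < t" "t = m + 2 * (n + m + 4) + 1" by (simp_all add: t_def)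
  have unf: "unfinished (enc ys) = tree_of_bool (d ys \<noteq> 0)" if "I ys" for ys
    using unfinished_eq[OF F _ t(1)] that by (simp add: enc_def d_def I_def)
  have chosen: "chosen ys r (hd (step ys r))" "hd (step ys r) \<in> bits m" if "I ys" "d ys \<noteq> 0" "r \<in> bits M" for ys r
  proof -
    have ys: "set ys \<subseteq> bits m" using that(1) by (simp add: I_def)
    have "Node (enc ys) (Node Leaf Leaf) \<in> search_lang"
      using unf[OF that(1)] that(2) by (simp add: unfinished_def tree_of_bool_def split: if_splits)
    then have "Node (state_tree n m F t ys) (Node (enc_list (map enc_bits [])) (enc_bits [])) \<in> search_lang"
      by (simp add: enc_def)
    from pick_survivor[OF F ys N_def that(3)[unfolded M_def] this]
    have "\<exists>y. chosen ys r y" by (simp add: chosen_def enc_def)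
    then show "chosen ys r (hd (step ys r))" unfolding step_def by (simp add: someI_ex)
    then show "hd (step ys r) \<in> bits m" by (simp add: chosen_def survivor_def)
  qed
  have step_Cons: "step ys r = hd (step ys r) # ys" for ys r by (simp add: step_def)
  have inv: "I (step ys r) \<and> length (step ys r) = Suc (length ys)"
    if "I ys" "d ys \<noteq> 0" "r \<in> bits M" for ys r
    using chosen(2)[OF that] that(1) by (subst (1 2) step_Cons) (auto simp: I_def)

  have fail: "real (card {r \<in> bits (R * M). \<not> finishes d step M R [] r}) \<le> 1 / 3 * 2 ^ (R * M)"
  proof (cases "k = 0")
    case True
    then have "d [] = 0" using uncovered_Nil_eq_0[OF sk] k by (simp add: d_def)
    then show ?thesis using True by (simp add: R_def)
  next
    case False
    let ?\<rho> = "1 - 1 / (2 * real k)" and ?\<delta> = "2 / 2 ^ (n + m + 4) :: real"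
    have "real (card {r \<in> bits (R * M). \<not> finishes d step M R [] r}) \<le> real R * ?\<delta> * 2 ^ (R * M)"
    proof (rule card_not_finishes[where I = I and \<rho> = ?\<rho>])
      show "I (step ys r)" if "I ys" "d ys \<noteq> 0" "r \<in> bits M" for ys r
        using inv[OF that] by simp
      show "0 \<le> ?\<rho>" using False by (simp add: field_simps)
      show "I []" by (simp add: I_def)
      have "?\<rho> ^ R * real (d []) \<le> ?\<rho> ^ R * 2 ^ n"
        using \<open>0 \<le> ?\<rho>\<close> uncovered_le[of n m F "[]"] unfolding d_def
        by (intro mult_left_mono) (simp_all flip: of_nat_le_iff)
      also have "\<dots> < 1" unfolding R_def using False by (intro decay) simp
      finally show "?\<rho> ^ R * real (d []) < 1" .
      fix ys assume ys: "I ys" "d ys \<noteq> 0"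
      \<comment> \<open>If \<open>d\<close> does not contract, then the survivor that was picked is
        not near-maximal, an event already counted in \<open>survivor_near_max\<close>.\<close>
      have "{r \<in> bits M. \<not> real (d (step ys r)) \<le> ?\<rho> * real (d ys)} \<subseteq>
        {r \<in> bits (N * N). \<not> (\<forall>y. survivor m N t (cover n F ys) r y \<longrightarrow> near_max m (cover n F ys) y)}"
      proof clarify
        fix r assume r: "r \<in> bits M" "\<not> real (d (step ys r)) \<le> ?\<rho> * real (d ys)"
        have sv: "survivor m N t (cover n F ys) r (hd (step ys r))"
          using chosen(1)[OF ys r(1)] by (simp add: chosen_def)
        have "\<not> near_max m (cover n F ys) (hd (step ys r))"
        proof
          assume "near_max m (cover n F ys) (hd (step ys r))"
          from near_max_progress[OF sk k _ chosen(2)[OF ys r(1)] this] False r(2) show False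
            unfolding d_def by (simp flip: step_Cons)
        qed
        with sv r(1) show "r \<in> bits (N * N) \<and>
            \<not> (\<forall>y. survivor m N t (cover n F ys) r y \<longrightarrow> near_max m (cover n F ys) y)"
          unfolding M_def by blast
      qed
      then have "card {r \<in> bits M. \<not> real (d (step ys r)) \<le> ?\<rho> * real (d ys)} \<le>
        card {r \<in> bits (N * N). \<not> (\<forall>y. survivor m N t (cover n F ys) r y \<longrightarrow> near_max m (cover n F ys) y)}"
        by (rule card_mono[rotated]) simp
      then have "card {r \<in> bits M. \<not> real (d (step ys r)) \<le> ?\<rho> * real (d ys)} * 2 ^ (n + m + 4) \<le> 2 * 2 ^ M"
        unfolding M_def
        using survivor_near_max[where A = "cover n F ys" and c = "n + m + 4" and m = m, OF cover_bits t(2) N_def]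
        by (meson le_trans mult_le_mono1)
      then have "real (card {r \<in> bits M. \<not> real (d (step ys r)) \<le> ?\<rho> * real (d ys)} * 2 ^ (n + m + 4))
          \<le> real (2 * 2 ^ M)" by (rule of_nat_mono)
      then show "real (card {r \<in> bits M. \<not> real (d (step ys r)) \<le> ?\<rho> * real (d ys)}) \<le> ?\<delta> * 2 ^ M"
        by (simp add: field_simps)
    qed simp
    also have "\<dots> \<le> 1 / 3 * 2 ^ (R * M)"
      unfolding R_def using failure_bound[of k m n] card_skolem_image_le[OF sk] k
      by (intro mult_right_mono) auto
    finally show ?thesis .
  qed

  have enc0: "setup_state (enc_spec n m F) = enc []"
    unfolding enc_def t_def by (rule setup_state_spec)
  have spec: "tsize (enc_spec n m F) \<le> spec_bound x" by (rule tsize_enc_spec[OF F x(1-3)])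
  have Z0: "tsize (enc []) \<le> a5 * spec_bound x ^ d5"
    unfolding enc0[symmetric] using setup_size spec by (meson order_trans mult_le_mono2 power_mono zero_le)
  have Rx: "R \<le> 2 * x * (x + 1)" unfolding R_def using x(1,4) by (intro mult_le_mono) auto
  have encZ: "tsize (enc ys) \<le> Z" if "I ys" "length ys \<le> R" for ys
  proof -
    have "length ys * (4 * m + 2) \<le> 2 * x * (x + 1) * (4 * x + 2)"
      using that(2) Rx x(2) by (intro mult_le_mono) auto
    with tsize_state_tree[of ys m n F t] that(1) Z0 show ?thesis
      by (simp add: Z_def state_bound_def enc_def I_def)
  qed
  have NZ: "N \<le> Z" using encZ[of "[]"] by (simp add: I_def enc_def state_tree_def base_tree_def N_def)
  have rowlen: "val row_length s = enc_nat N" if "s 0 = enc ys" for s ys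
    using that by (simp add: row_length_def enc_def state_tree_def base_tree_def N_def)
  let ?B = "round_time a1 d1 a2 d2 a3 d3 Z"
  have round: "\<exists>t' s'. exec search_lang (greedy_round cp cq) s r t' s' (drop M r) \<and>
      s' 0 = enc (step ys (take M r)) \<and> s' 1 = tree_of_bool (d (step ys (take M r)) \<noteq> 0) \<and> t' \<le> ?B"
    if ys: "I ys" "length ys < R" "d ys \<noteq> 0" and s: "s 0 = enc ys" and r: "M \<le> length r" for ys s r
  proof -
    have tr: "take M r \<in> bits M" using r by (simp add: bits_def)
    have Zs: "tsize (s 0) \<le> Z" unfolding s using ys by (intro encZ) auto
    obtain t' s' where *: "exec search_lang (greedy_round cp cq) s r t' s' (drop (N * N) r)"
      "s' 0 = pick (Node (s 0) (enc_list (map enc_bits (hash_rows N N r))))" "s' 1 = unfinished (s' 0)" "t' \<le> ?B"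
      using exec_greedy_round[OF cp pp pick cq pq rowlen[where s = s and ys = ys, OF s] Zs NZ r[unfolded M_def]] by blast
    have "s' 0 = enc (step ys (take M r))"
      using *(2) chosen(1)[OF ys(1,3) tr] step_Cons[of ys "take M r"]
      by (simp add: chosen_def s M_def hash_rows_take)
    moreover have "s' 1 = tree_of_bool (d (step ys (take M r)) \<noteq> 0)"
      unfolding *(3) calculation using inv[OF ys(1,3) tr] by (intro unf) simp
    ultimately show ?thesis using * unfolding M_def by blast
  qed
  have RMT: "R * M \<le> T"
  proof -
    have "R * M \<le> 2 * x * (x + 1) * (Z * Z)" unfolding M_def by (intro mult_le_mono Rx NZ)
    also have "\<dots> \<le> T" using T unfolding total_time_def Z_def by linarith
    finally show ?thesis .
  qed
  have run: "run_succeeds search_lang (synthesizer cs cp cq co) n m F T r"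
    if r: "r \<in> bits T" "finishes d step M R [] (take (R * M) r)" for r
  proof -
    let ?s0 = "init (enc_spec n m F)"
    obtain t1 s1 where 1: "exec search_lang cs ?s0 r t1 s1 r" "s1 0 = enc []" "t1 \<le> ps (enc_spec n m F)"
      by (rule implementsE[OF cs, where s = ?s0 and r = r]) (simp add: init_def enc0)
    let ?s2 = "s1(1 := val (Var 0) s1)"
    have s2: "?s2 1 = enc []" using 1(2) by simp
    obtain t3 s3 where 3: "exec search_lang cq ?s2 r t3 s3 r" "s3 1 = unfinished (?s2 1)" "s3 0 = ?s2 0" "t3 \<le> pq (?s2 1)"
      by (rule implementsE[OF cq, where s = ?s2 and r = r]) force
    have nil: "I []" by (simp add: I_def)
    have fin: "finishes d step M R [] r" using r(2) by (simp add: finishes_take)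
    have lr: "R * M \<le> length r" using r(1) RMT by (simp add: bits_def)
    have s3: "s3 0 = enc []" "s3 1 = tree_of_bool (d [] \<noteq> 0)" using 3 s2 1(2) unf[OF nil] by simp_all
    have "length ([] :: bool list list) + R \<le> R" by simp
    from exec_greedy_loop[where I = I and lev = length and d = d and enc = enc and step = step and W = R
        and Bd = ?B, OF round inv fin nil this lr s3]
    obtain t4 s4 r4 ys where 4: "exec search_lang (While (Var 1) (greedy_round cp cq)) s3 r t4 s4 r4"
      "s4 0 = enc ys" "d ys = 0" "I ys" "length ys \<le> R" "t4 \<le> Suc R * (5 + ?B)" by blast
    obtain t5 s5 where 5: "exec search_lang co s4 r4 t5 s5 r4" "s5 0 = all_circuits (s4 0)" "t5 \<le> po (s4 0)"
      by (rule implementsE[OF co, where s = s4 and r = r4]) blast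
    let ?t = "t1 + ((1 + cost (Var 0) s1) + (t3 + (t4 + t5)))"
    have ex: "exec search_lang (synthesizer cs cp cq co) ?s0 r ?t s5 r4"
      unfolding synthesizer_def
      by (rule exec.Seq[OF 1(1) exec.Seq[OF exec.Assign exec.Seq[OF 3(1) exec.Seq[OF 4(1) 5(1)]]]])
    have ys: "set ys \<subseteq> bits m" using 4(4) by (simp add: I_def)
    obtain Cs where Cs: "all_circuits (enc ys) = enc_circuits Cs" "length Cs = m"
      "\<forall>C \<in> set Cs. circuit_ok n C" "\<forall>i<m. \<forall>x \<in> bits n. circuit_fun (Cs ! i) x = select F ys i x"
      using all_circuits_correct[OF F ys, of t] unfolding enc_def by blast
    have covered: "\<forall>y \<in> bits m. cover n F ys y = {}" using 4(3) by (simp add: d_def uncovered_eq_0)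
    have "skolem n m F (map circuit_fun Cs)" by (rule skolem_circuits[OF F ys covered Cs(2,4)])
    moreover have "?t \<le> T"
    proof -
      have "ps (enc_spec n m F) \<le> a0 * spec_bound x ^ d0"
        using ps spec by (meson order_trans mult_le_mono2 power_mono zero_le)
      moreover have Z1: "tsize (enc []) \<le> Z" by (rule encZ[OF nil]) simp
      moreover have "cost (Var 0) s1 = tsize (enc [])" using 1(2) by simp
      moreover have "pq (enc []) \<le> a3 * Z ^ d3"
        using pq Z1 by (meson order_trans mult_le_mono2 power_mono zero_le)
      moreover have "po (enc ys) \<le> a4 * Z ^ d4"
        using po encZ[OF 4(4,5)] by (meson order_trans mult_le_mono2 power_mono zero_le)
      moreover have "Suc R * (5 + ?B) \<le> Suc (2 * x * (x + 1)) * (5 + ?B)"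
        using Rx by (intro mult_le_mono1) simp
      moreover have "t3 \<le> pq (enc [])" "t5 \<le> po (enc ys)" using 3(4) 5(3) 4(2) s2 by simp_all
      ultimately have "?t \<le> total_time a0 d0 a1 d1 a2 d2 a3 d3 a4 d4 a5 d5 x"
        unfolding total_time_def Z_def[symmetric] using 1(3) 4(6) by linarith
      then show ?thesis using T by (rule order_trans)
    qed
    ultimately show ?thesis
      unfolding run_succeeds_def using ex Cs(1,3) 4(2) 5(2) by auto
  qed
  show ?thesis
    unfolding synthesizes_within_def
  proof (rule prob_bits_ge)
    have "card {r \<in> bits T. \<not> finishes d step M R [] (take (R * M) r)} =
        card {r \<in> bits (R * M). \<not> finishes d step M R [] r} * 2 ^ (T - R * M)"
      by (rule card_bits_take[OF RMT])
    then have "real (card {r \<in> bits T. \<not> finishes d step M R [] (take (R * M) r)}) \<le>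
        1 / 3 * 2 ^ (R * M) * 2 ^ (T - R * M)"
      using mult_right_mono[OF fail, of "2 ^ (T - R * M)"] by simp
    also have "\<dots> = 1 / 3 * 2 ^ T" using RMT by (simp flip: power_add)
    finally show "real (card {r \<in> bits T. \<not> finishes d step M R [] (take (R * M) r)}) \<le> 1 / 3 * 2 ^ T" .
  qed (use run in simp)
qed

theorem theorem8:
  "\<exists>L \<in> NP. \<exists>A a d. \<forall>n m F k.
     is_spec n m F \<longrightarrow>
     (\<exists>\<Psi>. skolem n m F \<Psi> \<and> card (skolem_image n F \<Psi>) = k) \<longrightarrow>
     synthesizes_within L A n m F (a * (n + m + fsize F + k) ^ d)"
proof -
  have bound: "\<exists>a d. \<forall>v. f v \<le> a * tsize v ^ d" if "pbd f" for f
    using that by (simp add: pbd_def)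
  obtain cs ps where cs: "pbd ps" "implements search_lang 0 cs setup_state ps"
    using pt_setup_state[of search_lang] unfolding ptime_def by blast
  obtain cp pp where cp: "pbd pp" "implements search_lang 1 cp pick pp"
    using pt_pick unfolding ptime_def by blast
  obtain cq pq where cq: "pbd pq" "implements search_lang 1 cq unfinished pq"
    using pt_unfinished unfolding ptime_def by blast
  obtain co po where co: "pbd po" "implements search_lang 0 co all_circuits po"
    using pt_all_circuits[of search_lang] unfolding ptime_def by blast
  obtain a0 d0 where 0: "\<And>v. ps v \<le> a0 * tsize v ^ d0" using bound[OF cs(1)] by blast
  obtain a1 d1 where 1: "\<And>v. pp v \<le> a1 * tsize v ^ d1" using bound[OF cp(1)] by blast
  obtain a2 d2 where 2: "\<And>v. tsize (pick v) \<le> a2 * tsize v ^ d2"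
    using bound[OF ptime_size[OF pt_pick]] by blast
  obtain a3 d3 where 3: "\<And>v. pq v \<le> a3 * tsize v ^ d3" using bound[OF cq(1)] by blast
  obtain a4 d4 where 4: "\<And>v. po v \<le> a4 * tsize v ^ d4" using bound[OF co(1)] by blast
  obtain a5 d5 where 5: "\<And>v. tsize (setup_state v) \<le> a5 * tsize v ^ d5"
    using bound[OF ptime_size[OF pt_setup_state]] by blast
  let ?time = "total_time a0 d0 a1 d1 a2 d2 a3 d3 a4 d4 a5 d5"
  obtain a d where ad: "\<And>v. ?time (tsize v) \<le> a * tsize v ^ d"
    using bound[OF pbd_total_time] by blast
  have "synthesizes_within search_lang (synthesizer cs cp cq co) n m F
      (a * 3 ^ d * (n + m + fsize F + k) ^ d)"
    if F: "is_spec n m F" and sk: "skolem n m F \<Psi>" "card (skolem_image n F \<Psi>) = k" for n m F k \<Psi>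
  proof (rule synthesizer_works[OF cs(2) 0 cp(2) 1 2 cq(2) 3 co(2) 4 5 F sk])
    let ?X = "n + m + fsize F + k"
    \<comment> \<open>\<open>pbd\<close> measures trees, so the unary encoding of \<open>?X\<close>
      stands in for the number. Its size \<open>2 * ?X + 1\<close> is at most \<open>3 * ?X\<close>
      because \<open>?X\<close> is positive.\<close>
    have "fsize F \<ge> 1" by (cases F) auto
    then have "tsize (enc_nat ?X) \<le> 3 * ?X" by simp
    then have "a * tsize (enc_nat ?X) ^ d \<le> a * (3 * ?X) ^ d" by (intro mult_le_mono2 power_mono) simp_all
    also have "\<dots> = a * 3 ^ d * ?X ^ d" unfolding power_mult_distrib by simp
    finally show "?time (tsize (enc_nat ?X)) \<le> a * 3 ^ d * ?X ^ d"
      using ad[of "enc_nat ?X"] by (rule order_trans[rotated])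
  qed simp_all
  then show ?thesis using search_lang_NP by blast
qed

end
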